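(* Let $\{V_j\}_{j\in\mathbb{Z}}$ be a multiresolution analysis (MRA) of $L^2(\mathbb{R}^n)$ that admits a scaling function $\phi\in\mathcal{S}(\mathbb{R}^n)$, and let $f\in\mathcal{S}'(\mathbb{R}^n)$. Then $$\lim_{j\to\infty}(q_jf)(\mathbf{x}_0)=f(\mathbf{x}_0)$$ at every point $\mathbf{x}_0\in\mathbb{R}^n$ where the distributional point value $f(\mathbf{x}_0)$ of $f$ exists.
   Context: MRA: an increasing sequence $\{V_j\}_{j\in\mathbb{Z}}$ of closed linear subspaces of $L^2(\mathbb{R}^n)$ such that (i) $f\in V_j\Leftrightarrow f(2\,\cdot)\in V_{j+1}$; (ii) $f\in V_0\Leftrightarrow f(\cdot-\mathbf{m})\in V_0$ for $\mathbf{m}\in\mathbb{Z}^n$; (iii) $\bigcap_jV_j=\{0\}$ and $\overline{\bigcup_jV_j}=L^2(\mathbb{R}^n)$; (iv) there is $\phi\in L^2(\mathbb{R}^n)$, called a scaling function, such that $\{\phi(\cdot-\mathbf{m})\}_{\mathbf{m}\in\mathbb{Z}^n}$ is an orthonormal basis of $V_0$. Projections: $q_0(\mathbf{x},\mathbf{y})=\sum_{\mathbf{m}\in\mathbb{Z}^n}\phi(\mathbf{x}-\mathbf{m})\overline{\phi(\mathbf{y}-\mathbf{m})}$ is the reproducing kernel of $V_0$, and $q_j(\mathbf{x},\mathbf{y})=2^{nj}q_0(2^j\mathbf{x},2^j\mathbf{y})$. On $L^2(\mathbb{R}^n)$, $q_j$ is the orthogonal projection onto $V_j$. For $\phi\in\mathcal{S}(\mathbb{R}^n)$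 one has $q_j(\mathbf{x},\cdot)\in\mathcal{S}(\mathbb{R}^n)$ for each $\mathbf{x}$, and for $f\in\mathcal{S}'(\mathbb{R}^n)$ one defines $(q_jf)(\mathbf{x})=\langle f(\mathbf{y}),q_j(\mathbf{x},\mathbf{y})\rangle_{\mathbf{y}}$ (bilinear pairing). Distributional point value: $f(\mathbf{x}_0)=\gamma$ distributionally means that $\lim_{\varepsilon\to0}\langle f(\mathbf{x}_0+\varepsilon\mathbf{x}),\varphi(\mathbf{x})\rangle=\gamma\int_{\mathbb{R}^n}\varphi(\mathbf{x})\,d\mathbf{x}$ for every $\varphi\in\mathcal{D}(\mathbb{R}^n)$, where $\langle f(\mathbf{x}_0+\varepsilon\mathbf{x}),\varphi(\mathbf{x})\rangle=|\varepsilon|^{-n}\langle f(\mathbf{y}),\varphi((\mathbf{y}-\mathbf{x}_0)/\varepsilon)\rangle$. *)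

theory Defs
  imports "HOL-Analysis.Analysis"
begin

section \<open>The space of square-integrable functions\<close>

text \<open>
  The elements of the Hilbert space are represented by Borel functions, not by classes modulo
  equality almost everywhere. A set of classes corresponds to a set of functions that is invariant
  under equality almost everywhere; a set that is closed in the sense of \<open>L2_closed_subspace\<close> below
  has this invariance, because the closure is taken with respect to the seminorm \<open>L2_norm\<close>.
\<close>

definition L2_space :: "(real ^ 'n \<Rightarrow> complex) set" where
  "L2_space = {f \<in> borel_measurable lborel. integrable lborel (\<lambda>x. (norm (f x))\<^sup>2)}"

definition L2_inner :: "(real ^ 'n \<Rightarrow> complex) \<Rightarrow> (real ^ 'n \<Rightarrow> complex) \<Rightarrow> complex" where
  "L2_inner f g = (LINT x|lborel. f x * cnj (g x))"

definition L2_norm :: "(real ^ 'n \<Rightarrow> complex) \<Rightarrow> real" where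
  "L2_norm f = sqrt (LINT x|lborel. (norm (f x))\<^sup>2)"

definition L2_closure :: "(real ^ 'n \<Rightarrow> complex) set \<Rightarrow> (real ^ 'n \<Rightarrow> complex) set" where
  "L2_closure S = {g \<in> L2_space. \<forall>e>0. \<exists>h\<in>S. L2_norm (\<lambda>x. g x - h x) < e}"

definition L2_closed_subspace :: "(real ^ 'n \<Rightarrow> complex) set \<Rightarrow> bool" where
  "L2_closed_subspace S \<longleftrightarrow>
     S \<subseteq> L2_space \<and>
     (\<lambda>x. 0) \<in> S \<and>
     (\<forall>f\<in>S. \<forall>g\<in>S. (\<lambda>x. f x + g x) \<in> S) \<and>
     (\<forall>c. \<forall>f\<in>S. (\<lambda>x. c * f x) \<in> S) \<and>
     L2_closure S = S"

definition complex_span :: "('i \<Rightarrow> real ^ 'n \<Rightarrow> complex) \<Rightarrow> (real ^ 'n \<Rightarrow> complex) set" where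
  "complex_span e = {(\<lambda>x. \<Sum>i\<in>I. c i * e i x) | I c. finite I}"

definition orthonormal_basis ::
  "('i \<Rightarrow> real ^ 'n \<Rightarrow> complex) \<Rightarrow> (real ^ 'n \<Rightarrow> complex) set \<Rightarrow> bool" where
  "orthonormal_basis e S \<longleftrightarrow>
     (\<forall>i. e i \<in> S) \<and>
     (\<forall>i k. L2_inner (e i) (e k) = (if i = k then 1 else 0)) \<and>
     L2_closure (complex_span e) = S"


section \<open>Multiresolution analyses\<close>

definition lattice_point :: "int ^ 'n \<Rightarrow> real ^ 'n" where
  "lattice_point m = (\<chi> i. of_int (m $ i))"

definition scaling_function ::
  "(int \<Rightarrow> (real ^ 'n \<Rightarrow> complex) set) \<Rightarrow> (real ^ 'n \<Rightarrow> complex) \<Rightarrow> bool" where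
  "scaling_function V \<phi> \<longleftrightarrow>
     \<phi> \<in> L2_space \<and> orthonormal_basis (\<lambda>m x. \<phi> (x - lattice_point m)) (V 0)"

definition MRA :: "(int \<Rightarrow> (real ^ 'n \<Rightarrow> complex) set) \<Rightarrow> bool" where
  "MRA V \<longleftrightarrow>
     mono V \<and>
     (\<forall>j. L2_closed_subspace (V j)) \<and>
     (\<forall>j f. f \<in> V j \<longleftrightarrow> (\<lambda>x. f (2 *\<^sub>R x)) \<in> V (j + 1)) \<and>
     (\<forall>m f. f \<in> V 0 \<longleftrightarrow> (\<lambda>x. f (x - lattice_point m)) \<in> V 0) \<and>
     (\<Inter>j. V j) = {f \<in> L2_space. AE x in lborel. f x = 0} \<and>
     L2_closure (\<Union>j. V j) = L2_space \<and>
     (\<exists>\<phi>. scaling_function V \<phi>)"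


section \<open>Test functions and tempered distributions\<close>

definition partial_deriv :: "'n \<Rightarrow> (real ^ 'n \<Rightarrow> complex) \<Rightarrow> real ^ 'n \<Rightarrow> complex" where
  "partial_deriv i f x = frechet_derivative f (at x) (axis i 1)"

text \<open>
  Iterated partial derivatives are indexed by the list of the directions of differentiation instead
  of a multi-index; on smooth functions their order is immaterial.
\<close>

primrec partial_derivs :: "'n list \<Rightarrow> (real ^ 'n \<Rightarrow> complex) \<Rightarrow> real ^ 'n \<Rightarrow> complex" where
  "partial_derivs [] f = f"
| "partial_derivs (i # is) f = partial_deriv i (partial_derivs is f)"

definition smooth :: "(real ^ 'n \<Rightarrow> complex) \<Rightarrow> bool" where
  "smooth f \<longleftrightarrow> (\<forall>is x. partial_derivs is f differentiable (at x))"

definition schwartz_space :: "(real ^ 'n \<Rightarrow> complex) set" where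
  "schwartz_space =
     {f. smooth f \<and>
         (\<forall>k is. bdd_above (range (\<lambda>x. (1 + norm x) ^ k * norm (partial_derivs is f x))))}"

definition schwartz_seminorm :: "nat \<Rightarrow> 'n list \<Rightarrow> (real ^ 'n \<Rightarrow> complex) \<Rightarrow> real" where
  "schwartz_seminorm k is f = (SUP x. (1 + norm x) ^ k * norm (partial_derivs is f x))"

definition schwartz_topology :: "(real ^ 'n \<Rightarrow> complex) topology" where
  "schwartz_topology = topology_generated_by
     {{g \<in> schwartz_space. schwartz_seminorm k is (\<lambda>x. g x - f x) < e} | f k is e.
        f \<in> schwartz_space \<and> e > 0}"

text \<open>
  A tempered distribution is a function on all of \<^typ>\<open>real ^ 'n \<Rightarrow> complex\<close> of which only the
  restriction to \<open>schwartz_space\<close> matters.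
\<close>

definition tempered_distribution :: "((real ^ 'n \<Rightarrow> complex) \<Rightarrow> complex) \<Rightarrow> bool" where
  "tempered_distribution T \<longleftrightarrow>
     (\<forall>f\<in>schwartz_space. \<forall>g\<in>schwartz_space. T (\<lambda>x. f x + g x) = T f + T g) \<and>
     (\<forall>c. \<forall>f\<in>schwartz_space. T (\<lambda>x. c * f x) = c * T f) \<and>
     continuous_map schwartz_topology euclidean T"

definition compact_test_functions :: "(real ^ 'n \<Rightarrow> complex) set" where
  "compact_test_functions = {f. smooth f \<and> compact (closure {x. f x \<noteq> 0})}"

definition has_point_value ::
  "((real ^ 'n \<Rightarrow> complex) \<Rightarrow> complex) \<Rightarrow> real ^ 'n \<Rightarrow> complex \<Rightarrow> bool" where
  "has_point_value T x0 \<gamma> \<longleftrightarrow>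
     (\<forall>\<psi>\<in>compact_test_functions.
        ((\<lambda>\<epsilon>::real. of_real (1 / \<bar>\<epsilon>\<bar> ^ CARD('n)) * T (\<lambda>y. \<psi> ((1 / \<epsilon>) *\<^sub>R (y - x0))))
          \<longlongrightarrow> \<gamma> * (LINT x|lborel. \<psi> x)) (at 0))"


section \<open>The projections onto the spaces of the multiresolution analysis\<close>

definition MRA_kernel0 :: "(real ^ 'n \<Rightarrow> complex) \<Rightarrow> real ^ 'n \<Rightarrow> real ^ 'n \<Rightarrow> complex" where
  "MRA_kernel0 \<phi> x y =
     (\<Sum>\<^sub>\<infinity>m\<in>UNIV. \<phi> (x - lattice_point m) * cnj (\<phi> (y - lattice_point m)))"

definition MRA_kernel ::
  "(real ^ 'n \<Rightarrow> complex) \<Rightarrow> int \<Rightarrow> real ^ 'n \<Rightarrow> real ^ 'n \<Rightarrow> complex" where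
  "MRA_kernel \<phi> j x y =
     2 powi (int CARD('n) * j) * MRA_kernel0 \<phi> ((2 powi j) *\<^sub>R x) ((2 powi j) *\<^sub>R y)"

definition MRA_projection ::
  "(real ^ 'n \<Rightarrow> complex) \<Rightarrow> int \<Rightarrow> ((real ^ 'n \<Rightarrow> complex) \<Rightarrow> complex) \<Rightarrow> real ^ 'n \<Rightarrow> complex" where
  "MRA_projection \<phi> j T x = T (\<lambda>y. MRA_kernel \<phi> j x y)"

end

theory Submission
  imports Defs
begin

text \<open>
  Write \<open>T\<^sub>j \<psi> = 2\<^sup>n\<^sup>j \<langle>f(y), \<psi>(2\<^sup>j (y - x\<^sub>0))\<rangle>\<close>. The point value says that
  \<open>T\<^sub>j \<psi> \<rightarrow> \<gamma> \<integral>\<psi>\<close> for test functions \<open>\<psi>\<close> of compact support. The uniform boundedness principle makes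
  the \<open>T\<^sub>j\<close> equicontinuous on the test functions supported in a fixed ball, and a dyadic decomposition
  extends this to Schwartz functions; so the convergence holds for them too, and uniformly over
  translates by vectors of a bounded set.

  With \<open>t\<^sub>j\<close> the fractional part of \<open>2\<^sup>j x\<^sub>0\<close>, periodicity of the kernel gives
  \<open>(q\<^sub>j f)(x\<^sub>0) = \<Sum>m. \<phi>(t\<^sub>j + m) T\<^sub>j(cnj \<phi>(t\<^sub>j + m + \<cdot>))\<close>, which by dominated convergence has the
  same limit as \<open>\<gamma> cnj c \<Sum>m. \<phi>(t\<^sub>j + m)\<close> with \<open>c = \<integral>\<phi>\<close>. It remains to see that \<open>\<Sum>m. \<phi>(t + m) = c\<close>
  for all \<open>t\<close> and \<open>\<bar>c\<bar> = 1\<close>. Approximating the indicator of the unit cube from \<open>V\<^sub>j\<close> and rescaling,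
  the indicator of a cube of side \<open>L = 2\<^sup>j\<close> is nearly in the span of the \<open>\<phi>(\<cdot> - m)\<close>, so its coefficients
  have square sum about \<open>L\<^sup>n\<close>; but up to an error of square sum \<open>O(L\<^sup>n\<^sup>-\<^sup>1)\<close> they are \<open>cnj c\<close> at the
  lattice points of the cube and \<open>0\<close> elsewhere, whence \<open>\<bar>c\<bar> \<ge> 1\<close>. The periodization of \<open>\<phi>\<close> has
  mean \<open>c\<close> and mean square \<open>1\<close>, so it is constant.
\<close>

section \<open>Smooth functions\<close>

text \<open>Two gaps lie between hypothesis and conclusion. The point value is tested only on
  functions of compact support, whereas the kernel is merely a Schwartz function; and the base
  points \<open>t_j\<close> stay in the unit cube but need not converge. One estimate closes both: a
  bound of the dilated functionals by a single Schwartz norm, uniform in the scale. It makes cutting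
  off at a large radius harmless, and with the compactness of the set of translates it removes the
  dependence on \<open>t_j\<close>. That the lattice translates of the scaling function add up to a
  constant is the Strang-Fix condition, usually phrased as vanishing of the Fourier transform at the
  nonzero lattice frequencies. Here it comes from a variance, so that only a lower bound for the
  modulus of \<open>c\<close> remains; this is where the density of the union of the spaces is used.
  The cubes have to be large because the error made in replacing the coefficients by
  \<open>cnj c\<close> or 0 grows like the surface of the cube, and only relative to the volume does
  it become negligible.\<close>

lemma partial_deriv_eq:
  assumes "(f has_derivative D) (at x)"
  shows "partial_deriv i f x = D (axis i 1)"
  unfolding partial_deriv_def using frechet_derivative_at[OF assms] by simp

lemma has_derivative_partial_deriv:
  fixes f :: "real ^ 'n \<Rightarrow> complex"
  assumes "f differentiable (at x)"
  shows "(f has_derivative (\<lambda>h. \<Sum>i\<in>UNIV. of_real (h $ i) * partial_deriv i f x)) (at x)"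
proof -
  let ?D = "frechet_derivative f (at x)"
  have D: "(f has_derivative ?D) (at x)"
    using assms frechet_derivative_works by blast
  then interpret bounded_linear ?D by (rule has_derivative_bounded_linear)
  have "?D h = (\<Sum>i\<in>UNIV. of_real (h $ i) * partial_deriv i f x)" for h
  proof -
    have "?D h = ?D (\<Sum>i\<in>UNIV. (h $ i) *\<^sub>R axis i 1)"
      using basis_expansion[of h] by (simp only: scalar_mult_eq_scaleR)
    also have "\<dots> = (\<Sum>i\<in>UNIV. (h $ i) *\<^sub>R ?D (axis i 1))"
      by (simp only: sum scaleR)
    finally show ?thesis
      by (simp add: partial_deriv_def scaleR_conv_of_real)
  qed
  then show ?thesis using D by presburger
qed

lemma partial_derivs_append:
  "partial_derivs (is @ js) f = partial_derivs is (partial_derivs js f)"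
  by (induction "is") auto

lemma partial_derivs_snoc: "partial_derivs (is @ [i]) f = partial_derivs is (partial_deriv i f)"
  by (simp add: partial_derivs_append)

lemma partial_deriv_cong_open:
  fixes f g :: "real ^ 'n \<Rightarrow> complex"
  assumes "open U" "x \<in> U" "\<And>y. y \<in> U \<Longrightarrow> f y = g y"
  shows "partial_deriv i f x = partial_deriv i g x"
proof -
  have "(f has_derivative D) (at x) \<longleftrightarrow> (g has_derivative D) (at x)" for D
    using has_derivative_transform_within_open[OF _ assms(1,2), where f=f and g=g and f'=D and t=UNIV]
      has_derivative_transform_within_open[OF _ assms(1,2), where f=g and g=f and f'=D and t=UNIV] assms(3) by auto
  then show ?thesis
    by (simp add: partial_deriv_def frechet_derivative_def)
qed

lemma partial_derivs_cong_open:
  fixes f g :: "real ^ 'n \<Rightarrow> complex"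
  assumes "open U" "x \<in> U" "\<And>y. y \<in> U \<Longrightarrow> f y = g y"
  shows "partial_derivs is f x = partial_derivs is g x"
  using assms(2)
proof (induction "is" arbitrary: x)
  case (Cons i "is")
  then show ?case using partial_deriv_cong_open[OF assms(1)] by (metis partial_derivs.simps(2))
qed (simp add: assms)

lemma smoothD: "smooth f \<Longrightarrow> partial_derivs is f differentiable (at x)"
  by (simp add: smooth_def)

lemma smooth_continuous: "smooth f \<Longrightarrow> continuous_on S f"
  by (metis continuous_at_imp_continuous_on differentiable_imp_continuous_within
      partial_derivs.simps(1) smoothD)

lemma smooth_partial_derivs: "smooth f \<Longrightarrow> smooth (partial_derivs is f)"
  unfolding smooth_def by (metis partial_derivs_append)

text \<open>\<open>smooth\<close> quantifies over all lists of directions at once and offers nothing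
  to induct on. Grading by the number of derivatives gives the recursion
  \<open>smooth_upto_Suc\<close>, from which closure under products and compositions follows by
  induction on the order.\<close>

definition smooth_upto :: "nat \<Rightarrow> (real ^ 'n \<Rightarrow> complex) \<Rightarrow> bool" where
  "smooth_upto n f \<longleftrightarrow> (\<forall>is x. length is \<le> n \<longrightarrow> partial_derivs is f differentiable (at x))"

lemma smooth_iff_smooth_upto: "smooth f \<longleftrightarrow> (\<forall>n. smooth_upto n f)"
  by (auto simp: smooth_def smooth_upto_def)

lemma smooth_upto_0: "smooth_upto 0 f \<longleftrightarrow> (\<forall>x. f differentiable (at x))"
  by (simp add: smooth_upto_def)

text \<open>The recursion strips the derivative that is applied first, which is the last entry of
  the list, whereas \<open>partial_derivs\<close> recurses on the one applied last. Hence the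
  passage through \<open>partial_derivs_snoc\<close>.\<close>

lemma smooth_upto_Suc:
  "smooth_upto (Suc n) f \<longleftrightarrow>
     (\<forall>x. f differentiable (at x)) \<and> (\<forall>i. smooth_upto n (partial_deriv i f))"
proof
  assume f: "smooth_upto (Suc n) f"
  have "f differentiable (at x)" for x
    using f unfolding smooth_upto_def by (metis le0 list.size(3) partial_derivs.simps(1))
  moreover have "smooth_upto n (partial_deriv i f)" for i
    using f unfolding smooth_upto_def
    by (metis Suc_le_mono length_append_singleton partial_derivs_snoc)
  ultimately show "(\<forall>x. f differentiable (at x)) \<and> (\<forall>i. smooth_upto n (partial_deriv i f))"
    by blast
next
  assume f: "(\<forall>x. f differentiable (at x)) \<and> (\<forall>i. smooth_upto n (partial_deriv i f))"
  show "smooth_upto (Suc n) f"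
    unfolding smooth_upto_def
  proof (intro allI impI)
    fix "is" :: "'a list" and x
    assume "length is \<le> Suc n"
    then show "partial_derivs is f differentiable (at x)"
      using f unfolding smooth_upto_def
      by (cases "is" rule: rev_cases) (auto simp: partial_derivs_snoc)
  qed
qed

lemma smooth_upto_mono: "smooth_upto n f \<Longrightarrow> m \<le> n \<Longrightarrow> smooth_upto m f"
  by (auto simp: smooth_upto_def)

lemma smooth_upto_differentiable: "smooth_upto n f \<Longrightarrow> f differentiable (at x)"
  using smooth_upto_mono[of n f 0] by (simp add: smooth_upto_0)

lemma partial_deriv_add:
  assumes "\<And>x. f differentiable (at x)" "\<And>x. g differentiable (at x)"
  shows "partial_deriv i (\<lambda>x. f x + g x) = (\<lambda>x. partial_deriv i f x + partial_deriv i g x)"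
  using assms unfolding frechet_derivative_works
  by (auto intro!: partial_deriv_eq[THEN trans] has_derivative_add simp: partial_deriv_def)

lemma partial_deriv_cmult:
  assumes "\<And>x. f differentiable (at x)"
  shows "partial_deriv i (\<lambda>x. c * f x) = (\<lambda>x. c * partial_deriv i f x)"
  using assms unfolding frechet_derivative_works
  by (auto intro!: partial_deriv_eq[THEN trans] has_derivative_mult_right simp: partial_deriv_def)

lemma partial_deriv_mult:
  assumes "\<And>x. f differentiable (at x)" "\<And>x. g differentiable (at x)"
  shows "partial_deriv i (\<lambda>x. f x * g x) = (\<lambda>x. partial_deriv i f x * g x + f x * partial_deriv i g x)"
proof
  fix x
  have "((\<lambda>x. f x * g x) has_derivative
      (\<lambda>h. f x * frechet_derivative g (at x) h + frechet_derivative f (at x) h * g x)) (at x)"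
    using assms unfolding frechet_derivative_works by (intro has_derivative_mult) auto
  then show "partial_deriv i (\<lambda>x. f x * g x) x = partial_deriv i f x * g x + f x * partial_deriv i g x"
    by (simp add: partial_deriv_eq) (simp add: partial_deriv_def)
qed

lemma partial_deriv_const [simp]: "partial_deriv i (\<lambda>x. c) = (\<lambda>x. 0)"
  using partial_deriv_eq[OF has_derivative_const] by fastforce

lemma partial_deriv_linear:
  assumes "bounded_linear L" "\<And>x. f differentiable (at x)"
  shows "partial_deriv i (\<lambda>x. L (f x)) = (\<lambda>x. L (partial_deriv i f x))"
  using assms unfolding frechet_derivative_works
  by (auto intro!: partial_deriv_eq[THEN trans] bounded_linear.has_derivative[OF assms(1)] simp: partial_deriv_def)

lemma smooth_upto_add: "smooth_upto n f \<Longrightarrow> smooth_upto n g \<Longrightarrow> smooth_upto n (\<lambda>x. f x + g x)"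
  by (induction n arbitrary: f g) (auto simp: smooth_upto_0 smooth_upto_Suc partial_deriv_add)

lemma smooth_upto_mult: "smooth_upto n f \<Longrightarrow> smooth_upto n g \<Longrightarrow> smooth_upto n (\<lambda>x. f x * g x)"
proof (induction n arbitrary: f g)
  case (Suc n)
  then show ?case
    using smooth_upto_mono[OF Suc.prems(1), of n] smooth_upto_mono[OF Suc.prems(2), of n]
    by (auto simp: smooth_upto_Suc partial_deriv_mult intro!: smooth_upto_add)
qed (auto simp: smooth_upto_0)

lemma smooth_const [simp]: "smooth (\<lambda>x. c)"
proof -
  have "smooth_upto n (\<lambda>x. c)" for n
    by (induction n arbitrary: c) (auto simp: smooth_upto_0 smooth_upto_Suc)
  then show ?thesis unfolding smooth_iff_smooth_upto by blast
qed

lemma smooth_add: "smooth f \<Longrightarrow> smooth g \<Longrightarrow> smooth (\<lambda>x. f x + g x)"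
  by (simp add: smooth_iff_smooth_upto smooth_upto_add)

lemma smooth_mult: "smooth f \<Longrightarrow> smooth g \<Longrightarrow> smooth (\<lambda>x. f x * g x)"
  by (simp add: smooth_iff_smooth_upto smooth_upto_mult)

lemma smooth_diff: "smooth f \<Longrightarrow> smooth g \<Longrightarrow> smooth (\<lambda>x. f x - g x)"
  using smooth_add[of f "\<lambda>x. (-1) * g x"] smooth_mult[of "\<lambda>x. -1" g] by simp

lemma smooth_sum: "(\<And>k. k \<in> A \<Longrightarrow> smooth (f k)) \<Longrightarrow> smooth (\<lambda>x. \<Sum>k\<in>A. f k x)"
  by (induction A rule: infinite_finite_induct) (auto intro: smooth_add)

lemma partial_derivs_const: "partial_derivs (i # is) (\<lambda>x. c) = (\<lambda>x. 0)"
proof (induction "is" arbitrary: i)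
  case (Cons a "is")
  then show ?case by (metis partial_derivs.simps(2) partial_deriv_const)
qed simp

lemma partial_derivs_zero [simp]: "partial_derivs is (\<lambda>x. 0) = (\<lambda>x. 0)"
  by (cases "is") (auto simp del: partial_derivs.simps(2) simp: partial_derivs_const)

lemma partial_derivs_add:
  assumes "smooth f" "smooth g"
  shows "partial_derivs is (\<lambda>x. f x + g x) = (\<lambda>x. partial_derivs is f x + partial_derivs is g x)"
  by (induction "is") (auto simp: partial_deriv_add smoothD assms)

lemma partial_derivs_cmult:
  assumes "smooth f"
  shows "partial_derivs is (\<lambda>x. c * f x) = (\<lambda>x. c * partial_derivs is f x)"
  by (induction "is") (auto simp: partial_deriv_cmult smoothD assms)

lemma partial_derivs_diff:
  assumes "smooth f" "smooth g"
  shows "partial_derivs is (\<lambda>x. f x - g x) = (\<lambda>x. partial_derivs is f x - partial_derivs is g x)"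
  using partial_derivs_add[OF assms(1) smooth_mult[OF smooth_const[of "-1"] assms(2)], of "is"]
    partial_derivs_cmult[OF assms(2), of "is" "-1"] by simp

lemma partial_derivs_cnj:
  assumes "smooth f"
  shows "partial_derivs is (\<lambda>x. cnj (f x)) = (\<lambda>x. cnj (partial_derivs is f x))"
  by (induction "is") (auto simp: partial_deriv_linear[OF bounded_linear_cnj] smoothD assms)

lemma smooth_cnj: "smooth f \<Longrightarrow> smooth (\<lambda>x. cnj (f x))"
  unfolding smooth_def[of "\<lambda>x. cnj (f x)"]
  by (auto simp: partial_derivs_cnj intro!: differentiable_cnj_iff[THEN iffD2] smoothD)

lemma partial_deriv_affine:
  fixes f :: "real ^ 'n \<Rightarrow> complex"
  assumes "\<And>x. f differentiable (at x)"
  shows "partial_deriv i (\<lambda>x. f (a + c *\<^sub>R x)) = (\<lambda>x. of_real c * partial_deriv i f (a + c *\<^sub>R x))"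
proof
  fix x
  have "((\<lambda>x. f (a + c *\<^sub>R x)) has_derivative
      (\<lambda>h. \<Sum>j\<in>UNIV. of_real ((c *\<^sub>R h) $ j) * partial_deriv j f (a + c *\<^sub>R x))) (at x)"
    by (rule has_derivative_compose[where g = f and f = "\<lambda>x. a + c *\<^sub>R x"])
      (auto intro!: derivative_eq_intros has_derivative_partial_deriv assms)
  then have "partial_deriv i (\<lambda>x. f (a + c *\<^sub>R x)) x =
      (\<Sum>j\<in>UNIV. of_real ((c *\<^sub>R axis i (1::real)) $ j) * partial_deriv j f (a + c *\<^sub>R x))"
    by (rule partial_deriv_eq)
  also have "\<dots> = (\<Sum>j\<in>UNIV. if j = i then of_real c * partial_deriv j f (a + c *\<^sub>R x) else 0)"
    by (rule sum.cong) (auto simp: axis_def)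
  finally show "partial_deriv i (\<lambda>x. f (a + c *\<^sub>R x)) x = of_real c * partial_deriv i f (a + c *\<^sub>R x)"
    by simp
qed

lemma differentiable_affine:
  fixes f :: "real ^ 'n \<Rightarrow> complex"
  assumes "\<And>x. f differentiable (at x)"
  shows "(\<lambda>x. f (a + c *\<^sub>R x)) differentiable (at x)"
proof -
  have "f \<circ> (\<lambda>x. a + c *\<^sub>R x) differentiable (at x)"
    by (rule differentiable_chain_at) (auto simp: assms)
  then show ?thesis by (simp add: o_def)
qed

lemma partial_derivs_affine:
  assumes "smooth f"
  shows "partial_derivs is (\<lambda>x. f (a + c *\<^sub>R x)) =
    (\<lambda>x. of_real (c ^ length is) * partial_derivs is f (a + c *\<^sub>R x))"
proof (induction "is")
  case (Cons i "is")
  have "partial_deriv i (\<lambda>x. of_real (c ^ length is) * partial_derivs is f (a + c *\<^sub>R x)) =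
      (\<lambda>x. of_real (c ^ length is) * partial_deriv i (\<lambda>x. partial_derivs is f (a + c *\<^sub>R x)) x)"
    by (rule partial_deriv_cmult) (auto intro!: differentiable_affine smoothD assms)
  also have "\<dots> = (\<lambda>x. of_real (c ^ length (i # is)) * partial_derivs (i # is) f (a + c *\<^sub>R x))"
    by (subst partial_deriv_affine) (auto intro!: smoothD assms)
  finally show ?case using Cons by simp
qed simp

lemma smooth_affine: "smooth f \<Longrightarrow> smooth (\<lambda>x. f (a + c *\<^sub>R x))"
  unfolding smooth_def[of "\<lambda>x. f (a + c *\<^sub>R x)"]
  by (auto simp: partial_derivs_affine intro!: derivative_intros differentiable_affine smoothD)

text \<open>Each derivative turns one product into two, hence \<open>2 ^ length is\<close> in place
  of binomial coefficients. The induction peels off the innermost derivative, so that its hypothesis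
  applies to the two products given by the product rule. \<open>A\<close> and \<open>B\<close> bound
  the derivatives at the single point \<open>x\<close>, so that decay in \<open>x\<close> can enter
  through them.\<close>

lemma norm_partial_derivs_mult:
  assumes "smooth f" "smooth g"
    and "\<And>js. length js \<le> length is \<Longrightarrow> norm (partial_derivs js f x) \<le> A"
    and "\<And>js. length js \<le> length is \<Longrightarrow> norm (partial_derivs js g x) \<le> B"
  shows "norm (partial_derivs is (\<lambda>x. f x * g x) x) \<le> 2 ^ length is * (A * B)"
  using assms
proof (induction "is" arbitrary: f g rule: rev_induct)
  case Nil
  then show ?case
    using mult_mono[OF Nil(3)[of "[]"] Nil(4)[of "[]"]]
    by (force simp: norm_mult intro: order_trans[OF norm_ge_zero])
next
  case (snoc i "is")
  note f = snoc.prems(1) and g = snoc.prems(2)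
  have f': "smooth (partial_deriv i f)" and g': "smooth (partial_deriv i g)"
    using smooth_partial_derivs[OF f, of "[i]"] smooth_partial_derivs[OF g, of "[i]"] by auto
  have 1: "norm (partial_derivs is (\<lambda>x. partial_deriv i f x * g x) x) \<le> 2 ^ length is * (A * B)"
    by (rule snoc.IH) (use f' g snoc.prems(3)[of "js @ [i]" for js] snoc.prems(4)
        in \<open>auto simp: partial_derivs_snoc\<close>)
  have 2: "norm (partial_derivs is (\<lambda>x. f x * partial_deriv i g x) x) \<le> 2 ^ length is * (A * B)"
    by (rule snoc.IH) (use f g' snoc.prems(4)[of "js @ [i]" for js] snoc.prems(3)
        in \<open>auto simp: partial_derivs_snoc\<close>)
  have "partial_derivs (is @ [i]) (\<lambda>x. f x * g x) x =
      partial_derivs is (\<lambda>x. partial_deriv i f x * g x) x + partial_derivs is (\<lambda>x. f x * partial_deriv i g x) x"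
    using f' g' smoothD[OF f, of "[]"] smoothD[OF g, of "[]"] f g
    by (simp add: partial_derivs_snoc partial_deriv_mult partial_derivs_add smooth_mult)
  also have "norm \<dots> \<le> 2 ^ length is * (A * B) + 2 ^ length is * (A * B)"
    using norm_triangle_mono[OF 1 2] .
  finally show ?case by (simp add: mult_ac)
qed

section \<open>Termwise differentiation of series\<close>

lemma has_derivative_suminf_partial:
  fixes g :: "nat \<Rightarrow> real ^ 'n \<Rightarrow> complex"
  assumes g: "\<And>k x. g k differentiable (at x)"
    and M0: "\<And>k x. norm (g k x) \<le> M0 k" "summable M0"
    and M: "\<And>i k x. norm (partial_deriv i (g k) x) \<le> M i k" "\<And>i. summable (M i)"
  shows "((\<lambda>x. \<Sum>k. g k x) has_derivative
    (\<lambda>h. \<Sum>i\<in>UNIV. of_real (h $ i) * (\<Sum>k. partial_deriv i (g k) x))) (at x)"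
proof -
  let ?f' = "\<lambda>k x h. \<Sum>i\<in>UNIV. of_real (h $ i) * partial_deriv i (g k) x"
  let ?g' = "\<lambda>x h. \<Sum>i\<in>UNIV. of_real (h $ i) * (\<Sum>k. partial_deriv i (g k) x)"
  have sm: "summable (\<lambda>k. g k x)" for x
    by (rule summable_comparison_test'[OF M0(2)]) (simp add: M0)
  have "\<exists>G. \<forall>x\<in>UNIV. (\<lambda>n. g n x) sums (G x) \<and> (G has_derivative ?g' x) (at x within UNIV)"
  proof (rule has_derivative_series)
    fix e :: real assume e: "e > 0"
    have "uniform_limit UNIV (\<lambda>n x. \<Sum>k<n. partial_deriv i (g k) x)
        (\<lambda>x. \<Sum>k. partial_deriv i (g k) x) sequentially" for i
      by (rule Weierstrass_m_test[where M = "M i"]) (auto simp: M)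
    \<comment> \<open>Uniform convergence to within \<open>e / CARD('n)\<close> in each direction:
      the differential sums over the coordinates, which turns this into the operator bound
      \<open>e\<close>.\<close>
    then have "\<forall>\<^sub>F n in sequentially. \<forall>i\<in>UNIV. \<forall>x\<in>UNIV.
        dist (\<Sum>k<n. partial_deriv i (g k) x) (\<Sum>k. partial_deriv i (g k) x) < e / CARD('n)"
      using e by (subst eventually_ball_finite_distrib) (auto simp: uniform_limit_iff)
    then show "\<forall>\<^sub>F n in sequentially. \<forall>x\<in>UNIV. \<forall>h. norm (sum (\<lambda>k. ?f' k x h) {..<n} - ?g' x h) \<le> e * norm h"
    proof (rule eventually_mono, intro ballI allI)
      fix n x and h :: "real ^ 'n"
      assume A: "\<forall>i\<in>UNIV. \<forall>x\<in>UNIV.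
        dist (\<Sum>k<n. partial_deriv i (g k) x) (\<Sum>k. partial_deriv i (g k) x) < e / CARD('n)"
      have "sum (\<lambda>k. ?f' k x h) {..<n} - ?g' x h =
          (\<Sum>i\<in>UNIV. of_real (h $ i) * ((\<Sum>k<n. partial_deriv i (g k) x) - (\<Sum>k. partial_deriv i (g k) x)))"
        by (subst sum.swap) (simp add: sum_distrib_left sum_subtractf right_diff_distrib)
      also have "norm \<dots> \<le> (\<Sum>i\<in>(UNIV::'n set). norm h * (e / CARD('n)))"
      proof (rule sum_norm_le)
        fix i :: 'n
        show "norm (of_real (h $ i) * ((\<Sum>k<n. partial_deriv i (g k) x) - (\<Sum>k. partial_deriv i (g k) x)))
            \<le> norm h * (e / CARD('n))"
          unfolding norm_mult norm_of_real
          by (rule mult_mono[OF component_le_norm_cart])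
            (use A in \<open>auto simp: dist_norm less_imp_le\<close>)
      qed
      finally show "norm (sum (\<lambda>k. ?f' k x h) {..<n} - ?g' x h) \<le> e * norm h"
        by (simp add: mult_ac)
    qed
  qed (use has_derivative_partial_deriv[OF g] summable_sums[OF sm] in auto)
  then obtain G where G: "\<And>x. (\<lambda>n. g n x) sums (G x)" "\<And>x. (G has_derivative ?g' x) (at x)"
    by auto
  have "G = (\<lambda>x. \<Sum>k. g k x)" using G(1) sums_unique by blast
  with G(2) show ?thesis by simp
qed

lemma
  fixes f :: "nat \<Rightarrow> real ^ 'n \<Rightarrow> complex"
  assumes f: "\<And>k. smooth (f k)"
    and M: "\<And>is k x. norm (partial_derivs is (f k) x) \<le> M is k" "\<And>is. summable (M is)"
  shows partial_derivs_suminf: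
      "partial_derivs is (\<lambda>x. \<Sum>k. f k x) = (\<lambda>x. \<Sum>k. partial_derivs is (f k) x)"
    and smooth_suminf: "smooth (\<lambda>x. \<Sum>k. f k x)"
proof -
  have D: "((\<lambda>x. \<Sum>k. partial_derivs is (f k) x) has_derivative
    (\<lambda>h. \<Sum>i\<in>UNIV. of_real (h $ i) * (\<Sum>k. partial_derivs (i # is) (f k) x))) (at x)" for "is" x
    using has_derivative_suminf_partial[of "\<lambda>k. partial_derivs is (f k)" "M is" "\<lambda>i. M (i # is)" x]
      smoothD[OF f] M M(1)[of "_ # is"] by simp
  have eq: "partial_derivs is (\<lambda>x. \<Sum>k. f k x) = (\<lambda>x. \<Sum>k. partial_derivs is (f k) x)" for "is"
  proof (induction "is")
    case (Cons i "is")
    have "partial_deriv i (\<lambda>x. \<Sum>k. partial_derivs is (f k) x) x =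
        (\<Sum>j\<in>UNIV. of_real (axis i (1::real) $ j) * (\<Sum>k. partial_derivs (j # is) (f k) x))" for x
      by (rule partial_deriv_eq[OF D])
    also have "\<dots> x = (\<Sum>j\<in>UNIV. if j = i then (\<Sum>k. partial_derivs (j # is) (f k) x) else 0)" for x
      by (rule sum.cong) (auto simp: axis_def)
    finally show ?case using Cons by simp
  qed simp
  show "partial_derivs is (\<lambda>x. \<Sum>k. f k x) = (\<lambda>x. \<Sum>k. partial_derivs is (f k) x)"
    by (rule eq)
  show "smooth (\<lambda>x. \<Sum>k. f k x)"
    unfolding smooth_def eq using D differentiableI by blast
qed

section \<open>Schwartz functions and functionals\<close>

text \<open>One index \<open>N\<close> rules both the weight and the number of derivatives, so that
  these norms increase with \<open>N\<close> and any two of them are dominated by a third. As a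
  relation with an explicit bound it carries no finiteness side condition, unlike the suprema in
  \<open>schwartz_seminorm\<close>.\<close>

definition sbound :: "nat \<Rightarrow> (real ^ 'n \<Rightarrow> complex) \<Rightarrow> real \<Rightarrow> bool" where
  "sbound N f A \<longleftrightarrow>
     (\<forall>is x. length is \<le> N \<longrightarrow> (1 + norm x) ^ N * norm (partial_derivs is f x) \<le> A)"

lemma sboundI:
  "(\<And>is x. length is \<le> N \<Longrightarrow> (1 + norm x) ^ N * norm (partial_derivs is f x) \<le> A) \<Longrightarrow> sbound N f A"
  by (simp add: sbound_def)

lemma sboundD:
  "sbound N f A \<Longrightarrow> length is \<le> N \<Longrightarrow> (1 + norm x) ^ N * norm (partial_derivs is f x) \<le> A"
  by (simp add: sbound_def)

lemma sbound_nonneg: "sbound N f A \<Longrightarrow> 0 \<le> A"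
  using sboundD[of N f A "[]" 0] by (simp add: order_trans[OF norm_ge_zero])

lemma sbound_le: "sbound N f A \<Longrightarrow> A \<le> B \<Longrightarrow> sbound N f B"
  by (meson order_trans sbound_def)

lemma sbound_order_mono:
  assumes "sbound N f A" "M \<le> N"
  shows "sbound M f A"
proof (rule sboundI)
  fix "is" :: "'a list" and x :: "real ^ 'a"
  assume "length is \<le> M"
  then have "(1 + norm x) ^ N * norm (partial_derivs is f x) \<le> A"
    using assms by (intro sboundD) auto
  moreover have "(1 + norm x) ^ M \<le> (1 + norm x) ^ N"
    using assms(2) by (intro power_increasing) auto
  ultimately show "(1 + norm x) ^ M * norm (partial_derivs is f x) \<le> A"
    by (meson mult_right_mono norm_ge_zero order_trans)
qed

lemma sbound_norm_le:
  assumes "sbound N f A" "length is \<le> N"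
  shows "norm (partial_derivs is f x) \<le> A / (1 + norm x) ^ N"
proof -
  have "0 < 1 + norm x" by (simp add: add_pos_nonneg)
  then show ?thesis using sboundD[OF assms, of x]
    by (subst pos_le_divide_eq) (auto simp: mult.commute)
qed

lemma sbound_norm_le':
  assumes "sbound N f A" "length is \<le> N"
  shows "norm (partial_derivs is f x) \<le> A"
  using sbound_norm_le[OF sbound_order_mono[OF assms(1), of "length is"], of "is" x]
    sboundD[OF sbound_order_mono[OF assms(1), of "length is"], of "is" x] assms(2)
    mult_right_mono[of 1 "(1 + norm x) ^ length is" "norm (partial_derivs is f x)"]
  by (simp add: order_trans)

lemma schwartz_iff: "f \<in> schwartz_space \<longleftrightarrow> smooth f \<and> (\<forall>N. \<exists>A. sbound N f A)"
proof
  assume f: "f \<in> schwartz_space"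
  have "\<exists>A. sbound N f A" for N
  proof -
    let ?p = "\<lambda>is x. (1 + norm x) ^ N * norm (partial_derivs is f x)"
    have "\<forall>is. \<exists>A. \<forall>x. ?p is x \<le> A"
      using f unfolding schwartz_space_def bdd_above_def by blast
    then obtain A where A: "\<And>is x. ?p is x \<le> A is" by metis
    let ?L = "{is :: 'a list. set is \<subseteq> UNIV \<and> length is \<le> N}"
    have "sbound N f (\<Sum>is\<in>?L. \<bar>A is\<bar>)"
    proof (rule sboundI)
      fix "is" :: "'a list" and x :: "real ^ 'a"
      assume "length is \<le> N"
      then have "\<bar>A is\<bar> \<le> (\<Sum>is\<in>?L. \<bar>A is\<bar>)"
        by (intro member_le_sum finite_lists_length_le) auto
      then show "?p is x \<le> (\<Sum>is\<in>?L. \<bar>A is\<bar>)" using A[of x "is"] by linarith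
    qed
    then show ?thesis ..
  qed
  then show "smooth f \<and> (\<forall>N. \<exists>A. sbound N f A)"
    using f by (auto simp: schwartz_space_def)
next
  assume f: "smooth f \<and> (\<forall>N. \<exists>A. sbound N f A)"
  have "bdd_above (range (\<lambda>x. (1 + norm x) ^ k * norm (partial_derivs is f x)))" for k "is"
  proof -
    obtain A where A: "sbound (max k (length is)) f A" using f by blast
    have "(1 + norm x) ^ k * norm (partial_derivs is f x) \<le> A" for x
      using sboundD[OF A, of "is" x] power_increasing[of k "max k (length is)" "1 + norm x"]
      by (meson le_add_same_cancel1 max.cobounded1 max.cobounded2 mult_right_mono norm_ge_zero order_trans)
    then show ?thesis by (auto intro!: bdd_aboveI)
  qed
  then show "f \<in> schwartz_space" using f by (auto simp: schwartz_space_def)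
qed

lemma schwartz_smooth: "f \<in> schwartz_space \<Longrightarrow> smooth f"
  by (simp add: schwartz_iff)

lemma schwartz_sbound:
  assumes "f \<in> schwartz_space"
  obtains A where "sbound N f A" "A > 0"
proof -
  obtain A where "sbound N f A" using assms schwartz_iff by blast
  then have "sbound N f (\<bar>A\<bar> + 1)" by (rule sbound_le) simp
  then show ?thesis using that[of "\<bar>A\<bar> + 1"] by simp
qed

lemma sbound_zero [simp]: "0 \<le> A \<Longrightarrow> sbound N (\<lambda>x. 0) A"
  by (simp add: sbound_def)

lemma sbound_add:
  assumes "smooth f" "smooth g" "sbound N f A" "sbound N g B"
  shows "sbound N (\<lambda>x. f x + g x) (A + B)"
proof (rule sboundI)
  fix "is" :: "'a list" and x :: "real ^ 'a"
  assume l: "length is \<le> N"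
  have "(1 + norm x) ^ N * norm (partial_derivs is f x + partial_derivs is g x) \<le>
      (1 + norm x) ^ N * (norm (partial_derivs is f x) + norm (partial_derivs is g x))"
    by (intro mult_left_mono norm_triangle_ineq) auto
  also have "\<dots> \<le> A + B"
    using sboundD[OF assms(3) l, of x] sboundD[OF assms(4) l, of x] by (simp add: distrib_left)
  finally show "(1 + norm x) ^ N * norm (partial_derivs is (\<lambda>x. f x + g x) x) \<le> A + B"
    by (simp add: partial_derivs_add assms)
qed

lemma sbound_cmult:
  assumes "smooth f" "sbound N f A"
  shows "sbound N (\<lambda>x. c * f x) (norm c * A)"
  using assms by (auto simp: sbound_def partial_derivs_cmult norm_mult mult.left_commute intro!: mult_left_mono)

lemma sbound_cnj: "smooth f \<Longrightarrow> sbound N f A \<Longrightarrow> sbound N (\<lambda>x. cnj (f x)) A"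
  by (simp add: sbound_def partial_derivs_cnj)

text \<open>All decay is carried by \<open>f\<close>; of \<open>g\<close> only bounded derivatives
  are used. This fits cutoffs of the form \<open>1 - \<eta>\<close>, which do not decay.\<close>

lemma sbound_mult:
  assumes "smooth f" "smooth g" "sbound N f A"
    and "\<And>js x. length js \<le> N \<Longrightarrow> norm (partial_derivs js g x) \<le> B"
  shows "sbound N (\<lambda>x. f x * g x) (2 ^ N * (A * B))"
proof (rule sboundI)
  fix "is" :: "'a list" and x :: "real ^ 'a"
  assume l: "length is \<le> N"
  have pos: "0 < 1 + norm x" by (simp add: add_pos_nonneg)
  have B: "0 \<le> B" using assms(4)[of "[]"] norm_ge_zero order_trans by (metis le0 list.size(3))
  have "norm (partial_derivs is (\<lambda>x. f x * g x) x) \<le> 2 ^ length is * (A / (1 + norm x) ^ N * B)"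
    using l by (intro norm_partial_derivs_mult assms sbound_norm_le[OF assms(3)]) auto
  also have "\<dots> \<le> 2 ^ N * (A / (1 + norm x) ^ N * B)"
    using l B sbound_nonneg[OF assms(3)] by (intro mult_right_mono power_increasing) auto
  finally show "(1 + norm x) ^ N * norm (partial_derivs is (\<lambda>x. f x * g x) x) \<le> 2 ^ N * (A * B)"
    using pos by (simp add: field_simps)
qed

text \<open>The weight is moved by \<open>1 + norm x \<le> max 1 (1 / \<bar>c\<bar>) * (1 + norm a)
  * (1 + norm (a + c *\<^sub>R x))\<close>, and the chain rule contributes
  \<open>\<bar>c\<bar> ^ length is\<close>, at most \<open>max 1 \<bar>c\<bar> ^ N\<close>.
  Arguments such as \<open>0 + c *\<^sub>R x\<close> or \<open>a + 1 *\<^sub>R x\<close> further on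
  are written that way to match this form.\<close>

lemma sbound_affine:
  assumes "smooth f" "sbound N f A" "c \<noteq> 0"
  shows "sbound N (\<lambda>x. f (a + c *\<^sub>R x)) (((1 + norm a) * max 1 (1 / \<bar>c\<bar>) * max 1 \<bar>c\<bar>) ^ N * A)"
proof (rule sboundI)
  fix "is" :: "'a list" and x :: "real ^ 'a"
  assume l: "length is \<le> N"
  let ?K = "max 1 (1 / \<bar>c\<bar>)"
  have "norm x = 1 / \<bar>c\<bar> * norm (c *\<^sub>R x)" using assms(3) by simp
  also have "\<dots> \<le> ?K * norm (c *\<^sub>R x)" by (intro mult_right_mono) auto
  finally have "1 + norm x \<le> ?K + ?K * norm (c *\<^sub>R x)" by simp
  also have "\<dots> = ?K * (1 + norm (c *\<^sub>R x))" by (simp add: distrib_left)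
  also have "\<dots> \<le> ?K * ((1 + norm a) * (1 + norm (a + c *\<^sub>R x)))"
  proof (rule mult_left_mono)
    have "norm (c *\<^sub>R x) \<le> norm (a + c *\<^sub>R x) + norm a"
      using norm_triangle_ineq4[of "a + c *\<^sub>R x" a] by simp
    moreover have "(1 + norm a) * (1 + norm (a + c *\<^sub>R x)) =
        1 + norm a + norm (a + c *\<^sub>R x) + norm a * norm (a + c *\<^sub>R x)"
      by (simp add: algebra_simps)
    moreover have "0 \<le> norm a * norm (a + c *\<^sub>R x)" by simp
    ultimately show "1 + norm (c *\<^sub>R x) \<le> (1 + norm a) * (1 + norm (a + c *\<^sub>R x))"
      by linarith
  qed simp
  finally have "(1 + norm x) ^ N \<le> (?K * ((1 + norm a) * (1 + norm (a + c *\<^sub>R x)))) ^ N"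
    by (intro power_mono) auto
  then have 1: "(1 + norm x) ^ N \<le> (?K * (1 + norm a)) ^ N * (1 + norm (a + c *\<^sub>R x)) ^ N"
    by (simp add: power_mult_distrib mult_ac)
  have "\<bar>c\<bar> ^ length is \<le> max 1 \<bar>c\<bar> ^ length is" by (intro power_mono) auto
  also have "\<dots> \<le> max 1 \<bar>c\<bar> ^ N" using l by (intro power_increasing) auto
  finally have 2: "\<bar>c\<bar> ^ length is \<le> max 1 \<bar>c\<bar> ^ N" .
  have "(1 + norm x) ^ N * norm (partial_derivs is (\<lambda>x. f (a + c *\<^sub>R x)) x) =
      (1 + norm x) ^ N * (\<bar>c\<bar> ^ length is * norm (partial_derivs is f (a + c *\<^sub>R x)))"
    by (simp add: partial_derivs_affine assms norm_mult norm_power)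
  also have "\<dots> \<le> ((?K * (1 + norm a)) ^ N * (1 + norm (a + c *\<^sub>R x)) ^ N) *
      (max 1 \<bar>c\<bar> ^ N * norm (partial_derivs is f (a + c *\<^sub>R x)))"
    using 1 2 by (intro mult_mono mult_right_mono) auto
  also have "\<dots> = ((1 + norm a) * ?K * max 1 \<bar>c\<bar>) ^ N *
      ((1 + norm (a + c *\<^sub>R x)) ^ N * norm (partial_derivs is f (a + c *\<^sub>R x)))"
    by (simp add: power_mult_distrib mult_ac)
  also have "\<dots> \<le> ((1 + norm a) * ?K * max 1 \<bar>c\<bar>) ^ N * A"
    by (intro mult_left_mono sboundD assms l) auto
  finally show "(1 + norm x) ^ N * norm (partial_derivs is (\<lambda>x. f (a + c *\<^sub>R x)) x) \<le>
      ((1 + norm a) * ?K * max 1 \<bar>c\<bar>) ^ N * A" .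
qed

lemma schwartz_zero: "(\<lambda>x. 0) \<in> schwartz_space"
  by (auto simp: schwartz_iff intro: exI[of _ 0])

lemma schwartz_add:
  "f \<in> schwartz_space \<Longrightarrow> g \<in> schwartz_space \<Longrightarrow> (\<lambda>x. f x + g x) \<in> schwartz_space"
  unfolding schwartz_iff by (blast intro: smooth_add sbound_add)

lemma schwartz_cmult: "f \<in> schwartz_space \<Longrightarrow> (\<lambda>x. c * f x) \<in> schwartz_space"
  unfolding schwartz_iff using smooth_mult[OF smooth_const, of f c] sbound_cmult[of f _ _ c] by blast

lemma schwartz_diff:
  "f \<in> schwartz_space \<Longrightarrow> g \<in> schwartz_space \<Longrightarrow> (\<lambda>x. f x - g x) \<in> schwartz_space"
  using schwartz_add[of f "\<lambda>x. (-1) * g x"] schwartz_cmult[of g "-1"] by simp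

lemma schwartz_cnj: "f \<in> schwartz_space \<Longrightarrow> (\<lambda>x. cnj (f x)) \<in> schwartz_space"
  unfolding schwartz_iff by (blast intro: smooth_cnj sbound_cnj)

lemma schwartz_affine:
  "f \<in> schwartz_space \<Longrightarrow> c \<noteq> 0 \<Longrightarrow> (\<lambda>x. f (a + c *\<^sub>R x)) \<in> schwartz_space"
  unfolding schwartz_iff by (blast intro: smooth_affine sbound_affine)

lemma schwartz_sum:
  "(\<And>k. k \<in> K \<Longrightarrow> f k \<in> schwartz_space) \<Longrightarrow> (\<lambda>x. \<Sum>k\<in>K. f k x) \<in> schwartz_space"
  by (induction K rule: infinite_finite_induct) (auto intro: schwartz_add schwartz_zero)

lemma partial_derivs_bounded_upto:
  fixes f :: "real ^ 'n \<Rightarrow> complex"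
  assumes "\<And>is. \<exists>B. \<forall>x. norm (partial_derivs is f x) \<le> B"
  shows "\<exists>B>0. \<forall>is x. length is \<le> N \<longrightarrow> norm (partial_derivs is f x) \<le> B"
proof -
  obtain B where B: "\<And>is x. norm (partial_derivs is f x) \<le> B is" using assms by metis
  let ?L = "{is :: 'n list. set is \<subseteq> UNIV \<and> length is \<le> N}"
  have "norm (partial_derivs is f x) \<le> (\<Sum>is\<in>?L. \<bar>B is\<bar>) + 1" if "length is \<le> N" for "is" x
  proof -
    have "\<bar>B is\<bar> \<le> (\<Sum>is\<in>?L. \<bar>B is\<bar>)"
      using that by (intro member_le_sum finite_lists_length_le) auto
    then show ?thesis using B[of "is" x] by linarith
  qed
  moreover have "(\<Sum>is\<in>?L. \<bar>B is\<bar>) + 1 > 0" by (intro add_nonneg_pos sum_nonneg) auto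
  ultimately show ?thesis by blast
qed

lemma schwartz_mult:
  assumes "f \<in> schwartz_space" "smooth g" "\<And>is. \<exists>B. \<forall>x. norm (partial_derivs is g x) \<le> B"
  shows "(\<lambda>x. f x * g x) \<in> schwartz_space"
proof -
  have "\<exists>A. sbound N (\<lambda>x. f x * g x) A" for N
  proof -
    obtain A where A: "sbound N f A" using schwartz_sbound[OF assms(1)] by blast
    obtain B where "\<And>is x. length is \<le> N \<Longrightarrow> norm (partial_derivs is g x) \<le> B"
      using partial_derivs_bounded_upto[OF assms(3)] by blast
    then show ?thesis
      using sbound_mult[OF schwartz_smooth[OF assms(1)] assms(2) A] by blast
  qed
  then show ?thesis using assms(1,2) by (simp add: schwartz_iff smooth_mult)
qed

lemma
  fixes f :: "nat \<Rightarrow> real ^ 'n \<Rightarrow> complex"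
  assumes f: "\<And>k. f k \<in> schwartz_space"
    and a: "\<And>N k. sbound N (f k) (a N k)" "\<And>N. summable (a N)"
  shows schwartz_suminf: "(\<lambda>x. \<Sum>k. f k x) \<in> schwartz_space"
    and sbound_suminf: "sbound N (\<lambda>x. \<Sum>k. f k x) (\<Sum>k. a N k)"
proof -
  have b: "norm (partial_derivs is (f k) x) \<le> a (length is) k" for "is" k x
    using sbound_norm_le'[OF a(1)] by blast
  note eq = partial_derivs_suminf[of f "\<lambda>is. a (length is)", OF schwartz_smooth[OF f] b a(2)]
    and sm = smooth_suminf[of f "\<lambda>is. a (length is)", OF schwartz_smooth[OF f] b a(2)]
  have sb: "sbound N (\<lambda>x. \<Sum>k. f k x) (\<Sum>k. a N k)" for N
  proof (rule sboundI)
    fix "is" :: "'n list" and x :: "real ^ 'n"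
    assume l: "length is \<le> N"
    let ?w = "(1 + norm x) ^ N"
    have s1: "summable (\<lambda>k. ?w * norm (partial_derivs is (f k) x))"
      by (rule summable_comparison_test'[OF a(2)[of N]]) (use sboundD[OF a(1) l] in auto)
    then have s2: "summable (\<lambda>k. norm (partial_derivs is (f k) x))"
      by (rule summable_mult_D) (simp add: add_nonneg_eq_0_iff)
    have "?w * norm (\<Sum>k. partial_derivs is (f k) x) \<le> ?w * (\<Sum>k. norm (partial_derivs is (f k) x))"
      by (intro mult_left_mono summable_norm s2) auto
    also have "\<dots> = (\<Sum>k. ?w * norm (partial_derivs is (f k) x))"
      by (rule suminf_mult[OF s2, symmetric])
    also have "\<dots> \<le> (\<Sum>k. a N k)"
      by (intro suminf_le s1 a sboundD[OF a(1) l])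
    finally show "?w * norm (partial_derivs is (\<lambda>x. \<Sum>k. f k x) x) \<le> (\<Sum>k. a N k)"
      unfolding eq .
  qed
  show "sbound N (\<lambda>x. \<Sum>k. f k x) (\<Sum>k. a N k)" by (rule sb)
  show "(\<lambda>x. \<Sum>k. f k x) \<in> schwartz_space" using sb sm schwartz_iff by blast
qed

text \<open>Continuity is recorded as a bound by a single norm. The same rules then serve the
  distribution, the integral, their linear combination and all dilates of these.\<close>

locale schwartz_functional =
  fixes U :: "(real ^ 'n \<Rightarrow> complex) \<Rightarrow> complex"
  assumes add: "f \<in> schwartz_space \<Longrightarrow> g \<in> schwartz_space \<Longrightarrow> U (\<lambda>x. f x + g x) = U f + U g"
    and cmult: "f \<in> schwartz_space \<Longrightarrow> U (\<lambda>x. c * f x) = c * U f"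
    and bounded: "\<exists>N C. \<forall>f\<in>schwartz_space. \<forall>A. sbound N f A \<longrightarrow> norm (U f) \<le> C * A"
begin

lemma zero: "U (\<lambda>x. 0) = 0"
  using cmult[OF schwartz_zero, of 0] by simp

lemma diff: "f \<in> schwartz_space \<Longrightarrow> g \<in> schwartz_space \<Longrightarrow> U (\<lambda>x. f x - g x) = U f - U g"
  using add[of f "\<lambda>x. (-1) * g x"] cmult[of g "-1"] schwartz_cmult[of g "-1"] by simp

lemma sum:
  "(\<And>k. k \<in> K \<Longrightarrow> f k \<in> schwartz_space) \<Longrightarrow> U (\<lambda>x. \<Sum>k\<in>K. f k x) = (\<Sum>k\<in>K. U (f k))"
  by (induction K rule: infinite_finite_induct) (auto simp: add zero schwartz_sum)

lemma bound:
  obtains N C where "C > 0" "\<And>f A. f \<in> schwartz_space \<Longrightarrow> sbound N f A \<Longrightarrow> norm (U f) \<le> C * A"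
proof -
  obtain N C where C: "\<And>f A. f \<in> schwartz_space \<Longrightarrow> sbound N f A \<Longrightarrow> norm (U f) \<le> C * A"
    using bounded by blast
  have "norm (U f) \<le> (\<bar>C\<bar> + 1) * A" if "f \<in> schwartz_space" "sbound N f A" for f A
    using C[OF that] sbound_nonneg[OF that(2)] mult_right_mono[of C "\<bar>C\<bar> + 1" A] by linarith
  then show ?thesis using that[of "\<bar>C\<bar> + 1" N] by auto
qed

lemma suminf:
  assumes f: "\<And>k. f k \<in> schwartz_space"
    and a: "\<And>N k. sbound N (f k) (a N k)" "\<And>N. summable (a N)"
  shows "(\<lambda>k. U (f k)) sums U (\<lambda>x. \<Sum>k. f k x)"
proof -
  obtain N C where C: "C > 0" "\<And>f A. f \<in> schwartz_space \<Longrightarrow> sbound N f A \<Longrightarrow> norm (U f) \<le> C * A"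
    by (rule bound) blast
  let ?F = "\<lambda>x. \<Sum>k. f k x"
  have F: "?F \<in> schwartz_space" using schwartz_suminf[OF f a] .
  have sm: "summable (\<lambda>k. f k x)" for x
    using sbound_norm_le'[OF a(1)[of 0], of "[]"]
    by (intro summable_comparison_test'[OF a(2)[of 0]]) auto
  \<comment> \<open>The functional of the tail of the series is at most \<open>C\<close> times the
    tail of the bounds, which tends to 0.\<close>
  have "norm ((\<Sum>k<n. U (f k)) - U ?F) \<le> C * (\<Sum>k. a N (k + n))" for n
  proof -
    have a': "\<And>N. summable (\<lambda>k. a N (k + n))" using a(2) by (simp add: summable_iff_shift)
    have "U ?F - (\<Sum>k<n. U (f k)) = U (\<lambda>x. ?F x - (\<Sum>k<n. f k x))"
      using f F by (simp add: diff sum schwartz_sum)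
    also have "(\<lambda>x. ?F x - (\<Sum>k<n. f k x)) = (\<lambda>x. \<Sum>k. f (k + n) x)"
      using suminf_minus_initial_segment[OF sm] by auto
    finally have "norm (U ?F - (\<Sum>k<n. U (f k))) \<le> C * (\<Sum>k. a N (k + n))"
      using C(2) schwartz_suminf[of "\<lambda>k. f (k + n)" "\<lambda>N k. a N (k + n)"]
        sbound_suminf[of "\<lambda>k. f (k + n)" "\<lambda>N k. a N (k + n)"] f a(1) a' by metis
    then show ?thesis by (simp add: norm_minus_commute)
  qed
  moreover have "(\<lambda>n. C * (\<Sum>k. a N (k + n))) \<longlonglongrightarrow> C * 0"
    by (intro tendsto_intros suminf_exist_split2 a)
  ultimately have "(\<lambda>n. (\<Sum>k<n. U (f k)) - U ?F) \<longlonglongrightarrow> 0"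
    using Lim_null_comparison[of "\<lambda>n. (\<Sum>k<n. U (f k)) - U ?F" "\<lambda>n. C * (\<Sum>k. a N (k + n))" sequentially] by simp
  then show ?thesis unfolding sums_def using LIM_zero_iff by blast
qed

end

section \<open>From the Schwartz topology to a bound by one norm\<close>

lemma schwartz_seminorm_le:
  assumes "sbound N f A" "k \<le> N" "length is \<le> N"
  shows "schwartz_seminorm k is f \<le> A"
  unfolding schwartz_seminorm_def
proof (rule cSUP_least)
  fix x
  show "(1 + norm x) ^ k * norm (partial_derivs is f x) \<le> A"
    using sboundD[OF assms(1,3), of x] power_increasing[of k N "1 + norm x"] assms(2)
    by (meson le_add_same_cancel1 mult_right_mono norm_ge_zero order_trans)
qed simp

lemma schwartz_seminorm_upper:
  assumes "f \<in> schwartz_space"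
  shows "(1 + norm x) ^ k * norm (partial_derivs is f x) \<le> schwartz_seminorm k is f"
  unfolding schwartz_seminorm_def
  by (rule cSUP_upper) (use assms in \<open>auto simp: schwartz_space_def\<close>)

lemma schwartz_seminorm_add:
  assumes "f \<in> schwartz_space" "g \<in> schwartz_space"
  shows "schwartz_seminorm k is (\<lambda>x. f x + g x) \<le> schwartz_seminorm k is f + schwartz_seminorm k is g"
  unfolding schwartz_seminorm_def[of k "is" "\<lambda>x. f x + g x"]
proof (rule cSUP_least)
  fix x
  have "(1 + norm x) ^ k * norm (partial_derivs is (\<lambda>x. f x + g x) x) \<le>
    (1 + norm x) ^ k * (norm (partial_derivs is f x) + norm (partial_derivs is g x))"
    by (auto intro!: mult_left_mono norm_triangle_ineq simp: partial_derivs_add schwartz_smooth assms)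
  also have "\<dots> \<le> schwartz_seminorm k is f + schwartz_seminorm k is g"
    using schwartz_seminorm_upper[OF assms(1), of x k "is"] schwartz_seminorm_upper[OF assms(2), of x k "is"]
    by (simp add: distrib_left)
  finally show "(1 + norm x) ^ k * norm (partial_derivs is (\<lambda>x. f x + g x) x) \<le>
    schwartz_seminorm k is f + schwartz_seminorm k is g" .
qed simp

text \<open>Induction over the generation of the topology; intersections take the larger order and
  the smaller radius. A subbasic set may be centred at some \<open>f\<close> other than 0: then half
  of the slack that the seminorm of \<open>- f\<close> leaves below \<open>e\<close> serves as
  radius, the half keeping the inequality strict.\<close>

lemma schwartz_topology_nhd_zero:
  fixes W :: "(real ^ 'n \<Rightarrow> complex) set"
  assumes "openin schwartz_topology W" "(\<lambda>x. 0) \<in> W"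
  shows "\<exists>N \<delta>. \<delta> > 0 \<and> (\<forall>g\<in>schwartz_space. sbound N g \<delta> \<longrightarrow> g \<in> W)"
proof -
  define B where "B = {{g \<in> schwartz_space. schwartz_seminorm k is (\<lambda>x. g x - f x) < e} | f k is e.
        f \<in> (schwartz_space :: (real ^ 'n \<Rightarrow> complex) set) \<and> e > 0}"
  have "generate_topology_on B W"
    using assms(1) unfolding schwartz_topology_def B_def by (simp add: openin_topology_generated_by)
  then show ?thesis using assms(2)
  proof induction
    case Empty
    then show ?case by simp
  next
    case (Int a b)
    then obtain N M \<delta> \<epsilon> where *: "\<delta> > 0" "\<epsilon> > 0"
      "\<forall>g\<in>schwartz_space. sbound N g \<delta> \<longrightarrow> g \<in> a" "\<forall>g\<in>schwartz_space. sbound M g \<epsilon> \<longrightarrow> g \<in> b"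
      by (metis IntD1 IntD2)
    have "g \<in> a \<inter> b" if "g \<in> schwartz_space" "sbound (max N M) g (min \<delta> \<epsilon>)" for g
    proof -
      have "sbound N g \<delta>" "sbound M g \<epsilon>"
        using that(2) by (auto intro: sbound_le[OF sbound_order_mono])
      then show ?thesis using * that(1) by blast
    qed
    then show ?case using *(1,2) by (intro exI[of _ "max N M"] exI[of _ "min \<delta> \<epsilon>"]) auto
  next
    case (UN K)
    then obtain k where "k \<in> K" "(\<lambda>x. 0) \<in> k" by blast
    then show ?case using UN.IH[of k] by (meson UnionI)
  next
    case (Basis s)
    then obtain f k "is" e where s: "s = {g \<in> schwartz_space. schwartz_seminorm k is (\<lambda>x. g x - f x) < e}"
      "f \<in> schwartz_space" unfolding B_def by blast
    let ?f = "\<lambda>x. 0 - f x"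
    have f: "?f \<in> schwartz_space" using s(2) schwartz_diff schwartz_zero by blast
    let ?d = "(e - schwartz_seminorm k is ?f) / 2"
    have d: "?d > 0" using Basis.prems unfolding s by simp
    have "g \<in> s" if g: "g \<in> schwartz_space" "sbound (max k (length is)) g ?d" for g
    proof -
      have "schwartz_seminorm k is (\<lambda>x. g x - f x) \<le> schwartz_seminorm k is g + schwartz_seminorm k is ?f"
        using schwartz_seminorm_add[OF g(1) f, of k "is"] by simp
      also have "schwartz_seminorm k is g \<le> ?d" by (rule schwartz_seminorm_le[OF g(2)]) auto
      finally show ?thesis using g(1) d unfolding s by (simp add: field_simps)
    qed
    then show ?case using d by blast
  qed
qed

text \<open>The preimage of the unit ball contains every Schwartz function with
  \<open>sbound N g \<delta>\<close>, for some \<open>N\<close> and \<open>\<delta>\<close>;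
  homogeneity turns this into a bound with the constant \<open>1 / \<delta>\<close>.\<close>

lemma tempered_distribution_schwartz_functional:
  fixes T :: "(real ^ 'n \<Rightarrow> complex) \<Rightarrow> complex"
  assumes "tempered_distribution T"
  shows "schwartz_functional T"
proof
  have T: "\<And>f g. f \<in> schwartz_space \<Longrightarrow> g \<in> schwartz_space \<Longrightarrow> T (\<lambda>x. f x + g x) = T f + T g"
    "\<And>c f. f \<in> schwartz_space \<Longrightarrow> T (\<lambda>x. c * f x) = c * T f"
    "continuous_map schwartz_topology euclidean T"
    using assms unfolding tempered_distribution_def by blast+
  then show "\<And>f g. f \<in> schwartz_space \<Longrightarrow> g \<in> schwartz_space \<Longrightarrow> T (\<lambda>x. f x + g x) = T f + T g"
    "\<And>c f. f \<in> schwartz_space \<Longrightarrow> T (\<lambda>x. c * f x) = c * T f" by blast+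
  have T0: "T (\<lambda>x. 0) = 0" using T(2)[OF schwartz_zero, of 0] by simp
  let ?W = "{g \<in> topspace schwartz_topology. T g \<in> ball 0 1}"
  have "openin schwartz_topology ?W"
    using T(3) by (rule openin_continuous_map_preimage) auto
  moreover have "(\<lambda>x. 0) \<in> topspace schwartz_topology"
  proof -
    have "schwartz_seminorm 0 [] (\<lambda>x. 0 - 0 :: complex) < 1" by (simp add: schwartz_seminorm_def)
    then show ?thesis
      unfolding schwartz_topology_def topology_generated_by_topspace
      by (intro UnionI[of "{g \<in> schwartz_space. schwartz_seminorm 0 [] (\<lambda>x. g x - 0) < 1}"] CollectI
          exI[of _ "\<lambda>x. 0"] exI[of _ 0] exI[of _ "[]"] exI[of _ 1]) (auto simp: schwartz_zero)
  qed
  ultimately obtain N \<delta> where N: "\<delta> > 0" "\<And>g. g \<in> schwartz_space \<Longrightarrow> sbound N g \<delta> \<Longrightarrow> g \<in> ?W"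
    using schwartz_topology_nhd_zero[of ?W] T0 by auto
  have pos: "norm (T f) \<le> A / \<delta>" if f: "f \<in> schwartz_space" "sbound N f A" "A > 0" for f A
  proof -
    let ?c = "of_real (\<delta> / A) :: complex"
    have "sbound N (\<lambda>x. ?c * f x) \<delta>"
      using sbound_cmult[OF schwartz_smooth[OF f(1)] f(2), of ?c] f(3) N(1) by (simp add: norm_divide)
    then have "(\<lambda>x. ?c * f x) \<in> ?W"
      using N(2) schwartz_cmult[OF f(1)] by blast
    then have "norm (?c * T f) < 1" using T(2)[OF f(1), of ?c] by simp
    then show ?thesis using f(3) N(1) by (simp add: norm_mult norm_divide field_simps)
  qed
  \<comment> \<open>The scaling argument divides by \<open>A\<close>, which may be 0 here; it is
    therefore applied to \<open>A + e * \<delta>\<close> with \<open>e\<close> arbitrary.\<close>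
  have "norm (T f) \<le> 1 / \<delta> * A" if f: "f \<in> schwartz_space" "sbound N f A" for f A
  proof (rule field_le_epsilon)
    fix e :: real assume "e > 0"
    then have "norm (T f) \<le> (A + e * \<delta>) / \<delta>"
      using sbound_nonneg[OF f(2)] N(1) sbound_le[OF f(2)] by (intro pos f) (auto simp: add_nonneg_pos)
    then show "norm (T f) \<le> 1 / \<delta> * A + e" using N(1) by (simp add: field_simps)
  qed
  then show "\<exists>N C. \<forall>f\<in>schwartz_space. \<forall>A. sbound N f A \<longrightarrow> norm (T f) \<le> C * A" by blast
qed

section \<open>Cutoff functions and uniform boundedness\<close>

lemma smooth_upto_linear:
  assumes "bounded_linear L"
  shows "smooth_upto n f \<Longrightarrow> smooth_upto n (\<lambda>x. L (f x))"
proof (induction n arbitrary: f)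
  case 0
  then show ?case
    using bounded_linear.has_derivative[OF assms] unfolding smooth_upto_0 differentiable_def by blast
next
  case (Suc n)
  then have "smooth_upto 0 (\<lambda>x. L (f x))"
    using bounded_linear.has_derivative[OF assms] smooth_upto_differentiable[OF Suc.prems]
    unfolding smooth_upto_0 differentiable_def by blast
  then show ?case
    using Suc by (auto simp: smooth_upto_Suc smooth_upto_0 partial_deriv_linear[OF assms])
qed

lemma bounded_linear_Re_complex: "bounded_linear (\<lambda>z. complex_of_real (Re z))"
  by (intro bounded_linear_compose[OF bounded_linear_of_real bounded_linear_Re])

lemma has_derivative_compose_Re:
  fixes G G' :: "real \<Rightarrow> real" and w :: "real ^ 'n \<Rightarrow> complex"
  assumes "\<And>t. (G has_real_derivative G' t) (at t)" "w differentiable (at x)"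
  shows "((\<lambda>x. of_real (G (Re (w x))) :: complex) has_derivative
    (\<lambda>h. of_real (G' (Re (w x)) * Re (frechet_derivative w (at x) h)))) (at x)"
proof -
  have "((\<lambda>x. Re (w x)) has_derivative (\<lambda>h. Re (frechet_derivative w (at x) h))) (at x)"
    using assms(2) by (auto simp: frechet_derivative_works intro: has_derivative_Re)
  from has_derivative_compose[OF this assms(1)[unfolded has_field_derivative_def]]
  show ?thesis by (rule bounded_linear.has_derivative[OF bounded_linear_of_real])
qed

text \<open>\<open>F\<close> lists the successive derivatives of one function of a real variable.
  The claim is made for every \<open>k\<close> at once because the chain rule passes from
  \<open>F k\<close> to \<open>F (Suc k)\<close>. The real argument is taken as \<open>Re\<close> of
  a complex-valued function so that \<open>smooth\<close> applies to it.\<close>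

lemma smooth_upto_compose:
  fixes F :: "nat \<Rightarrow> real \<Rightarrow> real" and w :: "real ^ 'n \<Rightarrow> complex"
  assumes F: "\<And>k t. (F k has_real_derivative F (Suc k) t) (at t)"
  shows "smooth_upto n w \<Longrightarrow> smooth_upto n (\<lambda>x. of_real (F k (Re (w x))))"
proof (induction n arbitrary: k)
  case (0 k)
  then show ?case
    using has_derivative_compose_Re[OF F smooth_upto_differentiable[OF 0], of k]
    unfolding smooth_upto_0 differentiable_def by blast
next
  case (Suc n k)
  note D = has_derivative_compose_Re[OF F smooth_upto_differentiable[OF Suc.prems], of k]
  have "partial_deriv i (\<lambda>x. of_real (F k (Re (w x)))) =
      (\<lambda>x. of_real (F (Suc k) (Re (w x))) * of_real (Re (partial_deriv i w x)))" for i
    by (simp add: partial_deriv_eq[OF D] fun_eq_iff) (simp add: partial_deriv_def)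
  moreover have "smooth_upto n (\<lambda>x. of_real (Re (partial_deriv i w x)) :: complex)" for i
    using Suc.prems by (intro smooth_upto_linear[OF bounded_linear_Re_complex]) (simp add: smooth_upto_Suc)
  moreover have "smooth_upto n w" using smooth_upto_mono[OF Suc.prems, of n] by simp
  ultimately show ?case
    using D Suc.IH by (auto simp: smooth_upto_Suc differentiable_def intro!: smooth_upto_mult)
qed

lemma smooth_compose:
  fixes F :: "nat \<Rightarrow> real \<Rightarrow> real"
  assumes "\<And>k t. (F k has_real_derivative F (Suc k) t) (at t)" "smooth w"
  shows "smooth (\<lambda>x. of_real (F k (Re (w x))))"
  using assms(2) smooth_upto_compose[where F = F, OF assms(1)] unfolding smooth_iff_smooth_upto by blast

lemma smooth_coordinate: "smooth (\<lambda>x :: real ^ 'n. of_real (a * x $ i + b))"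
proof -
  have D: "((\<lambda>x :: real ^ 'n. of_real (a * x $ i + b) :: complex) has_derivative (\<lambda>h. of_real (a * h $ i))) (at x)" for x
    by (intro bounded_linear.has_derivative[OF bounded_linear_of_real])
      (auto intro!: derivative_eq_intros bounded_linear_imp_has_derivative[OF bounded_linear_vec_nth])
  have "smooth_upto n (\<lambda>x :: real ^ 'n. of_real (a * x $ i + b) :: complex)" for n
  proof (cases n)
    case (Suc m)
    have "partial_deriv k (\<lambda>x :: real ^ 'n. of_real (a * x $ i + b)) = (\<lambda>x. of_real (a * axis k 1 $ i))" for k
      using partial_deriv_eq[OF D] by fastforce
    moreover have "smooth_upto m (\<lambda>x :: real ^ 'n. of_real c)" for c
      using smooth_const smooth_iff_smooth_upto by blast
    ultimately show ?thesis using D unfolding Suc smooth_upto_Suc differentiable_def by metis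
  qed (use D in \<open>auto simp: smooth_upto_0 differentiable_def\<close>)
  then show ?thesis by (simp add: smooth_iff_smooth_upto)
qed

text \<open>The functions \<open>p(1/t) exp(-1/t)\<close>, extended by 0 to
  \<open>t \<le> 0\<close>, form a class closed under differentiation: the derivative belongs to the
  polynomial \<open>X^2 (p - p')\<close>, written \<open>[:0, 0, 1:] * (p - pderiv p)\<close> below.
  Iteration supplies the list of derivatives for \<open>smooth_compose\<close>.\<close>

definition flat :: "real poly \<Rightarrow> real \<Rightarrow> real" where
  "flat p t = (if t > 0 then poly p (1 / t) * exp (- 1 / t) else 0)"

lemma poly_times_exp_tendsto_0: "((\<lambda>s. poly p s * exp (- s)) \<longlongrightarrow> (0::real)) at_top"
proof -
  have "((\<lambda>s. \<Sum>i\<le>degree p. coeff p i * (s ^ i / exp s)) \<longlongrightarrow> (\<Sum>i\<le>degree p. coeff p i * 0)) at_top"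
    by (intro tendsto_intros tendsto_power_div_exp_0)
  then show ?thesis
    by (simp add: poly_altdef exp_minus sum_distrib_right divide_inverse mult.assoc)
qed

lemma flat_has_derivative:
  "(flat p has_real_derivative flat ([:0, 0, 1:] * (p - pderiv p)) t) (at t)"
proof -
  consider "t > 0" | "t < 0" | "t = 0" by linarith
  then show ?thesis
  proof cases
    case 1
    have "((\<lambda>t. poly p (1 / t) * exp (- 1 / t)) has_real_derivative
        flat ([:0, 0, 1:] * (p - pderiv p)) t) (at t)"
      using 1 by (auto intro!: derivative_eq_intros DERIV_chain2[OF poly_DERIV]
          simp: flat_def field_simps power2_eq_square)
    then show ?thesis
      by (rule has_field_derivative_transform_within_open[where S = "{0<..}"]) (use 1 in \<open>auto simp: flat_def\<close>)
  next
    case 2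
    have "((\<lambda>t. 0) has_real_derivative flat ([:0, 0, 1:] * (p - pderiv p)) t) (at t)"
      using 2 by (auto simp: flat_def)
    then show ?thesis
      by (rule has_field_derivative_transform_within_open[where S = "{..<0}"]) (use 2 in \<open>auto simp: flat_def\<close>)
  next
    case 3
    \<comment> \<open>The difference quotient at 0 is \<open>flat p h / h\<close>, which for
      \<open>h > 0\<close> is the polynomial \<open>X p\<close> at \<open>s = 1/h\<close> times
      \<open>exp (- s)\<close>.\<close>
    have "((\<lambda>s. poly ([:0, 1:] * p) s * exp (- s)) \<longlongrightarrow> 0) at_top"
      by (rule poly_times_exp_tendsto_0)
    then have "((\<lambda>h. poly ([:0, 1:] * p) (inverse h) * exp (- inverse h)) \<longlongrightarrow> 0) (at_right 0)"
      by (rule filterlim_compose[OF _ filterlim_inverse_at_top_right])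
    then have "((\<lambda>h. flat p h / h) \<longlongrightarrow> 0) (at_right 0)"
      by (rule Lim_transform_eventually)
        (auto simp: eventually_at_right_less flat_def field_simps
          intro!: eventually_mono[OF eventually_at_right_less[of 0]])
    moreover have "((\<lambda>h. flat p h / h) \<longlongrightarrow> 0) (at_left 0)"
      by (rule Lim_transform_eventually[OF tendsto_const])
        (auto simp: flat_def eventually_at_left_field intro!: exI[of _ "-1"])
    ultimately have "((\<lambda>h. flat p h / h) \<longlongrightarrow> 0) (at 0)"
      using filterlim_split_at by blast
    then show ?thesis unfolding 3 by (simp add: DERIV_def flat_def)
  qed
qed

definition flat_poly :: "nat \<Rightarrow> real poly" where
  "flat_poly k = ((\<lambda>p. [:0, 0, 1:] * (p - pderiv p)) ^^ k) 1"

lemma flat_poly_derivative: "(flat (flat_poly k) has_real_derivative flat (flat_poly (Suc k)) t) (at t)"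
  using flat_has_derivative[of "flat_poly k" t] by (simp add: flat_poly_def)

lemma flat_one: "flat 1 t = (if t > 0 then exp (- 1 / t) else 0)"
  by (simp add: flat_def)

text \<open>The sum \<open>s\<close> of \<open>flat 1 (\<bar>x $ i\<bar> - 1)\<close> over all
  coordinates, with the modulus resolved into the two signs, vanishes on the unit ball. It is at
  least \<open>1 / 2\<close> once a coordinate exceeds 3 in modulus, since
  \<open>exp (- 1 / t) \<ge> 1 - 1 / t \<ge> 1 / 2\<close> for \<open>t > 2\<close>. So
  \<open>flat 1 (1 / 2 - s)\<close>, divided by its value at \<open>s = 0\<close>, is 1 on the ball
  and 0 far out. A vector of norm above \<open>3 * CARD('n)\<close> has such a coordinate.\<close>

lemma exists_cutoff:
  obtains \<eta> :: "real ^ 'n \<Rightarrow> complex" and R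
  where "smooth \<eta>" "\<And>x. norm x \<le> 1 \<Longrightarrow> \<eta> x = 1" "\<And>x. norm x > R \<Longrightarrow> \<eta> x = 0" "R \<ge> 1"
proof -
  let ?g = "\<lambda>a i (x :: real ^ 'n). complex_of_real (flat 1 (a * x $ i + (- 1)))"
  let ?s = "\<lambda>x. \<Sum>i\<in>UNIV. ?g 1 i x + ?g (-1) i x"
  let ?\<eta> = "\<lambda>x. of_real (flat 1 (Re (1 / 2 - ?s x))) * (1 / of_real (flat 1 (1 / 2))) :: complex"
  let ?R = "3 * real CARD('n)"
  have comp: "smooth (\<lambda>x. complex_of_real (flat 1 (Re (w x))))" if "smooth w" for w :: "real ^ 'n \<Rightarrow> complex"
    using smooth_compose[where F = "\<lambda>k. flat (flat_poly k)" and k = 0, OF flat_poly_derivative that]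
    by (simp add: flat_poly_def)
  have g: "smooth (?g a i)" for a i
    using comp[OF smooth_coordinate[of a i "-1"]] by simp
  have sm: "smooth ?\<eta>"
    by (rule smooth_mult[OF comp smooth_const]) (intro smooth_diff smooth_const smooth_sum smooth_add g)
  have one: "?\<eta> x = 1" if "norm x \<le> 1" for x
  proof -
    have "\<bar>x $ i\<bar> \<le> 1" for i using that component_le_norm_cart[of x i] by linarith
    then have "?g 1 i x = 0" "?g (-1) i x = 0" for i
      using abs_le_D1[of "x $ i" 1] abs_le_D2[of "x $ i" 1] by (auto simp: flat_one)
    then show ?thesis by (simp add: flat_one)
  qed
  have zero: "?\<eta> x = 0" if "norm x > ?R" for x
  proof -
    have "\<exists>i. \<bar>x $ i\<bar> > 3"
    proof (rule ccontr)
      assume "\<not> ?thesis"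
      then have "(\<Sum>i\<in>UNIV. \<bar>x $ i\<bar>) \<le> (\<Sum>i\<in>(UNIV::'n set). 3)" by (intro sum_mono) (auto simp: not_less)
      then show False using norm_le_l1_cart[of x] that by simp
    qed
    then obtain i where i: "\<bar>x $ i\<bar> > 3" ..
    have nonneg: "flat 1 t \<ge> 0" for t by (simp add: flat_one)
    have half: "flat 1 t \<ge> 1 / 2" if "t > 2" for t
    proof -
      have "1 / t \<le> 1 / 2" using that by (intro divide_left_mono) auto
      then have "1 / 2 \<le> 1 + (- 1 / t)" by simp
      also have "\<dots> \<le> exp (- 1 / t)" by (rule exp_ge_add_one_self)
      finally show ?thesis using that by (simp add: flat_one)
    qed
    have "1 / 2 \<le> flat 1 (1 * x $ i + (- 1)) + flat 1 ((-1) * x $ i + (- 1))"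
      using i half[of "x $ i - 1"] half[of "- x $ i - 1"] nonneg[of "x $ i - 1"] nonneg[of "- x $ i - 1"]
      by (cases "x $ i > 0") auto
    also have "\<dots> \<le> (\<Sum>i\<in>UNIV. flat 1 (1 * x $ i + (- 1)) + flat 1 ((-1) * x $ i + (- 1)))"
      by (rule member_le_sum) (use nonneg in \<open>auto intro!: add_nonneg_nonneg\<close>)
    finally have "Re (1 / 2 - ?s x) \<le> 0" by simp
    then show ?thesis by (simp add: flat_one)
  qed
  have "?R \<ge> 1"
    using zero_less_card_finite[where 'a = 'n] by linarith
  then show ?thesis using that[OF sm one zero] by blast
qed

section \<open>Test functions supported in a fixed ball\<close>

lemma partial_derivs_zero_open:
  assumes "open W" "x \<in> W" "\<And>y. y \<in> W \<Longrightarrow> f y = 0"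
  shows "partial_derivs is f x = 0"
  using partial_derivs_cong_open[OF assms(1,2), of f "\<lambda>y. 0"] assms(3) by simp

lemma open_norm_greater: "open {x :: 'a :: real_normed_vector. norm x > R}"
  and open_norm_less: "open {x :: 'a :: real_normed_vector. norm x < R}"
  by (auto intro!: open_Collect_less continuous_intros)

lemma partial_derivs_bounded_compact_support:
  assumes "smooth f" "\<And>x. norm x > R \<Longrightarrow> f x = 0"
  shows "\<exists>B. \<forall>x. norm (partial_derivs is f x) \<le> B"
proof -
  have "compact (partial_derivs is f ` cball 0 R)"
    using assms(1) by (intro compact_continuous_image smooth_continuous smooth_partial_derivs) auto
  then have "bounded (partial_derivs is f ` cball 0 R)" by (rule compact_imp_bounded)
  then obtain B where B: "\<And>x. norm x \<le> R \<Longrightarrow> norm (partial_derivs is f x) \<le> B" "B > 0"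
    unfolding bounded_pos by (metis imageI mem_cball_0)
  have "norm (partial_derivs is f x) \<le> B" for x
  proof (cases "norm x \<le> R")
    case False
    have "partial_derivs is f x = 0"
      using False assms(2) by (intro partial_derivs_zero_open[OF open_norm_greater[of R]]) auto
    then show ?thesis using B by simp
  qed (use B in auto)
  then show ?thesis by blast
qed

lemma schwartz_compact_support:
  assumes "smooth f" "\<And>x. norm x > R \<Longrightarrow> f x = 0"
  shows "f \<in> schwartz_space"
proof -
  have "\<exists>A. sbound N f A" for N
  proof -
    obtain B where B: "B > 0" "\<And>is x. length is \<le> N \<Longrightarrow> norm (partial_derivs is f x) \<le> B"
      using partial_derivs_bounded_upto[of f N, OF partial_derivs_bounded_compact_support[OF assms(1), of R]] assms(2)
      by blast
    have "sbound N f ((1 + \<bar>R\<bar>) ^ N * B)"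
    proof (rule sboundI)
      fix "is" :: "'a list" and x :: "real ^ 'a"
      assume l: "length is \<le> N"
      show "(1 + norm x) ^ N * norm (partial_derivs is f x) \<le> (1 + \<bar>R\<bar>) ^ N * B"
      proof (cases "norm x \<le> R")
        case True
        then show ?thesis using l B by (intro mult_mono power_mono) auto
      next
        case False
        have "partial_derivs is f x = 0"
          using False assms(2) by (intro partial_derivs_zero_open[OF open_norm_greater[of R]]) auto
        then show ?thesis using B by simp
      qed
    qed
    then show ?thesis ..
  qed
  then show ?thesis using assms(1) schwartz_iff by blast
qed

definition test_functions_in_ball :: "real \<Rightarrow> (real ^ 'n \<Rightarrow> complex) set" where
  "test_functions_in_ball R = {\<psi>. smooth \<psi> \<and> (\<forall>x. norm x > R \<longrightarrow> \<psi> x = 0)}"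

lemma test_functions_in_ball_schwartz: "\<psi> \<in> test_functions_in_ball R \<Longrightarrow> \<psi> \<in> schwartz_space"
  by (auto simp: test_functions_in_ball_def intro: schwartz_compact_support)

text \<open>
  The uniform boundedness principle for the space of test functions supported in a fixed ball, by a
  gliding hump: if it fails, pick \<open>\<psi>\<^sub>k\<close> so small that it disturbs neither the convergence of
  \<open>\<Sum>k. \<psi>\<^sub>k\<close> in any Schwartz seminorm nor the earlier functionals, although some \<open>U\<^sub>j\<close> is larger on
  it than on the preceding partial sum.
\<close>

lemma uniform_boundedness_test_functions:
  fixes U :: "nat \<Rightarrow> (real ^ 'n \<Rightarrow> complex) \<Rightarrow> complex"
  assumes U: "\<And>j. schwartz_functional (U j)"
    and bounded: "\<And>\<psi>. \<psi> \<in> test_functions_in_ball R \<Longrightarrow> \<exists>B. \<forall>j. norm (U j \<psi>) \<le> B"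
  shows "\<exists>N C. \<forall>j. \<forall>\<psi>\<in>test_functions_in_ball R. \<forall>A. sbound N \<psi> A \<longrightarrow> norm (U j \<psi>) \<le> C * A"
proof (rule ccontr)
  let ?D = "test_functions_in_ball R :: (real ^ 'n \<Rightarrow> complex) set"
  assume "\<not> ?thesis"
  then have unbounded: "\<exists>j. \<exists>\<psi>\<in>?D. \<exists>A. sbound N \<psi> A \<and> norm (U j \<psi>) > C * A" for N C
    by (meson not_le)
  note schw = test_functions_in_ball_schwartz[of _ R]
  \<comment> \<open>Failure of the bound with the constant \<open>B / \<delta>\<close>, rescaled:
    the new function has norm at most \<open>\<delta>\<close>, while the functional takes a value of
    modulus exactly \<open>B\<close>.\<close>
  have hump: "\<exists>j. \<exists>\<psi>\<in>?D. sbound N \<psi> \<delta> \<and> norm (U j \<psi>) \<ge> B" if "\<delta> > 0" "B > 0" for N \<delta> B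
  proof -
    obtain j \<psi> A where *: "\<psi> \<in> ?D" "sbound N \<psi> A" "norm (U j \<psi>) > B / \<delta> * A"
      using unbounded by blast
    have A: "A \<ge> 0" using sbound_nonneg[OF *(2)] .
    then have u: "norm (U j \<psi>) > 0" using *(3) that by (intro le_less_trans[OF _ *(3)]) simp
    let ?c = "of_real (B / norm (U j \<psi>)) :: complex"
    have c: "norm ?c = B / norm (U j \<psi>)" using that u by (simp add: norm_divide)
    have "sbound N (\<lambda>x. ?c * \<psi> x) \<delta>"
    proof (rule sbound_le[OF sbound_cmult[OF _ *(2)]])
      show "smooth \<psi>" using *(1) by (simp add: test_functions_in_ball_def)
      show "norm ?c * A \<le> \<delta>" unfolding c using *(3) that u by (simp add: field_simps)
    qed
    moreover have "(\<lambda>x. ?c * \<psi> x) \<in> ?D"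
      using *(1) smooth_mult[OF smooth_const, of \<psi> ?c] by (simp add: test_functions_in_ball_def)
    moreover have "norm (U j (\<lambda>x. ?c * \<psi> x)) = B"
      using schwartz_functional.cmult[OF U schw[OF *(1)], of j ?c] that u by (simp add: norm_mult norm_divide)
    ultimately show ?thesis by (metis order_refl)
  qed
  \<comment> \<open>A state holds the partial sum \<open>v\<close>, an order \<open>n\<close>, a
    size \<open>\<delta>\<close>, and the latest index and hump. \<open>k \<le> n\<close> makes the
    later humps small in every norm; the last clause of \<open>Q\<close> converts smallness of the
    rest of the series into a bound on the functional just chosen. In the initial state, index and
    hump are placeholders.\<close>
  define P where "P = (\<lambda>(k::nat) s. case s of (v, n, \<delta>, j :: nat, \<psi> :: real ^ 'n \<Rightarrow> complex) \<Rightarrow>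
    v \<in> ?D \<and> k \<le> (n::nat) \<and> (\<delta>::real) > 0)"
  define Q where "Q = (\<lambda>(k::nat) s s'. case s of (v, n::nat, \<delta>::real, _ :: nat, _ :: real ^ 'n \<Rightarrow> complex) \<Rightarrow>
    case s' of (v', n'::nat, \<delta>', j, \<psi>) \<Rightarrow> \<psi> \<in> ?D \<and> sbound n \<psi> \<delta> \<and> norm (U j \<psi>) \<ge> norm (U j v) + k + 1 \<and>
      v' = (\<lambda>x. v x + \<psi> x) \<and> \<delta>' \<le> \<delta> / 2 \<and> n < n' \<and>
      (\<forall>w\<in>schwartz_space. \<forall>A. sbound n' w A \<longrightarrow> norm (U j w) \<le> A / \<delta>'))"
  have "\<exists>s. \<forall>k. P k (s k) \<and> Q k (s k) (s (Suc k))"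
  proof (rule dependent_nat_choice)
    show "\<exists>s. P 0 s"
      by (rule exI[of _ "(\<lambda>x. 0, 0, 1, 0, \<lambda>x. 0)"]) (auto simp: P_def test_functions_in_ball_def)
  next
    fix s k assume "P k s"
    moreover obtain v n \<delta> j0 \<psi>0 where s: "s = (v, n, \<delta>, j0, \<psi>0)" using prod_cases5 by blast
    ultimately have v: "v \<in> ?D" and "k \<le> n" "\<delta> > 0" unfolding P_def s prod.case by blast+
    obtain B where B: "\<And>j. norm (U j v) \<le> B" using bounded[OF v] by blast
    have "B + k + 1 > 0" using B[of 0] norm_ge_zero[of "U 0 v"] by linarith
    then obtain j \<psi> where \<psi>: "\<psi> \<in> ?D" "sbound n \<psi> \<delta>" "norm (U j \<psi>) \<ge> B + k + 1"
      using hump[OF \<open>\<delta> > 0\<close>] by blast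
    obtain N C where C: "C > 0" "\<And>f A. f \<in> schwartz_space \<Longrightarrow> sbound N f A \<Longrightarrow> norm (U j f) \<le> C * A"
      by (rule schwartz_functional.bound[OF U[of j]]) blast
    let ?v = "\<lambda>x. v x + \<psi> x" and ?n = "max (Suc n) N" and ?\<delta> = "min (\<delta> / 2) (1 / C)"
    have 1: "norm (U j w) \<le> A / ?\<delta>" if "w \<in> schwartz_space" "sbound ?n w A" for w A
    proof -
      have "norm (U j w) \<le> C * A"
        by (rule C(2)[OF that(1) sbound_order_mono[OF that(2)]]) simp
      also have "\<dots> = A / (1 / C)" by simp
      also have "\<dots> \<le> A / ?\<delta>"
        using sbound_nonneg[OF that(2)] C(1) \<open>\<delta> > 0\<close>
        by (intro divide_left_mono mult_pos_pos min.cobounded2) simp_all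
      finally show ?thesis .
    qed
    have 2: "?v \<in> ?D" using v \<psi>(1) smooth_add by (auto simp: test_functions_in_ball_def)
    have 3: "norm (U j \<psi>) \<ge> norm (U j v) + k + 1" using \<psi>(3) B[of j] by linarith
    have "P (Suc k) (?v, ?n, ?\<delta>, j, \<psi>)"
      unfolding P_def prod.case using 2 C(1) \<open>\<delta> > 0\<close> \<open>k \<le> n\<close> by simp
    moreover have "Q k s (?v, ?n, ?\<delta>, j, \<psi>)"
      unfolding Q_def s prod.case
      by (intro conjI refl ballI allI impI 1 3 \<psi>(1,2)) (rule min.cobounded1, simp)
    ultimately show "\<exists>s'. P (Suc k) s' \<and> Q k s s'"
      by (intro exI[of _ "(?v, ?n, ?\<delta>, j, \<psi>)"] conjI)
  qed
  then obtain s where s: "\<And>k. P k (s k)" "\<And>k. Q k (s k) (s (Suc k))" by blast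
  define v where "v k = fst (s k)" for k
  define n where "n k = fst (snd (s k))" for k
  define \<delta> where "\<delta> k = fst (snd (snd (s k)))" for k
  define j where "j k = fst (snd (snd (snd (s (Suc k)))))" for k
  define \<psi> where "\<psi> k = snd (snd (snd (snd (s (Suc k)))))" for k
  have P: "v k \<in> ?D" "k \<le> n k" "\<delta> k > 0" for k
    using s(1)[of k] unfolding P_def v_def n_def \<delta>_def case_prod_beta by blast+
  have Q: "\<psi> k \<in> ?D" "sbound (n k) (\<psi> k) (\<delta> k)" "norm (U (j k) (\<psi> k)) \<ge> norm (U (j k) (v k)) + k + 1"
    "v (Suc k) = (\<lambda>x. v k x + \<psi> k x)" "\<delta> (Suc k) \<le> \<delta> k / 2" "n k < n (Suc k)"
    "\<And>w A. w \<in> schwartz_space \<Longrightarrow> sbound (n (Suc k)) w A \<Longrightarrow> norm (U (j k) w) \<le> A / \<delta> (Suc k)" for k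
    using s(2)[of k] unfolding Q_def v_def n_def \<delta>_def j_def \<psi>_def case_prod_beta by blast+
  have \<psi>: "\<psi> k \<in> schwartz_space" for k using Q(1) schw by blast
  have n_mono: "n k \<le> n (i + k)" for i k
    using Q(6) by (induction i) (auto intro: order_trans less_imp_le)
  have \<delta>_le: "\<delta> (i + k) \<le> \<delta> k * (1 / 2) ^ i" for i k
  proof (induction i)
    case (Suc i)
    then show ?case using Q(5)[of "i + k"] by simp
  qed simp
  have "\<forall>N k. \<exists>A. sbound N (\<psi> k) A" using \<psi> schwartz_iff by blast
  then have "\<exists>a. \<forall>N k. sbound N (\<psi> k) (a N k)" by metis
  then obtain a0 where a0: "\<And>N k. sbound N (\<psi> k) (a0 N k)" by blast
  \<comment> \<open>At the latest from \<open>k = N\<close> on, the hump is bounded by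
    \<open>\<delta> k\<close> in the norm \<open>N\<close>; finitely many earlier ones may take
    arbitrary bounds without harm to summability.\<close>
  define a where "a N k = (if N \<le> n k then \<delta> k else a0 N k)" for N k
  have a: "sbound N (\<psi> k) (a N k)" for N k
    using a0 sbound_order_mono[OF Q(2)] by (auto simp: a_def)
  have tail: "summable (\<lambda>i. \<delta> (i + k))" "(\<Sum>i. \<delta> (i + k)) \<le> \<delta> k * 2" for k
  proof -
    have g: "(\<lambda>i. \<delta> k * (1 / 2) ^ i) sums (\<delta> k * 2)"
      using sums_mult[OF geometric_sums[of "1 / 2 :: real"], of "\<delta> k"] by simp
    show *: "summable (\<lambda>i. \<delta> (i + k))"
    proof (rule summable_comparison_test'[OF sums_summable[OF g]])
      show "norm (\<delta> (i + k)) \<le> \<delta> k * (1 / 2) ^ i" for i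
        using P(3)[of "i + k"] \<delta>_le[of i k] by simp
    qed
    show "(\<Sum>i. \<delta> (i + k)) \<le> \<delta> k * 2"
      using suminf_le[OF \<delta>_le * sums_summable[OF g]] sums_unique[OF g] by simp
  qed
  have asum: "summable (a N)" for N
  proof -
    have "a N (k + N) = \<delta> (k + N)" for k using P(2)[of "k + N"] by (auto simp: a_def)
    then show ?thesis using tail(1)[of N] summable_iff_shift[of "a N" N] by simp
  qed
  let ?u = "\<lambda>x. v 0 x + (\<Sum>k. \<psi> k x)"
  have "?u \<in> schwartz_space" using schwartz_add[OF schw[OF P(1)] schwartz_suminf[OF \<psi> a asum]] .
  then have "?u \<in> ?D" using schwartz_smooth P(1)[of 0] Q(1) by (auto simp: test_functions_in_ball_def)
  then obtain B where B: "\<And>j. norm (U j ?u) \<le> B" using bounded by blast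
  have sm: "summable (\<lambda>k. \<psi> k x)" for x
    using sbound_norm_le'[OF a[of 0], of "[]"] by (intro summable_comparison_test'[OF asum[of 0]]) auto
  \<comment> \<open>Split \<open>?u\<close> into the earlier partial sum, the hump and the tail. The
    value on the hump exceeds that on the partial sum by \<open>k + 1\<close>, and the tail, whose
    bounds add up to at most \<open>2 * \<delta> (Suc k)\<close>, contributes at most 2.\<close>
  have "norm (U (j k) ?u) \<ge> real k - 1" for k
  proof -
    interpret schwartz_functional "U (j k)" by (rule U)
    let ?t = "\<lambda>x. \<Sum>i. \<psi> (i + Suc k) x"
    have a': "summable (\<lambda>i. a N (i + Suc k))" for N using asum summable_iff_shift by blast
    have t: "?t \<in> schwartz_space" "sbound N ?t (\<Sum>i. a N (i + Suc k))" for N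
      by (fact schwartz_suminf[of "\<lambda>i. \<psi> (i + Suc k)" "\<lambda>N i. a N (i + Suc k)", OF \<psi> a a'],
          fact sbound_suminf[of "\<lambda>i. \<psi> (i + Suc k)" "\<lambda>N i. a N (i + Suc k)", OF \<psi> a a'])
    have vm: "v m x = v 0 x + (\<Sum>i<m. \<psi> i x)" for m x by (induction m) (simp_all add: Q(4))
    have "(\<Sum>k. \<psi> k x) = ?t x + (\<Sum>i<Suc k. \<psi> i x)" for x
      by (rule suminf_split_initial_segment[OF sm])
    then have eq: "?u = (\<lambda>x. v (Suc k) x + ?t x)"
      unfolding vm[of "Suc k"] by (simp only: add_ac)
    have "a (n (Suc k)) (i + Suc k) = \<delta> (i + Suc k)" for i
      using n_mono[of "Suc k" i] by (simp add: a_def)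
    then have "sbound (n (Suc k)) ?t (\<Sum>i. \<delta> (i + Suc k))" using t(2)[of "n (Suc k)"] by simp
    then have "sbound (n (Suc k)) ?t (\<delta> (Suc k) * 2)" using tail(2) by (rule sbound_le)
    from Q(7)[OF t(1) this] have "norm (U (j k) ?t) \<le> 2" using P(3)[of "Suc k"] by simp
    moreover have "U (j k) ?u = U (j k) (v k) + U (j k) (\<psi> k) + U (j k) ?t"
      unfolding eq add[OF schw[OF P(1)] t(1)] unfolding Q(4) add[OF schw[OF P(1)] \<psi>] ..
    moreover have "norm y \<le> norm (x + y + z) + norm x + norm z" for x y z :: complex
      using norm_triangle_ineq4[of "x + y + z" x] norm_triangle_ineq4[of "y + z" z] by simp
    ultimately have "norm (U (j k) (\<psi> k)) \<le> norm (U (j k) ?u) + norm (U (j k) (v k)) + norm (U (j k) ?t)"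
      by presburger
    moreover note \<open>norm (U (j k) ?t) \<le> 2\<close>
    ultimately have "norm (U (j k) (\<psi> k)) \<le> norm (U (j k) ?u) + norm (U (j k) (v k)) + 2"
      by linarith
    then show ?thesis using Q(3)[of k] by linarith
  qed
  then have "real k - 1 \<le> B" for k using B order_trans by meson
  moreover obtain k :: nat where "B + 1 < real k" using reals_Archimedean2 by blast
  ultimately show False by (meson diff_le_eq not_le)
qed

section \<open>Dilations of a functional\<close>

lemma partial_derivs_bounded_const_minus:
  assumes "smooth f" "\<And>is. \<exists>B. \<forall>x. norm (partial_derivs is f x) \<le> B"
  shows "\<exists>B. \<forall>x. norm (partial_derivs is (\<lambda>x. c - f x) x) \<le> B"
proof -
  obtain B where B: "\<And>x. norm (partial_derivs is f x) \<le> B" using assms(2) by blast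
  obtain D where D: "\<And>x :: real ^ 'a. norm (partial_derivs is (\<lambda>x. c) x) \<le> D"
    by (cases "is") (auto simp del: partial_derivs.simps(2) simp: partial_derivs_const)
  have "norm (partial_derivs is (\<lambda>x. c - f x) x) \<le> D + B" for x
    using norm_triangle_ineq4[of "partial_derivs is (\<lambda>x. c) x" "partial_derivs is f x"] B[of x] D[of x]
    by (simp add: partial_derivs_diff assms)
  then show ?thesis by blast
qed

lemma norm_partial_derivs_affine_le:
  assumes "smooth f" "\<bar>c\<bar> \<le> 1" "\<And>x. norm (partial_derivs is f x) \<le> B"
  shows "norm (partial_derivs is (\<lambda>x. f (a + c *\<^sub>R x)) x) \<le> B"
proof -
  have "norm (partial_derivs is (\<lambda>x. f (a + c *\<^sub>R x)) x) = \<bar>c\<bar> ^ length is * norm (partial_derivs is f (a + c *\<^sub>R x))"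
    by (simp add: partial_derivs_affine assms(1) norm_mult norm_power)
  also have "\<dots> \<le> 1 * B"
    using assms(2,3) by (intro mult_mono power_le_one) auto
  finally show ?thesis by simp
qed

definition dilated ::
  "((real ^ 'n \<Rightarrow> complex) \<Rightarrow> complex) \<Rightarrow> real ^ 'n \<Rightarrow> nat \<Rightarrow> (real ^ 'n \<Rightarrow> complex) \<Rightarrow> complex" where
  "dilated U x0 j \<psi> = 2 ^ (CARD('n) * j) * U (\<lambda>y. \<psi> (2 ^ j *\<^sub>R (y - x0)))"

lemma schwartz_functional_dilated:
  fixes x0 :: "real ^ 'n"
  assumes "schwartz_functional U"
  shows "schwartz_functional (dilated U x0 j)"
proof
  interpret schwartz_functional U by fact
  let ?s = "\<lambda>\<psi> y. \<psi> (- (2 ^ j *\<^sub>R x0) + 2 ^ j *\<^sub>R y) :: complex"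
  have d: "dilated U x0 j \<psi> = 2 ^ (CARD('n) * j) * U (?s \<psi>)" for \<psi>
    by (simp add: dilated_def scaleR_diff_right)
  have s: "?s \<psi> \<in> schwartz_space" if "\<psi> \<in> schwartz_space" for \<psi>
    using schwartz_affine[OF that, where a = "- (2 ^ j *\<^sub>R x0)" and c = "2 ^ j"] by simp
  show "dilated U x0 j (\<lambda>x. f x + g x) = dilated U x0 j f + dilated U x0 j g"
    if "f \<in> schwartz_space" "g \<in> schwartz_space" for f g
    using add[OF s[OF that(1)] s[OF that(2)]] by (simp add: d distrib_left)
  show "dilated U x0 j (\<lambda>x. c * f x) = c * dilated U x0 j f" if "f \<in> schwartz_space" for f c
    using cmult[OF s[OF that], of c] by (simp add: d)
  obtain N C where C: "C > 0" "\<And>f A. f \<in> schwartz_space \<Longrightarrow> sbound N f A \<Longrightarrow> norm (U f) \<le> C * A"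
    by (rule bound) blast
  let ?K = "((1 + norm (- (2 ^ j *\<^sub>R x0))) * max 1 (1 / \<bar>2 ^ j\<bar>) * max 1 \<bar>2 ^ j\<bar>) ^ N"
  have "norm (dilated U x0 j f) \<le> (2 ^ (CARD('n) * j) * (C * ?K)) * A"
    if f: "f \<in> schwartz_space" "sbound N f A" for f A
  proof -
    have "norm (U (?s f)) \<le> C * (?K * A)"
      by (intro C s f sbound_affine schwartz_smooth) auto
    then show ?thesis by (simp add: d norm_mult norm_power mult.assoc)
  qed
  then show "\<exists>N C. \<forall>f\<in>schwartz_space. \<forall>A. sbound N f A \<longrightarrow> norm (dilated U x0 j f) \<le> C * A" by blast
qed

lemma dilated_rescale:
  fixes x0 :: "real ^ 'n"
  assumes "l \<le> j"
  shows "dilated U x0 j (\<lambda>x. \<psi> x * \<theta> ((1 / 2) ^ l *\<^sub>R x)) =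
    2 ^ (CARD('n) * l) * dilated U x0 (j - l) (\<lambda>x. \<psi> (2 ^ l *\<^sub>R x) * \<theta> x)"
proof -
  obtain i where j: "j = l + i" using assms le_Suc_ex by blast
  have "2 ^ (l + i) *\<^sub>R z = 2 ^ l *\<^sub>R 2 ^ i *\<^sub>R z" "(1 / 2) ^ l *\<^sub>R 2 ^ l *\<^sub>R z = z" for z :: "real ^ 'n"
    by (simp_all add: power_add power_one_over)
  then show ?thesis
    by (simp only: dilated_def j diff_add_inverse distrib_left power_add mult.assoc)
qed

text \<open>Put \<open>q = 2 ^ l\<close>. On \<open>norm x \<ge> 1 / 2\<close> the decay of order
  \<open>N + n + 1\<close> of \<open>\<psi>\<close> at \<open>q x\<close> gains that power of
  \<open>q\<close>, and the derivatives lose at most \<open>q ^ N\<close>. Of the remaining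
  \<open>q ^ (n + 1)\<close>, with \<open>n\<close> the dimension, \<open>q ^ n\<close> pays for the
  factor in \<open>dilated_rescale\<close> and one more \<open>q\<close> makes the sum over the
  annuli converge.\<close>

lemma sbound_annulus:
  fixes \<psi> \<theta> :: "real ^ 'n \<Rightarrow> complex"
  assumes "smooth \<psi>" "smooth \<theta>" "sbound (N + n + 1) \<psi> A"
    and B: "\<And>is x. length is \<le> N \<Longrightarrow> norm (partial_derivs is \<theta> x) \<le> B" and "B > 0" "R \<ge> 1"
    and "\<And>x. norm x < 1 / 2 \<Longrightarrow> \<theta> x = 0" "\<And>x. norm x > R \<Longrightarrow> \<theta> x = 0"
  shows "sbound N (\<lambda>x. \<psi> (2 ^ l *\<^sub>R x) * \<theta> x)
    ((1 + R) ^ N * (2 ^ N * (2 ^ (N + n + 1) * B)) * A / (2 ^ l) ^ (n + 1))"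
proof (rule sboundI)
  fix "is" :: "'n list" and x :: "real ^ 'n"
  assume l: "length is \<le> N"
  define q :: real where "q = 2 ^ l"
  have q: "q \<ge> 1" by (simp add: q_def)
  let ?M = "N + n + 1"
  let ?f = "\<lambda>x. \<psi> (0 + q *\<^sub>R x)"
  have A: "0 \<le> A" using sbound_nonneg[OF assms(3)] .
  have "(1 + norm x) ^ N * norm (partial_derivs is (\<lambda>x. ?f x * \<theta> x) x) \<le>
      (1 + R) ^ N * (2 ^ N * (2 ^ ?M * B)) * A / q ^ (n + 1)"
  proof (cases "norm x < 1 / 2 \<or> norm x > R")
    case True
    then have "partial_derivs is (\<lambda>x. ?f x * \<theta> x) x = 0"
      using partial_derivs_zero_open[OF open_norm_greater[of R], of x]
        partial_derivs_zero_open[OF open_norm_less[of "1 / 2"], of x] assms(7,8) by auto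
    then show ?thesis using A \<open>B > 0\<close> \<open>R \<ge> 1\<close> q by (simp add: divide_nonneg_nonneg)
  next
    case False
    have 1: "norm (partial_derivs js ?f x) \<le> 2 ^ ?M * A / q ^ (n + 1)" if js: "length js \<le> length is" for js
    proof -
      have "q * (1 / 2) \<le> q * norm x" using False q by (intro mult_left_mono) auto
      moreover have "norm (q *\<^sub>R x) = q * norm x" using q by simp
      ultimately have "q / 2 \<le> 1 + norm (q *\<^sub>R x)" by linarith
      then have "(q / 2) ^ ?M \<le> (1 + norm (q *\<^sub>R x)) ^ ?M" using q by (intro power_mono) auto
      then have "A / (1 + norm (q *\<^sub>R x)) ^ ?M \<le> A / (q / 2) ^ ?M"
        using A q by (intro divide_left_mono mult_pos_pos zero_less_power add_pos_nonneg) auto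
      then have 2: "norm (partial_derivs js \<psi> (q *\<^sub>R x)) \<le> A / (q / 2) ^ ?M"
        using sbound_norm_le[OF assms(3), of js "q *\<^sub>R x"] js l by linarith
      have "norm (partial_derivs js ?f x) = q ^ length js * norm (partial_derivs js \<psi> (q *\<^sub>R x))"
        using q by (subst partial_derivs_affine) (auto simp: assms(1) norm_mult norm_power)
      also have "\<dots> \<le> q ^ N * (A / (q / 2) ^ ?M)"
        using q js l 2 by (intro mult_mono power_increasing) auto
      also have "\<dots> = 2 ^ ?M * A / q ^ (n + 1)"
        using q by (simp add: power_divide power_add)
      finally show ?thesis .
    qed
    have "norm (partial_derivs is (\<lambda>x. ?f x * \<theta> x) x) \<le> 2 ^ length is * ((2 ^ ?M * A / q ^ (n + 1)) * B)"
      using l by (intro norm_partial_derivs_mult smooth_affine assms 1) auto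
    also have "\<dots> \<le> 2 ^ N * ((2 ^ ?M * A / q ^ (n + 1)) * B)"
      using l A q \<open>B > 0\<close> by (intro mult_right_mono power_increasing) auto
    finally have "(1 + norm x) ^ N * norm (partial_derivs is (\<lambda>x. ?f x * \<theta> x) x) \<le>
        (1 + R) ^ N * (2 ^ N * ((2 ^ ?M * A / q ^ (n + 1)) * B))"
      using False by (intro mult_mono power_mono) auto
    also have "\<dots> = (1 + R) ^ N * (2 ^ N * (2 ^ ?M * B)) * A / q ^ (n + 1)" by simp
    finally show ?thesis .
  qed
  then show "(1 + norm x) ^ N * norm (partial_derivs is (\<lambda>x. \<psi> (2 ^ l *\<^sub>R x) * \<theta> x) x) \<le>
      (1 + R) ^ N * (2 ^ N * (2 ^ ?M * B)) * A / (2 ^ l) ^ (n + 1)"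
    by (simp add: q_def)
qed

text \<open>Put \<open>q = 2 ^ j\<close> and \<open>z = y - x0\<close>. On
  \<open>norm z \<ge> 1\<close> the decay of \<open>\<psi>\<close> at \<open>q z\<close> dominates
  \<open>q ^ (N + n) * norm z ^ N\<close>. The derivatives consume \<open>q ^ N\<close>, the
  prefactor of \<open>dilated\<close> consumes \<open>q ^ n\<close> when \<open>n\<close> is the
  dimension, and \<open>norm z ^ N\<close> absorbs the weight, which is centred at 0 instead of
  \<open>x0\<close>.\<close>

lemma sbound_exterior:
  fixes \<psi> \<kappa> :: "real ^ 'n \<Rightarrow> complex"
  assumes "smooth \<psi>" "smooth \<kappa>" "sbound (2 * N + n) \<psi> A"
    and B: "\<And>is x. length is \<le> N \<Longrightarrow> norm (partial_derivs is \<kappa> x) \<le> B" and "B > 0"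
    and \<kappa>: "\<And>x. norm x < 1 \<Longrightarrow> \<kappa> x = 0"
  shows "sbound N (\<lambda>y. \<psi> (2 ^ j *\<^sub>R (y - x0)) * \<kappa> (y - x0))
    ((2 * (1 + norm x0)) ^ N * (2 ^ N * B) * A / (2 ^ j) ^ n)"
proof (rule sboundI)
  fix "is" :: "'n list" and y :: "real ^ 'n"
  assume l: "length is \<le> N"
  define q :: real where "q = 2 ^ j"
  have q: "q \<ge> 1" by (simp add: q_def)
  let ?f = "\<lambda>y. \<psi> (- (q *\<^sub>R x0) + q *\<^sub>R y)" and ?k = "\<lambda>y. \<kappa> (- x0 + 1 *\<^sub>R y)"
  let ?z = "y - x0"
  have A: "0 \<le> A" using sbound_nonneg[OF assms(3)] .
  have "(1 + norm y) ^ N * norm (partial_derivs is (\<lambda>y. ?f y * ?k y) y) \<le>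
      (2 * (1 + norm x0)) ^ N * (2 ^ N * B) * A / q ^ n"
  proof (cases "norm ?z < 1")
    case True
    have "open {y. norm (y - x0) < 1}" by (intro open_Collect_less continuous_intros)
    then have "partial_derivs is (\<lambda>y. ?f y * ?k y) y = 0"
      using True \<kappa> by (intro partial_derivs_zero_open[of "{y. norm (y - x0) < 1}"]) auto
    then show ?thesis using A \<open>B > 0\<close> q by (simp add: divide_nonneg_nonneg)
  next
    case False
    then have z: "norm ?z \<ge> 1" by simp
    have 1: "norm (partial_derivs js ?f y) \<le> A / (q ^ n * norm ?z ^ N)" if js: "length js \<le> length is" for js
    proof -
      have pos: "0 < q ^ N * (q ^ n * norm ?z ^ N)"
        using q z by (intro mult_pos_pos zero_less_power) auto
      have "q ^ N * (q ^ n * norm ?z ^ N) = q ^ (N + n) * norm ?z ^ N" by (simp add: power_add)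
      also have "\<dots> \<le> q ^ (2 * N + n) * norm ?z ^ (2 * N + n)"
        using q z by (intro mult_mono power_increasing) auto
      also have "\<dots> = (q * norm ?z) ^ (2 * N + n)" by (simp add: power_mult_distrib)
      also have "\<dots> \<le> (1 + norm (q *\<^sub>R ?z)) ^ (2 * N + n)" using q by (intro power_mono) auto
      finally have "A / (1 + norm (q *\<^sub>R ?z)) ^ (2 * N + n) \<le> A / (q ^ N * (q ^ n * norm ?z ^ N))"
        using A pos by (intro divide_left_mono) auto
      then have 2: "norm (partial_derivs js \<psi> (q *\<^sub>R ?z)) \<le> A / (q ^ N * (q ^ n * norm ?z ^ N))"
        using sbound_norm_le[OF assms(3), of js "q *\<^sub>R ?z"] js l by linarith
      have "norm (partial_derivs js ?f y) = q ^ length js * norm (partial_derivs js \<psi> (q *\<^sub>R ?z))"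
        using q by (subst partial_derivs_affine) (auto simp: assms(1) norm_mult norm_power scaleR_diff_right)
      also have "\<dots> \<le> q ^ N * (A / (q ^ N * (q ^ n * norm ?z ^ N)))"
        using q js l 2 by (intro mult_mono power_increasing) auto
      also have "\<dots> = A / (q ^ n * norm ?z ^ N)" using q by simp
      finally show ?thesis .
    qed
    have "norm (partial_derivs js ?k y) \<le> B" if "length js \<le> length is" for js
      using that l B by (intro norm_partial_derivs_affine_le assms) auto
    then have "norm (partial_derivs is (\<lambda>y. ?f y * ?k y) y) \<le> 2 ^ length is * (A / (q ^ n * norm ?z ^ N) * B)"
      by (intro norm_partial_derivs_mult smooth_affine assms 1)
    also have "\<dots> \<le> 2 ^ N * (A / (q ^ n * norm ?z ^ N) * B)"
      using l A q \<open>B > 0\<close> by (intro mult_right_mono power_increasing) auto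
    finally have 2: "norm (partial_derivs is (\<lambda>y. ?f y * ?k y) y) \<le> 2 ^ N * (A / (q ^ n * norm ?z ^ N) * B)" .
    have "norm y \<le> norm x0 + norm ?z" using norm_triangle_ineq[of x0 ?z] by simp
    also have "\<dots> \<le> norm x0 * norm ?z + norm ?z"
      using z mult_left_mono[OF z norm_ge_zero[of x0]] by simp
    finally have "norm y \<le> norm x0 * norm ?z + norm ?z" .
    moreover have "2 * (1 + norm x0) * norm ?z = 2 * norm ?z + 2 * (norm x0 * norm ?z)"
      by (simp add: algebra_simps)
    moreover have "0 \<le> norm x0 * norm ?z" by simp
    ultimately have "1 + norm y \<le> 2 * (1 + norm x0) * norm ?z" using z by linarith
    then have "(1 + norm y) ^ N \<le> (2 * (1 + norm x0) * norm ?z) ^ N" by (intro power_mono) auto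
    then have "(1 + norm y) ^ N * norm (partial_derivs is (\<lambda>y. ?f y * ?k y) y) \<le>
       (2 * (1 + norm x0) * norm ?z) ^ N * (2 ^ N * (A / (q ^ n * norm ?z ^ N) * B))"
      using 2 by (intro mult_mono) auto
    also have "\<dots> = (2 * (1 + norm x0)) ^ N * (2 ^ N * B) * A / q ^ n"
      using z by (simp only: power_mult_distrib[of _ "norm ?z"]) auto
    finally show ?thesis .
  qed
  then show "(1 + norm y) ^ N * norm (partial_derivs is (\<lambda>y. \<psi> (2 ^ j *\<^sub>R (y - x0)) * \<kappa> (y - x0)) y) \<le>
      (2 * (1 + norm x0)) ^ N * (2 ^ N * B) * A / (2 ^ j) ^ n"
    by (simp add: q_def scaleR_diff_right)
qed

text \<open>
  A Schwartz function is split into dyadic annuli. A dilation carries the annulus of radius \<open>2\<^sup>l\<close> to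
  a fixed ball and \<open>dilated U x0 j\<close> to \<open>dilated U x0 (j - l)\<close>; beyond radius \<open>2\<^sup>j\<close> the
  boundedness of \<open>U\<close> itself suffices.
\<close>

lemma dilated_equicontinuous:
  fixes U :: "(real ^ 'n \<Rightarrow> complex) \<Rightarrow> complex"
  assumes U: "schwartz_functional U"
    and bounded: "\<And>R \<psi>. \<psi> \<in> test_functions_in_ball R \<Longrightarrow> \<exists>B. \<forall>j. norm (dilated U x0 j \<psi>) \<le> B"
  shows "\<exists>N C. \<forall>j. \<forall>\<psi>\<in>schwartz_space. \<forall>A. sbound N \<psi> A \<longrightarrow> norm (dilated U x0 j \<psi>) \<le> C * A"
proof -
  let ?n = "CARD('n)"
  obtain \<eta> :: "real ^ 'n \<Rightarrow> complex" and R where \<eta>: "smooth \<eta>" "\<And>x. norm x \<le> 1 \<Longrightarrow> \<eta> x = 1"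
    "\<And>x. norm x > R \<Longrightarrow> \<eta> x = 0" and R: "R \<ge> 1"
    using exists_cutoff by blast
  \<comment> \<open>\<open>\<theta>\<close> lives on an annulus and telescopes:
    \<open>\<eta>(x / 2^l) = \<eta>(x / 2^(l-1)) + \<theta>(x / 2^l)\<close>. With
    \<open>\<kappa>(x / 2^j)\<close> for the exterior this is the partition of unity applied to
    \<open>\<psi>\<close>.\<close>
  define \<theta> where "\<theta> x = \<eta> x - \<eta> (0 + 2 *\<^sub>R x)" for x
  define \<kappa> where "\<kappa> x = 1 - \<eta> x" for x
  have \<theta>: "smooth \<theta>" "\<And>x. norm x < 1 / 2 \<Longrightarrow> \<theta> x = 0" "\<And>x. norm x > R \<Longrightarrow> \<theta> x = 0"
  proof -
    show "smooth \<theta>" unfolding \<theta>_def by (intro smooth_diff smooth_affine \<eta>)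
    show "\<theta> x = 0" if "norm x < 1 / 2" for x using that \<eta>(2)[of x] \<eta>(2)[of "2 *\<^sub>R x"] by (simp add: \<theta>_def)
    show "\<theta> x = 0" if "norm x > R" for x using that R \<eta>(3)[of x] \<eta>(3)[of "2 *\<^sub>R x"] by (simp add: \<theta>_def)
  qed
  have \<kappa>: "smooth \<kappa>" "\<And>x. norm x < 1 \<Longrightarrow> \<kappa> x = 0"
    using \<eta> unfolding \<kappa>_def by (auto intro!: smooth_diff)
  have bd\<eta>: "\<exists>B. \<forall>x. norm (partial_derivs is \<eta> x) \<le> B" for "is"
    by (rule partial_derivs_bounded_compact_support[OF \<eta>(1,3)])
  have bd\<theta>: "\<exists>B. \<forall>x. norm (partial_derivs is \<theta> x) \<le> B" for "is"
    by (rule partial_derivs_bounded_compact_support[OF \<theta>(1,3)])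
  have bd\<kappa>: "\<exists>B. \<forall>x. norm (partial_derivs is \<kappa> x) \<le> B" for "is"
    unfolding \<kappa>_def by (rule partial_derivs_bounded_const_minus[OF \<eta>(1) bd\<eta>])
  obtain N1 C1' where C1': "\<And>j \<psi> A. \<psi> \<in> test_functions_in_ball R \<Longrightarrow> sbound N1 \<psi> A \<Longrightarrow>
      norm (dilated U x0 j \<psi>) \<le> C1' * A"
    using uniform_boundedness_test_functions[where U = "dilated U x0" and R = R,
        OF schwartz_functional_dilated[OF U] bounded[of _ R]] by blast
  define C1 where "C1 = \<bar>C1'\<bar>"
  have C1_nonneg: "C1 \<ge> 0" by (simp add: C1_def)
  have C1: "norm (dilated U x0 j \<psi>) \<le> C1 * A"
    if "\<psi> \<in> test_functions_in_ball R" "sbound N1 \<psi> A" for j \<psi> A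
    using C1'[OF that, of j] mult_right_mono[OF abs_ge_self[of C1'] sbound_nonneg[OF that(2)]]
    by (simp add: C1_def)
  obtain N0 C0 where C0: "C0 > 0" "\<And>f A. f \<in> schwartz_space \<Longrightarrow> sbound N0 f A \<Longrightarrow> norm (U f) \<le> C0 * A"
    by (rule schwartz_functional.bound[OF U]) blast
  obtain B1 where B1: "B1 > 0" "\<And>is x. length is \<le> N1 \<Longrightarrow> norm (partial_derivs is \<eta> x) \<le> B1"
    using partial_derivs_bounded_upto[OF bd\<eta>] by blast
  obtain B2 where B2: "B2 > 0" "\<And>is x. length is \<le> N1 \<Longrightarrow> norm (partial_derivs is \<theta> x) \<le> B2"
    using partial_derivs_bounded_upto[OF bd\<theta>] by blast
  obtain B3 where B3: "B3 > 0" "\<And>is x. length is \<le> N0 \<Longrightarrow> norm (partial_derivs is \<kappa> x) \<le> B3"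
    using partial_derivs_bounded_upto[OF bd\<kappa>] by blast
  define K1 where "K1 = C1 * (2 ^ N1 * B1)"
  define K2 where "K2 = C1 * ((1 + R) ^ N1 * (2 ^ N1 * (2 ^ (N1 + ?n + 1) * B2)))"
  define K3 where "K3 = C0 * ((2 * (1 + norm x0)) ^ N0 * (2 ^ N0 * B3))"
  have K2: "K2 \<ge> 0" using C1_nonneg R B2(1) by (auto simp: K2_def intro!: mult_nonneg_nonneg)
  define N where "N = max (N1 + ?n + 1) (2 * N0 + ?n)"
  have "norm (dilated U x0 j \<psi>) \<le> (K1 + K2 + K3) * A" if \<psi>: "\<psi> \<in> schwartz_space" and A: "sbound N \<psi> A" for j \<psi> A
  proof -
    interpret Uj: schwartz_functional "dilated U x0 j" by (rule schwartz_functional_dilated[OF U])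
    have A0: "A \<ge> 0" by (rule sbound_nonneg[OF A])
    have A1: "sbound (N1 + ?n + 1) \<psi> A" and A1': "sbound N1 \<psi> A" and A2: "sbound (2 * N0 + ?n) \<psi> A"
      by (rule sbound_order_mono[OF A]; simp add: N_def)+
    note s\<psi> = schwartz_smooth[OF \<psi>]
    have mult: "(\<lambda>x. \<psi> x * g (0 + c *\<^sub>R x)) \<in> schwartz_space"
      if g: "smooth g" and bd: "\<And>is. \<exists>B. \<forall>x. norm (partial_derivs is g x) \<le> B" and c: "\<bar>c\<bar> \<le> 1" for g c
    proof (rule schwartz_mult[OF \<psi> smooth_affine[OF g]])
      fix "is" :: "'n list"
      obtain B where "\<And>x. norm (partial_derivs is g x) \<le> B" using bd by blast
      then have "norm (partial_derivs is (\<lambda>x. g (0 + c *\<^sub>R x)) x) \<le> B" for x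
        by (rule norm_partial_derivs_affine_le[OF g c])
      then show "\<exists>B. \<forall>x. norm (partial_derivs is (\<lambda>x. g (0 + c *\<^sub>R x)) x) \<le> B" by blast
    qed
    have h: "\<bar>(1 / 2) ^ k\<bar> \<le> (1::real)" for k :: nat by (simp add: power_le_one)
    let ?S = "\<lambda>k. dilated U x0 j (\<lambda>x. \<psi> x * \<eta> ((1 / 2) ^ k *\<^sub>R x))"
    \<comment> \<open>The annulus of index \<open>l\<close> costs \<open>K2 * A / 2 ^ l\<close>, and
      \<open>1 - (1 / 2) ^ k\<close> collects these costs up to \<open>k\<close>. The restriction
      \<open>k \<le> j\<close> reflects that \<open>dilated_rescale\<close> lowers the scale to
      \<open>j - l\<close>.\<close>
    have "norm (?S k) \<le> K1 * A + K2 * A * (1 - (1 / 2) ^ k)" if "k \<le> j" for k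
      using that
    proof (induction k)
      case 0
      have "(\<lambda>x. \<psi> x * \<eta> x) \<in> test_functions_in_ball R"
        using smooth_mult[OF s\<psi> \<eta>(1)] \<eta>(3) by (simp add: test_functions_in_ball_def)
      then have "norm (dilated U x0 j (\<lambda>x. \<psi> x * \<eta> x)) \<le> C1 * (2 ^ N1 * (A * B1))"
        by (rule C1[OF _ sbound_mult[OF s\<psi> \<eta>(1) A1' B1(2)]])
      then show ?case by (simp add: K1_def mult_ac)
    next
      case (Suc k)
      let ?l = "Suc k"
      have half: "(1 / 2) ^ k *\<^sub>R x = 2 *\<^sub>R (1 / 2) ^ ?l *\<^sub>R x" for x :: "real ^ 'n" by simp
      have "(\<lambda>x. \<psi> x * \<eta> ((1 / 2) ^ ?l *\<^sub>R x)) =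
          (\<lambda>x. \<psi> x * \<eta> ((1 / 2) ^ k *\<^sub>R x) + \<psi> x * \<theta> ((1 / 2) ^ ?l *\<^sub>R x))"
        unfolding \<theta>_def half by (simp add: right_diff_distrib)
      then have "?S ?l = ?S k + dilated U x0 j (\<lambda>x. \<psi> x * \<theta> ((1 / 2) ^ ?l *\<^sub>R x))"
        using Uj.add[OF mult[OF \<eta>(1) bd\<eta> h[of k]] mult[OF \<theta>(1) bd\<theta> h[of ?l]]] by simp
      then have "norm (?S ?l) \<le> norm (?S k) + norm (dilated U x0 j (\<lambda>x. \<psi> x * \<theta> ((1 / 2) ^ ?l *\<^sub>R x)))"
        by (simp only: norm_triangle_ineq)
      moreover have "norm (dilated U x0 j (\<lambda>x. \<psi> x * \<theta> ((1 / 2) ^ ?l *\<^sub>R x))) \<le> K2 * A * (1 / 2) ^ ?l"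
      proof -
        let ?g = "\<lambda>x. \<psi> (2 ^ ?l *\<^sub>R x) * \<theta> x"
        have "?g \<in> test_functions_in_ball R"
          using smooth_affine[OF s\<psi>, of 0 "2 ^ ?l"] \<theta> by (auto simp: test_functions_in_ball_def intro!: smooth_mult)
        then have "norm (dilated U x0 (j - ?l) ?g) \<le>
            C1 * ((1 + R) ^ N1 * (2 ^ N1 * (2 ^ (N1 + ?n + 1) * B2)) * A / (2 ^ ?l) ^ (?n + 1))"
          by (rule C1[OF _ sbound_annulus[OF s\<psi> \<theta>(1) A1 B2(2,1) R \<theta>(2,3)]])
        also have "\<dots> = K2 * A / (2 ^ ?l) ^ (?n + 1)" by (simp add: K2_def)
        finally have "2 ^ (?n * ?l) * norm (dilated U x0 (j - ?l) ?g) \<le>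
            2 ^ (?n * ?l) * (K2 * A / (2 ^ ?l) ^ (?n + 1))"
          by (intro mult_left_mono) auto
        also have "\<dots> = (2 ^ ?l) ^ ?n * (K2 * A / (2 ^ ?l) ^ (?n + 1))"
          by (simp only: power_mult[symmetric] mult.commute)
        also have "\<dots> = K2 * A * (1 / 2) ^ ?l"
          by (simp only: power_add power_one_right power_one_over) (simp add: field_simps)
        finally show ?thesis
          using dilated_rescale[OF Suc.prems, of U x0 \<psi> \<theta>] by (simp only: norm_mult norm_power norm_numeral)
      qed
      ultimately have "norm (?S ?l) \<le> norm (?S k) + K2 * A * (1 / 2) ^ ?l"
        by linarith
      also have "\<dots> \<le> K1 * A + K2 * A * (1 - (1 / 2) ^ k) + K2 * A * (1 / 2) ^ ?l"
        using Suc.IH Suc.prems by linarith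
      also have "\<dots> = K1 * A + K2 * A * (1 - (1 / 2) ^ ?l)" by (simp add: algebra_simps)
      finally show ?case .
    qed
    from this[of j] have near: "norm (?S j) \<le> K1 * A + K2 * A"
      using mult_nonneg_nonneg[OF mult_nonneg_nonneg[OF K2 A0], of "(1 / 2) ^ j"] by (simp add: algebra_simps)
    have far: "norm (dilated U x0 j (\<lambda>x. \<psi> x * \<kappa> ((1 / 2) ^ j *\<^sub>R x))) \<le> K3 * A"
    proof -
      let ?g = "\<lambda>y. \<psi> (2 ^ j *\<^sub>R (y - x0)) * \<kappa> (y - x0)"
      have half: "(1 / 2) ^ j *\<^sub>R 2 ^ j *\<^sub>R x = x" for x :: "real ^ 'n" by (simp add: power_one_over)
      have "(\<lambda>y. \<psi> (- (2 ^ j *\<^sub>R x0) + 2 ^ j *\<^sub>R y) * \<kappa> (- x0 + 1 *\<^sub>R y)) \<in> schwartz_space"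
      proof (rule schwartz_mult[OF schwartz_affine[OF \<psi>] smooth_affine[OF \<kappa>(1)]])
        fix "is" :: "'n list"
        obtain B where "\<And>x. norm (partial_derivs is \<kappa> x) \<le> B" using bd\<kappa> by blast
        then have "norm (partial_derivs is (\<lambda>y. \<kappa> (- x0 + 1 *\<^sub>R y)) y) \<le> B" for y
          by (intro norm_partial_derivs_affine_le \<kappa>(1)) auto
        then show "\<exists>B. \<forall>y. norm (partial_derivs is (\<lambda>y. \<kappa> (- x0 + 1 *\<^sub>R y)) y) \<le> B" by blast
      qed simp
      then have g: "?g \<in> schwartz_space" by (simp add: scaleR_diff_right)
      have "dilated U x0 j (\<lambda>x. \<psi> x * \<kappa> ((1 / 2) ^ j *\<^sub>R x)) = 2 ^ (?n * j) * U ?g"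
        by (simp only: dilated_def half)
      then have "norm (dilated U x0 j (\<lambda>x. \<psi> x * \<kappa> ((1 / 2) ^ j *\<^sub>R x))) = (2 ^ j) ^ ?n * norm (U ?g)"
        by (simp only: norm_mult norm_power norm_numeral power_mult[symmetric] mult.commute)
      also have "norm (U ?g) \<le> C0 * ((2 * (1 + norm x0)) ^ N0 * (2 ^ N0 * B3) * A / (2 ^ j) ^ ?n)"
        by (rule C0(2)[OF g sbound_exterior[OF s\<psi> \<kappa>(1) A2 B3(2,1) \<kappa>(2)]])
      also have "(2 ^ j) ^ ?n * (C0 * ((2 * (1 + norm x0)) ^ N0 * (2 ^ N0 * B3) * A / (2 ^ j) ^ ?n)) = K3 * A"
        by (simp add: K3_def)
      finally show ?thesis by simp
    qed
    have "(\<lambda>x. \<psi> x * \<eta> ((1 / 2) ^ j *\<^sub>R x) + \<psi> x * \<kappa> ((1 / 2) ^ j *\<^sub>R x)) = \<psi>"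
      by (simp add: \<kappa>_def right_diff_distrib)
    then have "dilated U x0 j \<psi> = ?S j + dilated U x0 j (\<lambda>x. \<psi> x * \<kappa> ((1 / 2) ^ j *\<^sub>R x))"
      using Uj.add[OF mult[OF \<eta>(1) bd\<eta> h[of j]] mult[OF \<kappa>(1) bd\<kappa> h[of j]]] by simp
    then have "norm (dilated U x0 j \<psi>) \<le> (K1 * A + K2 * A) + K3 * A"
      using norm_triangle_mono[OF near far] by simp
    then show ?thesis by (simp add: distrib_right)
  qed
  then show ?thesis by blast
qed

text \<open>One spare order of decay, \<open>Suc N\<close> against the weight \<open>N\<close>, is
  worth \<open>1 / (1 + norm x)\<close>, and this is at most \<open>(1 / 2) ^ k\<close> wherever the
  cutoff does not vanish.\<close>

lemma sbound_cutoff_tail: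
  fixes \<psi> \<kappa> :: "real ^ 'n \<Rightarrow> complex"
  assumes "smooth \<psi>" "smooth \<kappa>" "sbound (Suc N) \<psi> A"
    and B: "\<And>is x. length is \<le> N \<Longrightarrow> norm (partial_derivs is \<kappa> x) \<le> B" and "B > 0"
    and \<kappa>: "\<And>x. norm x < 1 \<Longrightarrow> \<kappa> x = 0"
  shows "sbound N (\<lambda>x. \<psi> x * \<kappa> ((1 / 2) ^ k *\<^sub>R x)) (2 ^ N * (A * B) * (1 / 2) ^ k)"
proof (rule sboundI)
  fix "is" :: "'n list" and x :: "real ^ 'n"
  assume l: "length is \<le> N"
  let ?k = "\<lambda>x. \<kappa> (0 + (1 / 2) ^ k *\<^sub>R x)"
  have A: "0 \<le> A" using sbound_nonneg[OF assms(3)] .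
  have "(1 + norm x) ^ N * norm (partial_derivs is (\<lambda>x. \<psi> x * ?k x) x) \<le> 2 ^ N * (A * B) * (1 / 2) ^ k"
  proof (cases "norm x < 2 ^ k")
    case True
    have "partial_derivs is (\<lambda>x. \<psi> x * ?k x) x = 0"
      using True \<kappa> by (intro partial_derivs_zero_open[OF open_norm_less[of "2 ^ k"]]) (auto simp: power_one_over field_simps)
    then show ?thesis using A \<open>B > 0\<close> by simp
  next
    case False
    have pos: "0 < 1 + norm x" by (simp add: add_pos_nonneg)
    have "norm (partial_derivs js ?k x) \<le> B" if "length js \<le> length is" for js
      using that l B by (intro norm_partial_derivs_affine_le assms) (auto simp: power_le_one)
    then have "norm (partial_derivs is (\<lambda>x. \<psi> x * ?k x) x) \<le> 2 ^ length is * (A / (1 + norm x) ^ Suc N * B)"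
      using l by (intro norm_partial_derivs_mult smooth_affine assms sbound_norm_le[OF assms(3)]) auto
    also have "\<dots> \<le> 2 ^ N * (A / (1 + norm x) ^ Suc N * B)"
      using l A \<open>B > 0\<close> by (intro mult_right_mono power_increasing) auto
    finally have "(1 + norm x) ^ N * norm (partial_derivs is (\<lambda>x. \<psi> x * ?k x) x) \<le>
        (1 + norm x) ^ N * (2 ^ N * (A / (1 + norm x) ^ Suc N * B))"
      by (intro mult_left_mono) auto
    also have "\<dots> = 2 ^ N * (A * B) * (1 / (1 + norm x))"
      using pos by simp
    also have "\<dots> \<le> 2 ^ N * (A * B) * (1 / 2 ^ k)"
      using False A \<open>B > 0\<close> pos by (intro mult_left_mono divide_left_mono) auto
    finally show ?thesis by (simp add: power_one_over)
  qed
  then show "(1 + norm x) ^ N * norm (partial_derivs is (\<lambda>x. \<psi> x * \<kappa> ((1 / 2) ^ k *\<^sub>R x)) x) \<le>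
      2 ^ N * (A * B) * (1 / 2) ^ k"
    by simp
qed

text \<open>Compactly supported functions approximate \<open>\<psi>\<close> in the norm of order
  \<open>N\<close>. By the bound uniform in \<open>j\<close> the remainder stays below
  \<open>e / 2\<close> at every scale, so the cutoff radius can be fixed before \<open>j\<close>
  tends to infinity.\<close>

lemma dilated_tendsto_zero:
  fixes U :: "(real ^ 'n \<Rightarrow> complex) \<Rightarrow> complex"
  assumes U: "schwartz_functional U"
    and lim: "\<And>R \<psi>. \<psi> \<in> test_functions_in_ball R \<Longrightarrow> (\<lambda>j. dilated U x0 j \<psi>) \<longlonglongrightarrow> 0"
    and equicont: "\<And>j \<psi> A. \<psi> \<in> schwartz_space \<Longrightarrow> sbound N \<psi> A \<Longrightarrow> norm (dilated U x0 j \<psi>) \<le> C * A"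
    and \<psi>: "\<psi> \<in> schwartz_space"
  shows "(\<lambda>j. dilated U x0 j \<psi>) \<longlonglongrightarrow> 0"
proof (rule tendstoI)
  fix e :: real assume e: "e > 0"
  obtain \<eta> :: "real ^ 'n \<Rightarrow> complex" and R where \<eta>: "smooth \<eta>" "\<And>x. norm x \<le> 1 \<Longrightarrow> \<eta> x = 1"
    "\<And>x. norm x > R \<Longrightarrow> \<eta> x = 0" and R: "R \<ge> 1"
    using exists_cutoff by blast
  define \<kappa> where "\<kappa> x = 1 - \<eta> x" for x
  have \<kappa>: "smooth \<kappa>" "\<And>x. norm x < 1 \<Longrightarrow> \<kappa> x = 0"
    using \<eta> unfolding \<kappa>_def by (auto intro!: smooth_diff)
  have bd\<kappa>: "\<exists>B. \<forall>x. norm (partial_derivs is \<kappa> x) \<le> B" for "is"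
    unfolding \<kappa>_def
    by (rule partial_derivs_bounded_const_minus[OF \<eta>(1) partial_derivs_bounded_compact_support[OF \<eta>(1,3)]])
  obtain B where B: "B > 0" "\<And>is x. length is \<le> N \<Longrightarrow> norm (partial_derivs is \<kappa> x) \<le> B"
    using partial_derivs_bounded_upto[OF bd\<kappa>] by blast
  obtain A where A: "sbound (Suc N) \<psi> A" using schwartz_sbound[OF \<psi>] by blast
  let ?K = "C * (2 ^ N * (A * B))"
  have "(\<lambda>k. ?K * (1 / 2) ^ k) \<longlonglongrightarrow> ?K * 0"
    by (intro tendsto_intros LIMSEQ_realpow_zero) auto
  then have "eventually (\<lambda>k. ?K * (1 / 2) ^ k < e / 2) sequentially"
    by (rule order_tendstoD(2)) (use e in simp)
  then obtain k where k: "?K * (1 / 2) ^ k < e / 2"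
    using eventually_happens'[OF sequentially_bot] by blast
  let ?g = "\<lambda>x. \<psi> x * \<eta> ((1 / 2) ^ k *\<^sub>R x)" and ?h = "\<lambda>x. \<psi> x * \<kappa> ((1 / 2) ^ k *\<^sub>R x)"
  have "?g \<in> test_functions_in_ball (2 ^ k * R)"
    using smooth_mult[OF schwartz_smooth[OF \<psi>] smooth_affine[OF \<eta>(1), of 0 "(1 / 2) ^ k"]] \<eta>(3)
    by (simp add: test_functions_in_ball_def power_one_over field_simps)
  then have g: "?g \<in> schwartz_space" "(\<lambda>j. dilated U x0 j ?g) \<longlonglongrightarrow> 0"
    using test_functions_in_ball_schwartz lim by blast+
  have eq: "?h = (\<lambda>x. \<psi> x - ?g x)" by (simp add: \<kappa>_def right_diff_distrib)
  have h: "?h \<in> schwartz_space" unfolding eq by (rule schwartz_diff[OF \<psi> g(1)])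
  have "norm (dilated U x0 j ?h) \<le> C * (2 ^ N * (A * B) * (1 / 2) ^ k)" for j
    by (rule equicont[OF h sbound_cutoff_tail[OF schwartz_smooth[OF \<psi>] \<kappa>(1) A B(2,1) \<kappa>(2)]])
  then have small: "norm (dilated U x0 j ?h) < e / 2" for j
    using k unfolding mult.assoc by (rule le_less_trans)
  from g(2) have "eventually (\<lambda>j. norm (dilated U x0 j ?g) < e / 2) sequentially"
    using tendstoD[OF g(2) half_gt_zero[OF e]] by (simp only: dist_norm diff_zero)
  then show "eventually (\<lambda>j. dist (dilated U x0 j \<psi>) 0 < e) sequentially"
  proof eventually_elim
    case (elim j)
    interpret Uj: schwartz_functional "dilated U x0 j" by (rule schwartz_functional_dilated[OF U])
    have "dilated U x0 j \<psi> = dilated U x0 j ?g + dilated U x0 j ?h"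
      unfolding eq Uj.diff[OF \<psi> g(1)] by simp
    then have "norm (dilated U x0 j \<psi>) \<le> norm (dilated U x0 j ?g) + norm (dilated U x0 j ?h)"
      by (simp only: norm_triangle_ineq)
    then show ?case using elim small[of j] by (simp only: dist_norm diff_zero)
  qed
qed

section \<open>Lattice sums\<close>

lemma lattice_point_nth [simp]: "lattice_point m $ i = of_int (m $ i)"
  by (simp add: lattice_point_def)

lemma lattice_point_add: "lattice_point (m + k) = lattice_point m + lattice_point k"
  by (simp add: vec_eq_iff)

lemma lattice_point_minus: "lattice_point (- m) = - lattice_point m"
  by (simp add: vec_eq_iff)

lemma lattice_point_zero [simp]: "lattice_point 0 = 0"
  by (simp add: vec_eq_iff)

definition unit_cube :: "(real ^ 'n) set" where
  "unit_cube = {x. \<forall>i. 0 \<le> x $ i \<and> x $ i < 1}"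

definition floor_vec :: "real ^ 'n \<Rightarrow> int ^ 'n" where
  "floor_vec x = (\<chi> i. \<lfloor>x $ i\<rfloor>)"

lemma floor_vec_iff: "x - lattice_point m \<in> unit_cube \<longleftrightarrow> m = floor_vec x"
proof -
  have "x - lattice_point m \<in> unit_cube \<longleftrightarrow> (\<forall>i. \<lfloor>x $ i\<rfloor> = m $ i)"
    unfolding unit_cube_def by (simp add: floor_eq_iff diff_less_eq add.commute)
  then show ?thesis unfolding floor_vec_def vec_eq_iff by (simp add: eq_commute)
qed

text \<open>The lattice sums are unordered \<open>infsum\<close>s, whereas the rules for
  interchanging series with limits, integrals and functionals speak of \<open>suminf\<close>. All
  the lattice sums concerned converge absolutely, so one enumeration converts them.\<close>

definition lattice_enum :: "nat \<Rightarrow> int ^ 'n" where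
  "lattice_enum = from_nat_into UNIV"

lemma bij_lattice_enum: "bij_betw lattice_enum UNIV (UNIV :: (int ^ 'n) set)"
  unfolding lattice_enum_def
  by (rule bij_betw_from_nat_into[OF countableI_type infinite_UNIV_char_0])

lemma lattice_enum_cases:
  obtains k where "m = lattice_enum k"
proof -
  have "m \<in> range lattice_enum" unfolding bij_betw_imp_surj_on[OF bij_lattice_enum] by (rule UNIV_I)
  then show ?thesis using that by blast
qed

lemma lattice_enum_inj: "lattice_enum j = lattice_enum k \<longleftrightarrow> j = k"
  by (rule inj_eq[OF bij_betw_imp_inj_on[OF bij_lattice_enum]])

section \<open>Boxes of lattice points and a summable weight\<close>

lemma bij_betw_vec_nth_PiE:
  "bij_betw (\<lambda>v. vec_nth v) {m :: 'a ^ 'n. \<forall>i. m $ i \<in> S i} (PiE UNIV S)"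
  by (rule bij_betwI[where g = vec_lambda]) (auto simp: PiE_def extensional_def)

lemma sum_vec_box:
  fixes f :: "'n::finite \<Rightarrow> 'a \<Rightarrow> 'b :: comm_semiring_1"
  assumes "\<And>i. finite (S i)"
  shows "(\<Sum>m\<in>{m :: 'a ^ 'n. \<forall>i. m $ i \<in> S i}. \<Prod>i\<in>UNIV. f i (m $ i)) = (\<Prod>i\<in>UNIV. \<Sum>a\<in>S i. f i a)"
  using sum.reindex_bij_betw[OF bij_betw_vec_nth_PiE, of "\<lambda>g. \<Prod>i\<in>UNIV. f i (g i)" S] assms
  by (simp add: prod_sum_PiE)

lemma finite_vec_box:
  assumes "\<And>i. finite (S i)"
  shows "finite {m :: 'a ^ 'n. \<forall>i. m $ i \<in> S i}"
  using bij_betw_finite[OF bij_betw_vec_nth_PiE, of S] finite_PiE[of UNIV S] assms by simp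

lemma card_vec_box:
  assumes "\<And>i. finite (S i)"
  shows "card {m :: 'a ^ 'n. \<forall>i. m $ i \<in> S i} = (\<Prod>i\<in>UNIV. card (S i))"
  using bij_betw_same_card[OF bij_betw_vec_nth_PiE, of S] by (simp add: card_PiE)

text \<open>A summable majorant in product form: its sum over a box factors into one-dimensional
  sums, which a power of the norm would not allow.\<close>

definition lattice_weight :: "int ^ 'n \<Rightarrow> real" where
  "lattice_weight m = (\<Prod>i\<in>UNIV. 1 / (1 + \<bar>of_int (m $ i)\<bar>)\<^sup>2)"

lemma lattice_weight_nonneg: "0 \<le> lattice_weight m"
  unfolding lattice_weight_def by (intro prod_nonneg) auto

text \<open>The correction \<open>- 2 / (real K + 1)\<close> strengthens the bound 3 so that the
  induction closes: each of the two new terms \<open>1 / (K + 2)^2\<close> is at most the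
  telescoping difference of \<open>1 / (K + 1)\<close> and \<open>1 / (K + 2)\<close>. At
  \<open>K = 0\<close> there is equality.\<close>

lemma sum_int_weight: "(\<Sum>a\<in>{- int K..int K}. 1 / (1 + \<bar>of_int a\<bar> :: real)\<^sup>2) \<le> 3 - 2 / (real K + 1)"
proof (induction K)
  case (Suc K)
  have "{- int (Suc K)..int (Suc K)} = insert (int (Suc K)) (insert (- int (Suc K)) {- int K..int K})"
    by auto
  then have "(\<Sum>a\<in>{- int (Suc K)..int (Suc K)}. 1 / (1 + \<bar>of_int a\<bar> :: real)\<^sup>2) =
      2 / (real K + 2)\<^sup>2 + (\<Sum>a\<in>{- int K..int K}. 1 / (1 + \<bar>of_int a\<bar> :: real)\<^sup>2)"
    by (simp add: add_ac)
  also have "\<dots> \<le> 2 / ((real K + 1) * (real K + 2)) + (3 - 2 / (real K + 1))"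
    by (intro add_mono Suc.IH divide_left_mono) (auto simp: power2_eq_square intro!: mult_right_mono)
  also have "2 / ((real K + 1) * (real K + 2)) = 2 / (real K + 1) - 2 / (real K + 2)"
    by (simp add: field_simps)
  finally show ?case by (simp add: add_ac)
qed simp

lemma lattice_weight_summable: "lattice_weight summable_on (UNIV :: (int ^ 'n) set)"
proof (rule nonneg_bdd_above_summable_on[OF lattice_weight_nonneg])
  have "sum lattice_weight F \<le> 3 ^ CARD('n)" if F: "finite F" for F :: "(int ^ 'n) set"
  proof -
    have "finite ((\<lambda>(m, i). nat \<bar>m $ i\<bar>) ` (F \<times> UNIV))" using F by auto
    then obtain K where K0: "\<forall>n\<in>(\<lambda>(m, i). nat \<bar>m $ i\<bar>) ` (F \<times> UNIV). n \<le> K"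
      unfolding finite_nat_set_iff_bounded_le by blast
    have K: "nat \<bar>m $ i\<bar> \<le> K" if "m \<in> F" for m i
      using K0[rule_format, OF imageI, of "(m, i)"] that by simp
    let ?B = "{m :: int ^ 'n. \<forall>i. m $ i \<in> {- int K..int K}}"
    have "F \<subseteq> ?B"
    proof
      fix m assume "m \<in> F"
      then have "\<bar>m $ i\<bar> \<le> int K" for i using K[of m i] by linarith
      then show "m \<in> ?B" by (simp add: abs_le_iff minus_le_iff)
    qed
    then have "sum lattice_weight F \<le> sum lattice_weight ?B"
      by (intro sum_mono2 finite_vec_box) (auto simp: lattice_weight_nonneg)
    also have "\<dots> = (\<Prod>i\<in>(UNIV::'n set). \<Sum>a\<in>{- int K..int K}. 1 / (1 + \<bar>of_int a\<bar>)\<^sup>2)"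
      unfolding lattice_weight_def by (rule sum_vec_box) simp
    also have "\<dots> \<le> (\<Prod>i\<in>(UNIV::'n set). 3)"
    proof (rule prod_mono, intro conjI)
      show "0 \<le> (\<Sum>a\<in>{- int K..int K}. 1 / (1 + \<bar>of_int a\<bar> :: real)\<^sup>2)" by (intro sum_nonneg) auto
      have "0 \<le> 2 / (real K + 1)" by simp
      then show "(\<Sum>a\<in>{- int K..int K}. 1 / (1 + \<bar>of_int a\<bar> :: real)\<^sup>2) \<le> 3"
        using sum_int_weight[of K] by linarith
    qed
    finally show ?thesis by simp
  qed
  then show "bdd_above (sum lattice_weight ` {F :: (int ^ 'n) set. F \<subseteq> UNIV \<and> finite F})"
    by (intro bdd_aboveI2[where M = "3 ^ CARD('n)"]) auto
qed

lemma lattice_weight_enum_summable: "summable (\<lambda>k. lattice_weight (lattice_enum k :: int ^ 'n))"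
proof -
  have "(\<lambda>k. lattice_weight (lattice_enum k :: int ^ 'n)) summable_on UNIV"
    by (rule iffD2[OF summable_on_reindex_bij_betw[OF bij_lattice_enum] lattice_weight_summable])
  then show ?thesis by (rule summable_on_imp_summable)
qed

lemma lattice_dominated_summable:
  fixes f :: "int ^ 'n \<Rightarrow> 'b :: banach"
  assumes "\<And>m. norm (f m) \<le> K * lattice_weight m"
  shows "summable (\<lambda>k. norm (f (lattice_enum k)))" "summable (\<lambda>k. f (lattice_enum k))"
proof -
  show "summable (\<lambda>k. norm (f (lattice_enum k)))"
    by (rule summable_comparison_test'[OF summable_mult[OF lattice_weight_enum_summable[where 'n = 'n], of K]])
      (simp add: assms)
  then show "summable (\<lambda>k. f (lattice_enum k))" by (rule summable_norm_cancel)
qed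

lemma infsum_lattice_enum:
  fixes f :: "int ^ 'n \<Rightarrow> 'b :: banach"
  assumes "\<And>m. norm (f m) \<le> K * lattice_weight m"
  shows "infsum f UNIV = (\<Sum>k. f (lattice_enum k))"
proof -
  have "infsum f UNIV = infsum (\<lambda>k. f (lattice_enum k)) UNIV"
    by (rule infsum_reindex_bij_betw[OF bij_lattice_enum, symmetric])
  also have "\<dots> = (\<Sum>k. f (lattice_enum k))"
    using norm_summable_imp_has_sum[OF lattice_dominated_summable(1) summable_sums[OF lattice_dominated_summable(2)],
        OF assms assms] by (rule infsumI)
  finally show ?thesis .
qed

lemma prod_coordinates_le:
  fixes x :: "real ^ 'n"
  shows "(\<Prod>i\<in>UNIV. (1 + \<bar>x $ i\<bar>)\<^sup>2) \<le> (1 + norm x) ^ (2 * CARD('n))"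
proof -
  have "(\<Prod>i\<in>(UNIV :: 'n set). (1 + \<bar>x $ i\<bar>)\<^sup>2) \<le> (\<Prod>i\<in>(UNIV :: 'n set). (1 + norm x)\<^sup>2)"
    using component_le_norm_cart[of x] by (intro prod_mono) (auto intro!: power_mono)
  then show ?thesis by (simp add: power_mult)
qed

text \<open>Of the available decay, \<open>2 * CARD('n)\<close> orders are exchanged for one
  quadratic factor per coordinate, each coordinate being at most the norm; \<open>N\<close> orders
  remain as weight.\<close>

lemma schwartz_product_decay:
  fixes x :: "real ^ 'n"
  assumes "sbound (N + 2 * CARD('n)) f A"
  shows "(1 + norm x) ^ N * norm (f x) \<le> A * (\<Prod>i\<in>UNIV. 1 / (1 + \<bar>x $ i\<bar>)\<^sup>2)"
proof -
  let ?P = "\<Prod>i\<in>UNIV. (1 + \<bar>x $ i\<bar>)\<^sup>2"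
  have P: "?P > 0" by (intro prod_pos) (auto simp: add_pos_nonneg)
  have "?P * ((1 + norm x) ^ N * norm (f x)) \<le> (1 + norm x) ^ (2 * CARD('n)) * ((1 + norm x) ^ N * norm (f x))"
    by (intro mult_right_mono prod_coordinates_le) auto
  also have "\<dots> = (1 + norm x) ^ (N + 2 * CARD('n)) * norm (partial_derivs [] f x)"
    by (simp add: power_add)
  also have "\<dots> \<le> A" by (rule sboundD[OF assms]) simp
  finally have "(1 + norm x) ^ N * norm (f x) \<le> A / ?P"
    using P by (simp add: pos_le_divide_eq mult.commute)
  then show ?thesis by (simp add: prod_dividef)
qed

text \<open>A shift by \<open>x\<close> changes each coordinate factor by at most
  \<open>(1 + r)\<^sup>2\<close>, because \<open>1 + \<bar>m $ i\<bar> \<le> (1 + r) * (1 + \<bar>x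
  $ i + m $ i\<bar>)\<close>.\<close>

lemma schwartz_lattice_decay':
  fixes x :: "real ^ 'n"
  assumes "sbound (N + 2 * CARD('n)) f A" and r: "\<And>i. \<bar>x $ i\<bar> \<le> r"
  shows "(1 + norm (x + lattice_point m)) ^ N * norm (f (x + lattice_point m)) \<le>
    ((1 + r)\<^sup>2) ^ CARD('n) * A * lattice_weight m"
proof -
  have "(\<Prod>i\<in>(UNIV :: 'n set). 1 / (1 + \<bar>(x + lattice_point m) $ i\<bar>)\<^sup>2) \<le>
      (\<Prod>i\<in>(UNIV :: 'n set). (1 + r)\<^sup>2 * (1 / (1 + \<bar>of_int (m $ i)\<bar>)\<^sup>2))"
  proof (rule prod_mono, intro conjI)
    fix i :: 'n
    let ?a = "1 + \<bar>x $ i + of_int (m $ i)\<bar>" and ?b = "1 + \<bar>of_int (m $ i) :: real\<bar>"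
    have r0: "0 \<le> r" by (rule order_trans[OF abs_ge_zero r])
    have "?b \<le> ?a + r"
      using abs_triangle_ineq4[of "x $ i + of_int (m $ i)" "x $ i"] r[of i] by simp
    also have "\<dots> \<le> (1 + r) * ?a"
      using mult_nonneg_nonneg[OF r0 abs_ge_zero[of "x $ i + of_int (m $ i)"]] by (simp add: algebra_simps)
    finally have "?b\<^sup>2 \<le> ((1 + r) * ?a)\<^sup>2" by (intro power_mono) auto
    then have "?b\<^sup>2 \<le> (1 + r)\<^sup>2 * ?a\<^sup>2" by (simp only: power_mult_distrib)
    moreover have "0 < ?a\<^sup>2" "0 < ?b\<^sup>2" by (auto intro!: zero_less_power add_pos_nonneg)
    ultimately have "1 / ?a\<^sup>2 \<le> (1 + r)\<^sup>2 * (1 / ?b\<^sup>2)" by (simp add: divide_simps)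
    then show "1 / (1 + \<bar>(x + lattice_point m) $ i\<bar>)\<^sup>2 \<le> (1 + r)\<^sup>2 * (1 / (1 + \<bar>of_int (m $ i)\<bar>)\<^sup>2)" by simp
  qed simp
  also have "\<dots> = ((1 + r)\<^sup>2) ^ CARD('n) * lattice_weight m"
    unfolding lattice_weight_def prod.distrib by simp
  finally have "A * (\<Prod>i\<in>(UNIV :: 'n set). 1 / (1 + \<bar>(x + lattice_point m) $ i\<bar>)\<^sup>2) \<le>
      A * (((1 + r)\<^sup>2) ^ CARD('n) * lattice_weight m)"
    by (rule mult_left_mono[OF _ sbound_nonneg[OF assms(1)]])
  then have "A * (\<Prod>i\<in>(UNIV :: 'n set). 1 / (1 + \<bar>(x + lattice_point m) $ i\<bar>)\<^sup>2) \<le>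
      ((1 + r)\<^sup>2) ^ CARD('n) * A * lattice_weight m" by (simp only: mult_ac)
  with schwartz_product_decay[OF assms(1), of "x + lattice_point m"] show ?thesis by (rule order_trans)
qed

text \<open>The constant is \<open>(1 + r)\<^sup>2\<close> for \<open>r = 2\<close>, a radius that
  leaves room around the closed unit cube.\<close>

lemma schwartz_lattice_decay:
  fixes x :: "real ^ 'n"
  assumes "sbound (N + 2 * CARD('n)) f A" "\<And>i. \<bar>x $ i\<bar> \<le> 2"
  shows "(1 + norm (x + lattice_point m)) ^ N * norm (f (x + lattice_point m)) \<le> 9 ^ CARD('n) * A * lattice_weight m"
  using schwartz_lattice_decay'[OF assms] by simp

section \<open>Integrals unfolded over lattice translates of the unit cube\<close>

lemma integral_lborel_translate:
  fixes f :: "'a::euclidean_space \<Rightarrow> 'b::{banach, second_countable_topology}"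
  assumes [measurable]: "f \<in> borel_measurable lborel"
  shows "integrable lborel (\<lambda>x. f (x + a)) \<longleftrightarrow> integrable lborel f"
    and "(LINT x|lborel. f (x + a)) = (LINT x|lborel. f x)"
proof -
  have f: "f \<in> borel_measurable borel" using assms by simp
  have p: "(+) a \<in> measurable lborel borel" by simp
  show "integrable lborel (\<lambda>x. f (x + a)) \<longleftrightarrow> integrable lborel f"
    using integrable_distr_eq[OF p f] unfolding lborel_distr_plus by (simp add: add.commute)
  show "(LINT x|lborel. f (x + a)) = (LINT x|lborel. f x)"
    using integral_distr[OF p f] unfolding lborel_distr_plus by (simp add: add.commute)
qed

lemma unit_cube_measurable [measurable]: "(unit_cube :: (real ^ 'n) set) \<in> sets borel"
  unfolding unit_cube_def by measurable

lemma emeasure_unit_cube: "emeasure lborel (unit_cube :: (real ^ 'n) set) = 1"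
proof -
  have b: "(1 :: real ^ 'n) \<bullet> b = 1" if "b \<in> Basis" for b
    using that by (auto simp: Basis_vec_def inner_axis)
  have box: "emeasure lborel (box 0 1 :: (real ^ 'n) set) = 1" "emeasure lborel (cbox 0 1 :: (real ^ 'n) set) = 1"
    using b by (auto simp: emeasure_lborel_box_eq emeasure_lborel_cbox_eq prod.neutral)
  have "box 0 1 \<subseteq> (unit_cube :: (real ^ 'n) set)" "(unit_cube :: (real ^ 'n) set) \<subseteq> cbox 0 1"
    by (auto simp: unit_cube_def mem_box_cart less_imp_le)
  then show ?thesis
    using emeasure_mono[of "box 0 1" "unit_cube :: (real ^ 'n) set" lborel]
      emeasure_mono[of "unit_cube :: (real ^ 'n) set" "cbox 0 1" lborel] box by (auto intro: antisym)
qed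

lemma integrable_indicator_unit_cube [simp]: "integrable lborel (indicator (unit_cube :: (real ^ 'n) set) :: _ \<Rightarrow> real)"
  by (simp add: emeasure_unit_cube)

lemma measure_unit_cube [simp]: "measure lborel (unit_cube :: (real ^ 'n) set) = 1"
  using emeasure_unit_cube[where 'n = 'n] by (simp add: measure_def)

lemma unit_cube_bounded: "x \<in> unit_cube \<Longrightarrow> \<bar>x $ i\<bar> \<le> 2"
  unfolding unit_cube_def by (auto simp: abs_le_iff) (smt (verit))

lemma integrable_unit_cube_bounded:
  fixes f :: "real ^ 'n \<Rightarrow> 'b::{banach, second_countable_topology}"
  assumes [measurable]: "f \<in> borel_measurable lborel" and "\<And>x. x \<in> unit_cube \<Longrightarrow> norm (f x) \<le> B"
  shows "integrable lborel (\<lambda>x. indicator unit_cube x *\<^sub>R f x)"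
    and "(LINT x|lborel. norm (indicator unit_cube x *\<^sub>R f x)) \<le> B"
proof -
  have le: "norm (indicator unit_cube x *\<^sub>R f x) \<le> B * indicator unit_cube x" for x
    using assms(2)[of x] by (simp split: split_indicator)
  have iB: "integrable lborel (\<lambda>x :: real ^ 'n. B * indicator unit_cube x)" by simp
  show "integrable lborel (\<lambda>x. indicator unit_cube x *\<^sub>R f x)"
  proof (rule Bochner_Integration.integrable_bound[OF iB])
    show "AE x in lborel. norm (indicator unit_cube x *\<^sub>R f x) \<le> norm (B * indicator unit_cube x)"
      using le by (intro AE_I2) (metis abs_ge_self order_trans real_norm_def)
  qed measurable
  from integrable_norm[OF this]
  have "(LINT x|lborel. norm (indicator unit_cube x *\<^sub>R f x)) \<le> (LINT x|lborel. B * indicator (unit_cube :: (real ^ 'n) set) x)"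
    by (intro integral_mono iB le)
  then show "(LINT x|lborel. norm (indicator unit_cube x *\<^sub>R f x)) \<le> B" by simp
qed

text \<open>The lattice translates of the half-open cube tile the space, so that \<open>f\<close> is
  the sum of its restrictions to the tiles, with at most one nonzero term at each point. Each
  restriction is translated back to the unit cube, where the majorant allows sum and integral to be
  interchanged.\<close>

lemma integral_unfold_lattice:
  fixes f :: "real ^ 'n \<Rightarrow> 'b::{banach, second_countable_topology}"
  assumes f [measurable]: "f \<in> borel_measurable lborel"
    and dom: "\<And>x m. x \<in> unit_cube \<Longrightarrow> norm (f (x + lattice_point m)) \<le> K * lattice_weight m"
  shows "integrable lborel f"
    and "(LINT x|lborel. f x) = (LINT x|lborel. indicator unit_cube x *\<^sub>R (\<Sum>k. f (x + lattice_point (lattice_enum k))))"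
proof -
  let ?l = "\<lambda>k. lattice_point (lattice_enum k :: int ^ 'n)"
  let ?w = "\<lambda>k. K * lattice_weight (lattice_enum k :: int ^ 'n)"
  let ?g = "\<lambda>k x. indicator unit_cube (x - ?l k) *\<^sub>R f x"
  let ?h = "\<lambda>k x. indicator unit_cube x *\<^sub>R f (x + ?l k)"
  have w: "summable ?w" by (rule summable_mult[OF lattice_weight_enum_summable])
  have h: "integrable lborel (?h k)" "(LINT x|lborel. norm (?h k x)) \<le> ?w k" for k
    using integrable_unit_cube_bounded[of "\<lambda>x. f (x + ?l k)" "?w k"] dom by auto
  have gm: "?g k \<in> borel_measurable lborel" for k by measurable
  have gnm: "(\<lambda>x. norm (?g k x)) \<in> borel_measurable lborel" for k by measurable
  have gh: "?h k = (\<lambda>x. ?g k (x + ?l k))" for k by simp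
  have g: "integrable lborel (?g k)" "(LINT x|lborel. ?g k x) = (LINT x|lborel. ?h k x)"
      "(LINT x|lborel. norm (?g k x)) = (LINT x|lborel. norm (?h k x))" for k
    using h(1)[of k] integral_lborel_translate[OF gm[of k], of "?l k"]
      integral_lborel_translate(2)[where f = "\<lambda>x. norm (?g k x)", OF gnm[of k], of "?l k"] unfolding gh by simp_all
  have s: "summable (\<lambda>k. LINT x|lborel. norm (?h k x))"
  proof (rule summable_comparison_test'[OF w])
    fix k
    have "0 \<le> (LINT x|lborel. norm (?h k x))" by (rule Bochner_Integration.integral_nonneg) simp
    then show "norm (LINT x|lborel. norm (?h k x)) \<le> ?w k"
      using h(2)[of k] by (simp only: real_norm_def abs_of_nonneg)
  qed
  have "(\<lambda>k. ?g k x) sums f x" "summable (\<lambda>k. norm (?g k x))" for x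
  proof -
    obtain k0 where k0: "floor_vec x = lattice_enum k0" by (rule lattice_enum_cases)
    have g0: "?g k x = (if k = k0 then f x else 0)" for k
      using floor_vec_iff[of x "lattice_enum k"] unfolding k0 lattice_enum_inj by (simp add: indicator_def)
    show "(\<lambda>k. ?g k x) sums f x" unfolding g0 using sums_single[of k0 "\<lambda>_. f x"] by simp
    have "(\<lambda>k. norm (?g k x)) sums norm (f x)"
      unfolding g0 using sums_single[of k0 "\<lambda>_. norm (f x)"] by (simp add: if_distrib cong: if_cong)
    then show "summable (\<lambda>k. norm (?g k x))" by (rule sums_summable)
  qed
  then have fg: "f = (\<lambda>x. \<Sum>k. ?g k x)" and gs: "AE x in lborel. summable (\<lambda>k. norm (?g k x))"
    by (auto simp: sums_iff)
  have s': "summable (\<lambda>k. LINT x|lborel. norm (?g k x))" unfolding g(3) by (rule s)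
  show "integrable lborel f"
    using integrable_suminf[of lborel ?g, OF g(1) gs s'] by (subst fg)
  have w_nonneg: "0 \<le> ?w k" for k
    by (rule order_trans[OF norm_ge_zero dom[of 0]]) (simp add: unit_cube_def)
  have sh: "summable (\<lambda>k. norm (?h k x))" for x
    by (rule summable_comparison_test'[OF w]) (use w_nonneg dom in \<open>auto simp: indicator_def\<close>)
  have "(LINT x|lborel. f x) = (\<Sum>k. LINT x|lborel. ?g k x)"
    using integral_suminf[of lborel ?g, OF g(1) gs s'] by (subst fg)
  also have "\<dots> = (\<Sum>k. LINT x|lborel. ?h k x)" unfolding g(2) ..
  also have "\<dots> = (LINT x|lborel. (\<Sum>k. ?h k x))"
    by (rule integral_suminf[symmetric, OF h(1) AE_I2[OF sh] s])
  also have "\<dots> = (LINT x|lborel. indicator unit_cube x *\<^sub>R (\<Sum>k. f (x + ?l k)))"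
    by (intro Bochner_Integration.integral_cong refl) (simp add: indicator_def)
  finally show "(LINT x|lborel. f x) = (LINT x|lborel. indicator unit_cube x *\<^sub>R (\<Sum>k. f (x + ?l k)))" .
qed

lemma smooth_borel_measurable: "smooth f \<Longrightarrow> f \<in> borel_measurable lborel"
  using borel_measurable_continuous_onI[OF smooth_continuous] by simp

text \<open>Unfolding replaces an integral over the whole space by lattice sums over the unit cube,
  where the decay is uniform; no weight has to be integrated explicitly.\<close>

lemma schwartz_integral_bound:
  fixes f :: "real ^ 'n \<Rightarrow> complex"
  assumes "f \<in> schwartz_space" "sbound (N + 2 * CARD('n)) f A"
  shows "integrable lborel (\<lambda>x. (1 + norm x) ^ N * norm (f x))"
    and "(LINT x|lborel. (1 + norm x) ^ N * norm (f x)) \<le>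
      (\<Sum>k. 9 ^ CARD('n) * A * lattice_weight (lattice_enum k :: int ^ 'n))"
proof -
  let ?f = "\<lambda>x. (1 + norm x) ^ N * norm (f x)"
  let ?K = "9 ^ CARD('n) * A"
  have m [measurable]: "?f \<in> borel_measurable lborel"
    using smooth_borel_measurable[OF schwartz_smooth[OF assms(1)]] by measurable
  have dom: "norm (?f (x + lattice_point m)) \<le> ?K * lattice_weight m" if "x \<in> unit_cube" for x m
    using schwartz_lattice_decay[OF assms(2), of x m] unit_cube_bounded[OF that] by (simp add: abs_mult)
  have dom': "?f (x + lattice_point m) \<le> ?K * lattice_weight m" if "x \<in> unit_cube" for x m
    using schwartz_lattice_decay[OF assms(2), of x m] unit_cube_bounded[OF that] by simp
  show "integrable lborel ?f" by (rule integral_unfold_lattice(1)[where f = ?f, OF m dom])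
  let ?g = "\<lambda>x. indicator (unit_cube :: (real ^ 'n) set) x *\<^sub>R (\<Sum>k. ?f (x + lattice_point (lattice_enum k)))"
  have "(LINT x|lborel. ?f x) = (LINT x|lborel. ?g x)"
    by (rule integral_unfold_lattice(2)[where f = ?f, OF m dom])
  also have "\<dots> \<le> norm (LINT x|lborel. ?g x)" by simp
  also have "\<dots> \<le> (LINT x|lborel. norm (?g x))" by (rule integral_norm_bound)
  also have "\<dots> \<le> (\<Sum>k. ?K * lattice_weight (lattice_enum k :: int ^ 'n))"
  proof (rule integrable_unit_cube_bounded(2))
    fix x :: "real ^ 'n" assume x: "x \<in> unit_cube"
    note s = lattice_dominated_summable[of "\<lambda>m. ?f (x + lattice_point m)" ?K, OF dom[OF x]]
    have "0 \<le> (\<Sum>k. ?f (x + lattice_point (lattice_enum k)))" by (intro suminf_nonneg s(2)) simp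
    moreover have "(\<Sum>k. ?f (x + lattice_point (lattice_enum k))) \<le> (\<Sum>k. ?K * lattice_weight (lattice_enum k :: int ^ 'n))"
      by (intro suminf_le dom' x s(2) summable_mult lattice_weight_enum_summable)
    ultimately show "norm (\<Sum>k. ?f (x + lattice_point (lattice_enum k))) \<le>
      (\<Sum>k. ?K * lattice_weight (lattice_enum k :: int ^ 'n))" by simp
  qed measurable
  finally show "(LINT x|lborel. ?f x) \<le> (\<Sum>k. ?K * lattice_weight (lattice_enum k :: int ^ 'n))" .
qed

lemma schwartz_integrable:
  assumes "f \<in> schwartz_space"
  shows "integrable lborel f"
proof -
  obtain A where "sbound (0 + 2 * CARD('a)) f A" by (rule schwartz_sbound[OF assms])
  from schwartz_integral_bound(1)[OF assms this] have "integrable lborel (\<lambda>x. norm (f x))" by simp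
  then show ?thesis
    using integrable_norm_iff[OF smooth_borel_measurable[OF schwartz_smooth[OF assms]]] by simp
qed

lemma schwartz_functional_integral: "schwartz_functional (\<lambda>f :: real ^ 'n \<Rightarrow> complex. LINT x|lborel. f x)"
proof
  let ?C = "9 ^ CARD('n) * (\<Sum>k. lattice_weight (lattice_enum k :: int ^ 'n))"
  show "(LINT x|lborel. f x + g x) = (LINT x|lborel. f x) + (LINT x|lborel. g x)"
    if "f \<in> schwartz_space" "g \<in> schwartz_space" for f g :: "real ^ 'n \<Rightarrow> complex"
    by (intro Bochner_Integration.integral_add schwartz_integrable that)
  show "(LINT x|lborel. c * f x) = c * (LINT x|lborel. f x)" for f :: "real ^ 'n \<Rightarrow> complex" and c
    by simp
  have "norm (LINT x|lborel. f x) \<le> ?C * A"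
    if "f \<in> schwartz_space" "sbound (0 + 2 * CARD('n)) f A" for f :: "real ^ 'n \<Rightarrow> complex" and A
  proof -
    have "norm (LINT x|lborel. f x) \<le> (LINT x|lborel. (1 + norm x) ^ 0 * norm (f x))"
      using integral_norm_bound[of lborel f] by simp
    also have "\<dots> \<le> (\<Sum>k. 9 ^ CARD('n) * A * lattice_weight (lattice_enum k :: int ^ 'n))"
      by (rule schwartz_integral_bound(2)[OF that])
    also have "\<dots> = ?C * A"
      unfolding suminf_mult[OF lattice_weight_enum_summable] by simp
    finally show ?thesis .
  qed
  then show "\<exists>N C. \<forall>f\<in>(schwartz_space :: (real ^ 'n \<Rightarrow> complex) set). \<forall>A. sbound N f A \<longrightarrow> norm (LINT x|lborel. f x) \<le> C * A" by blast
qed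

section \<open>Square-integrable functions\<close>

lemma measurable_cnj [measurable]: "cnj \<in> borel_measurable borel"
  by (intro borel_measurable_continuous_onI continuous_intros)

lemma integrable_scaleR_iff:
  fixes f :: "'a \<Rightarrow> 'b::{banach, second_countable_topology}"
  assumes "c \<noteq> 0"
  shows "integrable M (\<lambda>x. c *\<^sub>R f x) \<longleftrightarrow> integrable M f"
proof
  assume "integrable M (\<lambda>x. c *\<^sub>R f x)"
  then have "integrable M (\<lambda>x. (1 / c) *\<^sub>R c *\<^sub>R f x)" by (rule integrable_scaleR_right)
  then show "integrable M f" using assms by simp
qed (intro integrable_scaleR_right)

lemma integral_lborel_scale:
  fixes f :: "real ^ 'n \<Rightarrow> 'b::{banach, second_countable_topology}"
  assumes f: "f \<in> borel_measurable lborel" and c: "c > 0"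
  shows "integrable lborel (\<lambda>x. f (c *\<^sub>R x)) \<longleftrightarrow> integrable lborel f"
    and "(LINT x|lborel. f x) = c ^ CARD('n) *\<^sub>R (LINT x|lborel. f (c *\<^sub>R x))"
proof -
  have fb: "f \<in> borel_measurable borel" using f by simp
  have p: "(\<lambda>x :: real ^ 'n. 0 + c *\<^sub>R x) \<in> measurable lborel borel" by measurable
  have eq: "(lborel :: (real ^ 'n) measure) =
      density (distr lborel borel (\<lambda>x. 0 + c *\<^sub>R x)) (\<lambda>_. ennreal (c ^ CARD('n)))"
    using lborel_affine[of c "0 :: real ^ 'n"] c by (simp add: ennreal_power)
  have fd: "f \<in> borel_measurable (distr lborel borel (\<lambda>x. 0 + c *\<^sub>R x))" using fb by simp
  have "integrable lborel f \<longleftrightarrow> integrable (distr lborel borel (\<lambda>x. 0 + c *\<^sub>R x)) (\<lambda>x. c ^ CARD('n) *\<^sub>R f x)"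
    using c by (subst eq, subst integrable_density[OF fd]) auto
  also have "\<dots> \<longleftrightarrow> integrable lborel (\<lambda>x. c ^ CARD('n) *\<^sub>R f (0 + c *\<^sub>R x))"
    by (rule integrable_distr_eq[OF p]) (use fb in measurable)
  also have "\<dots> \<longleftrightarrow> integrable lborel (\<lambda>x. f (c *\<^sub>R x))" using c by (simp add: integrable_scaleR_iff)
  finally show "integrable lborel (\<lambda>x. f (c *\<^sub>R x)) \<longleftrightarrow> integrable lborel f" ..
  have "(LINT x|lborel. f x) = (LINT x|distr lborel borel (\<lambda>x. 0 + c *\<^sub>R x). c ^ CARD('n) *\<^sub>R f x)"
    using c by (subst eq, subst integral_density[OF fd]) auto
  also have "\<dots> = (LINT x|lborel. c ^ CARD('n) *\<^sub>R f (0 + c *\<^sub>R x))"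
    by (rule integral_distr[OF p]) (use fb in measurable)
  finally show "(LINT x|lborel. f x) = c ^ CARD('n) *\<^sub>R (LINT x|lborel. f (c *\<^sub>R x))" by simp
qed

lemma L2_spaceD:
  assumes "f \<in> L2_space"
  shows "f \<in> borel_measurable lborel" "integrable lborel (\<lambda>x. (norm (f x))\<^sup>2)"
  using assms by (auto simp: L2_space_def)

lemma integrable_L2_mult:
  assumes f: "f \<in> L2_space" and g: "g \<in> L2_space"
  shows "integrable lborel (\<lambda>x. f x * cnj (g x))"
proof (rule Bochner_Integration.integrable_bound[OF Bochner_Integration.integrable_add[OF L2_spaceD(2)[OF f] L2_spaceD(2)[OF g]]])
  show "(\<lambda>x. f x * cnj (g x)) \<in> borel_measurable lborel"
    using L2_spaceD(1)[OF f] L2_spaceD(1)[OF g] by measurable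
  have "norm (f x) * norm (g x) \<le> (norm (f x))\<^sup>2 + (norm (g x))\<^sup>2" for x
    using sum_squares_bound[of "norm (f x)" "norm (g x)"] mult_nonneg_nonneg[OF norm_ge_zero[of "f x"] norm_ge_zero[of "g x"]]
    by linarith
  then show "AE x in lborel. norm (f x * cnj (g x)) \<le> norm ((norm (f x))\<^sup>2 + (norm (g x))\<^sup>2)"
    by (intro AE_I2) (simp add: norm_mult)
qed

text \<open>This is \<open>0 \<le> (\<theta> * p - q)\<^sup>2 / \<theta>\<close>. The parameter
  stays free because in \<open>sum_cube_coefficients_le\<close> the main term may be enlarged only
  by a factor \<open>1 + \<theta>\<close> that fits the gap to be contradicted.\<close>

lemma weighted_square_sum:
  fixes p q \<theta> :: real
  assumes "\<theta> > 0"
  shows "(p + q)\<^sup>2 \<le> (1 + \<theta>) * p\<^sup>2 + (1 + 1 / \<theta>) * q\<^sup>2"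
proof -
  have "0 \<le> (\<theta> * p - q)\<^sup>2 / \<theta>" using assms by simp
  also have "\<dots> = \<theta> * p\<^sup>2 - 2 * (p * q) + 1 / \<theta> * q\<^sup>2"
    using assms by (simp add: power2_eq_square field_simps)
  finally show ?thesis by (simp add: power2_sum algebra_simps)
qed

lemma norm_square_add_le: "(norm (a + b))\<^sup>2 \<le> 2 * (norm a)\<^sup>2 + 2 * (norm b)\<^sup>2"
proof -
  have "(norm (a + b))\<^sup>2 \<le> (norm a + norm b)\<^sup>2" by (intro power_mono norm_triangle_ineq) auto
  also have "\<dots> \<le> 2 * (norm a)\<^sup>2 + 2 * (norm b)\<^sup>2" using weighted_square_sum[of 1] by simp
  finally show ?thesis .
qed

lemma L2_space_add:
  assumes f: "f \<in> L2_space" and g: "g \<in> L2_space"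
  shows "(\<lambda>x. f x + g x) \<in> L2_space"
proof -
  have m: "(\<lambda>x. f x + g x) \<in> borel_measurable lborel"
    using L2_spaceD(1)[OF f] L2_spaceD(1)[OF g] by measurable
  have i: "integrable lborel (\<lambda>x. 2 * (norm (f x))\<^sup>2 + 2 * (norm (g x))\<^sup>2)"
    using L2_spaceD(2)[OF f] L2_spaceD(2)[OF g] by auto
  have "integrable lborel (\<lambda>x. (norm (f x + g x))\<^sup>2)"
  proof (rule Bochner_Integration.integrable_bound[OF i])
    show "(\<lambda>x. (norm (f x + g x))\<^sup>2) \<in> borel_measurable lborel" using m by measurable
    show "AE x in lborel. norm ((norm (f x + g x))\<^sup>2) \<le> norm (2 * (norm (f x))\<^sup>2 + 2 * (norm (g x))\<^sup>2)"
      using norm_square_add_le by (intro AE_I2) simp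
  qed
  with m show ?thesis by (simp add: L2_space_def)
qed

lemma L2_space_cmult:
  assumes f: "f \<in> L2_space"
  shows "(\<lambda>x. c * f x) \<in> L2_space"
  using L2_spaceD[OF f] by (auto simp: L2_space_def norm_mult power_mult_distrib)

lemma L2_space_zero: "(\<lambda>x. 0) \<in> L2_space"
  by (simp add: L2_space_def)

lemma L2_space_diff: "f \<in> L2_space \<Longrightarrow> g \<in> L2_space \<Longrightarrow> (\<lambda>x. f x - g x) \<in> L2_space"
  using L2_space_add[of f "\<lambda>x. (-1) * g x"] L2_space_cmult[of g "-1"] by simp

lemma L2_space_sum: "(\<And>i. i \<in> I \<Longrightarrow> f i \<in> L2_space) \<Longrightarrow> (\<lambda>x. \<Sum>i\<in>I. f i x) \<in> L2_space"
  by (induction I rule: infinite_finite_induct) (auto intro: L2_space_add L2_space_zero)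

lemma L2_inner_cnj: "L2_inner g f = cnj (L2_inner f g)"
proof -
  have "(LINT x|lborel. g x * cnj (f x)) = (LINT x|lborel. cnj (f x * cnj (g x)))"
    by (intro Bochner_Integration.integral_cong) simp_all
  also have "\<dots> = cnj (LINT x|lborel. f x * cnj (g x))" by (rule Bochner_Integration.integral_cnj)
  finally show ?thesis unfolding L2_inner_def .
qed

lemma L2_inner_add_left:
  assumes "f \<in> L2_space" "g \<in> L2_space" "h \<in> L2_space"
  shows "L2_inner (\<lambda>x. f x + g x) h = L2_inner f h + L2_inner g h"
  unfolding L2_inner_def distrib_right
  by (intro Bochner_Integration.integral_add integrable_L2_mult assms)

lemma L2_inner_cmult_left: "L2_inner (\<lambda>x. c * f x) h = c * L2_inner f h"
  unfolding L2_inner_def mult.assoc by simp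

lemma L2_inner_diff_left:
  assumes "f \<in> L2_space" "g \<in> L2_space" "h \<in> L2_space"
  shows "L2_inner (\<lambda>x. f x - g x) h = L2_inner f h - L2_inner g h"
  unfolding L2_inner_def left_diff_distrib
  by (intro Bochner_Integration.integral_diff integrable_L2_mult assms)

lemma L2_inner_diff_right:
  assumes "f \<in> L2_space" "g \<in> L2_space" "h \<in> L2_space"
  shows "L2_inner h (\<lambda>x. f x - g x) = L2_inner h f - L2_inner h g"
  unfolding L2_inner_cnj[of h] L2_inner_diff_left[OF assms] by simp

lemma L2_inner_sum_left:
  assumes "\<And>i. i \<in> I \<Longrightarrow> e i \<in> L2_space" "h \<in> L2_space"
  shows "L2_inner (\<lambda>x. \<Sum>i\<in>I. c i * e i x) h = (\<Sum>i\<in>I. c i * L2_inner (e i) h)"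
  using assms(1)
proof (induction I rule: infinite_finite_induct)
  case (insert i I)
  have "L2_inner (\<lambda>x. c i * e i x + (\<Sum>i\<in>I. c i * e i x)) h =
      L2_inner (\<lambda>x. c i * e i x) h + L2_inner (\<lambda>x. \<Sum>i\<in>I. c i * e i x) h"
    using insert.prems by (intro L2_inner_add_left L2_space_sum L2_space_cmult assms(2)) auto
  then show ?case using insert by (simp add: L2_inner_cmult_left)
qed (simp_all add: L2_inner_def)

lemma L2_inner_self: "L2_inner f f = of_real (LINT x|lborel. (norm (f x))\<^sup>2)"
  unfolding L2_inner_def complex_norm_square[symmetric] of_real_power[symmetric] by (rule integral_complex_of_real)

text \<open>The left side is the squared distance of \<open>F\<close> to the span, and other
  coefficients \<open>c i\<close> instead of the inner products \<open>a i\<close> add the sum of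
  \<open>(norm (a i - c i))\<^sup>2\<close>. It is read backwards later: a function close to the
  span has coefficients with a large square sum.\<close>

lemma bessel_approximation:
  assumes e: "\<And>i. e i \<in> L2_space" and orth: "\<And>i k. L2_inner (e i) (e k) = (if i = k then 1 else 0)"
    and F: "F \<in> L2_space" and "finite I"
  shows "(LINT x|lborel. (norm (F x))\<^sup>2) - (\<Sum>i\<in>I. (norm (L2_inner F (e i)))\<^sup>2) \<le>
    (LINT x|lborel. (norm (F x - (\<Sum>i\<in>I. c i * e i x)))\<^sup>2)"
proof -
  let ?s = "\<lambda>x. \<Sum>i\<in>I. c i * e i x"
  define a where "a i = L2_inner F (e i)" for i
  have s: "?s \<in> L2_space" by (intro L2_space_sum L2_space_cmult e)
  have sF: "L2_inner ?s F = (\<Sum>i\<in>I. c i * cnj (a i))"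
    unfolding L2_inner_sum_left[OF e F] a_def L2_inner_cnj[of _ F] ..
  have es: "L2_inner (e i) ?s = (if i \<in> I then cnj (c i) else 0)" for i
  proof -
    have "L2_inner ?s (e i) = (\<Sum>k\<in>I. if k = i then c k else 0)"
      unfolding L2_inner_sum_left[OF e e] orth by (rule sum.cong) auto
    then show ?thesis
      unfolding L2_inner_cnj[of "e i" ?s] using \<open>finite I\<close> by simp
  qed
  have ss: "L2_inner ?s ?s = (\<Sum>i\<in>I. c i * cnj (c i))"
    unfolding L2_inner_sum_left[OF e s] es by (rule sum.cong) auto
  have "of_real (LINT x|lborel. (norm (F x - ?s x))\<^sup>2) = L2_inner (\<lambda>x. F x - ?s x) (\<lambda>x. F x - ?s x)"
    by (rule L2_inner_self[symmetric])
  also have "\<dots> = L2_inner F F - L2_inner ?s F - (L2_inner F ?s - L2_inner ?s ?s)"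
    by (simp only: L2_inner_diff_left[OF F s L2_space_diff[OF F s]] L2_inner_diff_right[OF F s F]
        L2_inner_diff_right[OF F s s]) simp
  also have "\<dots> = of_real (LINT x|lborel. (norm (F x))\<^sup>2) - (\<Sum>i\<in>I. c i * cnj (a i)) -
      ((\<Sum>i\<in>I. cnj (c i) * a i) - (\<Sum>i\<in>I. c i * cnj (c i)))"
    unfolding L2_inner_cnj[of F ?s] sF ss L2_inner_self by (simp add: mult.commute)
  also have "\<dots> = of_real (LINT x|lborel. (norm (F x))\<^sup>2) - (\<Sum>i\<in>I. a i * cnj (a i)) +
      (\<Sum>i\<in>I. (a i - c i) * cnj (a i - c i))"
    by (simp add: algebra_simps sum.distrib sum_subtractf)
  also have "\<dots> = of_real ((LINT x|lborel. (norm (F x))\<^sup>2) - (\<Sum>i\<in>I. (norm (a i))\<^sup>2) +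
      (\<Sum>i\<in>I. (norm (a i - c i))\<^sup>2))"
    by (simp only: complex_norm_square[symmetric] of_real_add of_real_diff of_real_sum)
  finally have "(LINT x|lborel. (norm (F x - ?s x))\<^sup>2) = (LINT x|lborel. (norm (F x))\<^sup>2) -
      (\<Sum>i\<in>I. (norm (a i))\<^sup>2) + (\<Sum>i\<in>I. (norm (a i - c i))\<^sup>2)"
    by (simp only: of_real_eq_iff)
  moreover have "0 \<le> (\<Sum>i\<in>I. (norm (a i - c i))\<^sup>2)" by (intro sum_nonneg) simp
  ultimately show ?thesis by (simp add: a_def)
qed

section \<open>Large cubes: approximation, and counting of lattice points\<close>

definition cube :: "real \<Rightarrow> (real ^ 'n) set" where
  "cube L = {x. \<forall>i. 0 \<le> x $ i \<and> x $ i < L}"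

lemma cube_measurable [measurable]: "(cube L :: (real ^ 'n) set) \<in> sets borel"
  unfolding cube_def by measurable

lemma scaleR_mem_unit_cube:
  assumes "L > 0"
  shows "(1 / L) *\<^sub>R x \<in> unit_cube \<longleftrightarrow> x \<in> cube L"
  using assms by (simp add: cube_def unit_cube_def zero_le_divide_iff)

lemma indicator_unit_cube_scale: "L > 0 \<Longrightarrow> indicator unit_cube ((1 / L) *\<^sub>R x) = indicator (cube L) x"
  using scaleR_mem_unit_cube[of L x] by (simp add: indicator_def)

lemma indicator_unit_cube_L2: "(\<lambda>x. indicator unit_cube x :: complex) \<in> L2_space"
proof -
  have eq: "(norm (indicator unit_cube x :: complex))\<^sup>2 = indicator unit_cube x" for x :: "real ^ 'n"
    by (simp split: split_indicator)
  show ?thesis unfolding L2_space_def mem_Collect_eq eq by simp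
qed

lemma L2_space_scale:
  assumes "f \<in> L2_space" "c > 0"
  shows "(\<lambda>x. f (c *\<^sub>R x)) \<in> L2_space"
proof -
  note f = L2_spaceD[OF assms(1)]
  have "(\<lambda>x. (norm (f x))\<^sup>2) \<in> borel_measurable lborel" using f(1) by measurable
  from integral_lborel_scale(1)[OF this assms(2)] f(2) have "integrable lborel (\<lambda>x. (norm (f (c *\<^sub>R x)))\<^sup>2)" by simp
  moreover have "(\<lambda>x. f (c *\<^sub>R x)) \<in> borel_measurable lborel" using f(1) by measurable
  ultimately show ?thesis by (simp add: L2_space_def)
qed

lemma integral_indicator_cube:
  assumes "L > 0"
  shows "(LINT x|lborel. (norm (indicator (cube L :: (real ^ 'n) set) x :: complex))\<^sup>2) = L ^ CARD('n)"
    and "(\<lambda>x. indicator (cube L :: (real ^ 'n) set) x :: complex) \<in> L2_space"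
proof -
  note ind = indicator_unit_cube_scale[OF assms]
  have sq: "(norm (indicator A x :: complex))\<^sup>2 = indicator A x" for x :: "real ^ 'n" and A
    by (simp split: split_indicator)
  have "(LINT x|lborel. indicator (unit_cube :: (real ^ 'n) set) x :: real) =
      (1 / L) ^ CARD('n) * (LINT x|lborel. indicator (cube L :: (real ^ 'n) set) x)"
    using integral_lborel_scale(2)[of "indicator (unit_cube :: (real ^ 'n) set) :: _ \<Rightarrow> real" "1 / L"] assms
    unfolding ind by simp
  then show "(LINT x|lborel. (norm (indicator (cube L :: (real ^ 'n) set) x :: complex))\<^sup>2) = L ^ CARD('n)"
    unfolding sq using assms by (simp add: power_one_over field_simps)
  show "(\<lambda>x. indicator (cube L :: (real ^ 'n) set) x :: complex) \<in> L2_space"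
    using L2_space_scale[OF indicator_unit_cube_L2, of "1 / L"] assms unfolding ind by simp
qed

lemma MRA_scale_to_zero:
  assumes "MRA V" "h \<in> V (int J)"
  shows "(\<lambda>x. h ((1 / 2 ^ J) *\<^sub>R x)) \<in> V 0"
  using assms(2)
proof (induction J arbitrary: h)
  case (Suc J)
  let ?g = "\<lambda>x. h ((1 / 2) *\<^sub>R x)"
  have "(\<lambda>x. ?g (2 *\<^sub>R x)) \<in> V (int J + 1)" using Suc.prems by (simp add: add.commute)
  then have "?g \<in> V (int J)" using assms(1) unfolding MRA_def by blast
  from Suc.IH[OF this] show ?case by (simp add: mult.commute)
qed simp

text \<open>The translates of \<open>\<phi>\<close> span only \<open>V 0\<close>, so an approximant
  of the unit cube from a space of high index is dilated into \<open>V 0\<close>, which blows the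
  cube up to side \<open>2 ^ J\<close>. The lower bound \<open>J0\<close> can be prescribed because
  the spaces increase.\<close>

lemma MRA_cube_approximation:
  fixes V :: "int \<Rightarrow> (real ^ 'n \<Rightarrow> complex) set"
  assumes V: "MRA V" and \<phi>: "scaling_function V \<phi>" and "\<delta> > 0"
  shows "\<exists>J\<ge>J0. \<exists>I. finite I \<and> (1 - \<delta>) * (2 ^ J) ^ CARD('n) \<le>
    (\<Sum>m\<in>I. (norm (L2_inner (\<lambda>x. indicator (cube (2 ^ J)) x) (\<lambda>x. \<phi> (x - lattice_point m))))\<^sup>2)"
proof -
  let ?f = "\<lambda>x :: real ^ 'n. indicator unit_cube x :: complex"
  let ?e = "\<lambda>m x. \<phi> (x - lattice_point m)"
  \<comment> \<open>Two approximation errors occur, each of square at most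
    \<open>\<epsilon>\<^sup>2\<close> relative to the volume \<open>L ^ CARD('n)\<close>, and
    squaring their sum doubles both: \<open>4 * \<epsilon>\<^sup>2 = \<delta>\<close>.\<close>
  define \<epsilon> where "\<epsilon> = sqrt (\<delta> / 4)"
  have \<epsilon>: "\<epsilon> > 0" "\<epsilon>\<^sup>2 = \<delta> / 4" using \<open>\<delta> > 0\<close> by (simp_all add: \<epsilon>_def)
  have less: "(LINT x|lborel. (norm (g x))\<^sup>2) < \<epsilon>\<^sup>2" if "L2_norm g < \<epsilon>" for g :: "real ^ 'n \<Rightarrow> complex"
  proof -
    have "0 \<le> (LINT x|lborel. (norm (g x))\<^sup>2)" by simp
    moreover have "(L2_norm g)\<^sup>2 < \<epsilon>\<^sup>2" using that by (intro power_strict_mono) (auto simp: L2_norm_def)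
    ultimately show ?thesis unfolding L2_norm_def by simp
  qed
  have approx: "\<exists>h\<in>S. L2_norm (\<lambda>x. g x - h x) < \<epsilon>" if "g \<in> L2_closure S" for g S
    using that \<epsilon>(1) by (simp add: L2_closure_def)
  have mono: "mono V"
    using V unfolding MRA_def by (elim conjE)
  have closed: "\<forall>j. L2_closed_subspace (V j)"
    using V unfolding MRA_def by (elim conjE)
  have dense: "L2_closure (\<Union>j. V j) = L2_space"
    using V unfolding MRA_def by (elim conjE)
  have sub: "V j \<subseteq> L2_space" for j
    using closed[rule_format, of j] by (simp only: L2_closed_subspace_def)
  have "?f \<in> L2_closure (\<Union>j. V j)" unfolding dense by (rule indicator_unit_cube_L2)
  from approx[OF this] obtain h j where h: "h \<in> V j" "L2_norm (\<lambda>x. ?f x - h x) < \<epsilon>"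
    by (elim bexE UN_E)
  define J where "J = max J0 (nat j)"
  have J: "J \<ge> J0" "j \<le> int J" by (auto simp: J_def)
  then have hJ: "h \<in> V (int J)" using monoD[OF mono J(2)] h(1) by blast
  define L :: real where "L = 2 ^ J"
  have L: "L \<ge> 1" "L > 0" by (simp_all add: L_def)
  let ?F = "\<lambda>x :: real ^ 'n. indicator (cube L) x :: complex"
  let ?h = "\<lambda>x. h ((1 / L) *\<^sub>R x)"
  have h0: "?h \<in> V 0" using MRA_scale_to_zero[OF V hJ] by (simp add: L_def)
  have basis: "\<And>m. ?e m \<in> V 0" "\<And>m k. L2_inner (?e m) (?e k) = (if m = k then 1 else 0)"
    "L2_closure (complex_span ?e) = V 0"
    using \<phi> by (simp_all only: scaling_function_def orthonormal_basis_def)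
  have e: "?e m \<in> L2_space" for m using basis(1) sub by blast
  have "?h \<in> L2_closure (complex_span ?e)" using h0 basis(3) by simp
  from approx[OF this] obtain s where s: "s \<in> complex_span ?e" "L2_norm (\<lambda>x. ?h x - s x) < \<epsilon>"
    by (elim bexE)
  from s(1) obtain I c where Ic: "finite I" "s = (\<lambda>x. \<Sum>m\<in>I. c m * ?e m x)"
    unfolding complex_span_def mem_Collect_eq by (elim exE conjE)
  have hL: "h \<in> L2_space" "?h \<in> L2_space" using h(1) h0 sub by blast+
  have sL: "s \<in> L2_space" unfolding Ic(2) by (intro L2_space_sum L2_space_cmult e)
  have FL: "?F \<in> L2_space" by (rule integral_indicator_cube(2)[OF L(2)])
  have ind: "?f ((1 / L) *\<^sub>R x) = ?F x" for x
    by (rule indicator_unit_cube_scale[OF L(2)])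
  have fh: "(\<lambda>x. (norm (?f x - h x))\<^sup>2) \<in> borel_measurable lborel"
    using L2_spaceD(1)[OF L2_space_diff[OF indicator_unit_cube_L2 hL(1)]] by measurable
  have "(LINT x|lborel. (norm (?F x - ?h x))\<^sup>2) = L ^ CARD('n) * (LINT x|lborel. (norm (?f x - h x))\<^sup>2)"
    using integral_lborel_scale(2)[OF fh, of "1 / L"] L unfolding ind by (simp add: power_one_over)
  also have "\<dots> \<le> L ^ CARD('n) * \<epsilon>\<^sup>2"
    using less[OF h(2)] L by (intro mult_left_mono) auto
  finally have Fh: "(LINT x|lborel. (norm (?F x - ?h x))\<^sup>2) \<le> L ^ CARD('n) * \<epsilon>\<^sup>2" .
  have "L ^ CARD('n) - (\<Sum>m\<in>I. (norm (L2_inner ?F (?e m)))\<^sup>2) \<le> (LINT x|lborel. (norm (?F x - s x))\<^sup>2)"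
    using bessel_approximation[OF e basis(2) FL Ic(1), of c] integral_indicator_cube(1)[OF L(2), where 'n = 'n]
    unfolding Ic(2) by simp
  also have "\<dots> \<le> (LINT x|lborel. 2 * (norm (?F x - ?h x))\<^sup>2 + 2 * (norm (?h x - s x))\<^sup>2)"
  proof (rule integral_mono)
    show "integrable lborel (\<lambda>x. (norm (?F x - s x))\<^sup>2)"
      by (rule L2_spaceD(2)[OF L2_space_diff[OF FL sL]])
    show "integrable lborel (\<lambda>x. 2 * (norm (?F x - ?h x))\<^sup>2 + 2 * (norm (?h x - s x))\<^sup>2)"
      by (intro Bochner_Integration.integrable_add integrable_mult_right L2_spaceD(2) L2_space_diff FL sL hL)
    show "(norm (?F x - s x))\<^sup>2 \<le> 2 * (norm (?F x - ?h x))\<^sup>2 + 2 * (norm (?h x - s x))\<^sup>2" for x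
      using norm_square_add_le[of "?F x - ?h x" "?h x - s x"] by simp
  qed
  also have "\<dots> = 2 * (LINT x|lborel. (norm (?F x - ?h x))\<^sup>2) + 2 * (LINT x|lborel. (norm (?h x - s x))\<^sup>2)"
    using L2_spaceD(2)[OF L2_space_diff[OF FL hL(2)]] L2_spaceD(2)[OF L2_space_diff[OF hL(2) sL]] by simp
  also have "\<dots> \<le> 2 * (L ^ CARD('n) * \<epsilon>\<^sup>2) + 2 * (L ^ CARD('n) * \<epsilon>\<^sup>2)"
  proof -
    have "1 * \<epsilon>\<^sup>2 \<le> L ^ CARD('n) * \<epsilon>\<^sup>2" using L by (intro mult_right_mono one_le_power) auto
    then show ?thesis using Fh less[OF s(2)] by simp
  qed
  also have "\<dots> = \<delta> * L ^ CARD('n)" unfolding \<epsilon>(2) by simp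
  finally have "(1 - \<delta>) * L ^ CARD('n) \<le> (\<Sum>m\<in>I. (norm (L2_inner ?F (?e m)))\<^sup>2)"
    by (simp add: algebra_simps)
  then show ?thesis using J(1) Ic(1) unfolding L_def by blast
qed

text \<open>The condition that \<open>lattice_point m + y\<close> lie in the cube, for one
  coordinate. Because the interval is half-open, every slice is a run of exactly \<open>L\<close>
  consecutive integers, whatever \<open>y\<close> is.\<close>

definition int_slice :: "nat \<Rightarrow> real \<Rightarrow> int set" where
  "int_slice L y = {a. 0 \<le> of_int a + y \<and> of_int a + y < real L}"

lemma int_slice_eq: "int_slice L y = {\<lceil>- y\<rceil>..<\<lceil>- y\<rceil> + int L}"
proof -
  have "0 \<le> of_int a + y \<longleftrightarrow> \<lceil>- y\<rceil> \<le> a" for a :: int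
    unfolding ceiling_le_iff by linarith
  moreover have "of_int a + y < real L \<longleftrightarrow> a < \<lceil>- y\<rceil> + int L" for a :: int
  proof -
    have "a < \<lceil>- y\<rceil> + int L \<longleftrightarrow> a - int L < \<lceil>- y\<rceil>" by linarith
    also have "\<dots> \<longleftrightarrow> of_int (a - int L) < - y" by (rule less_ceiling_iff)
    finally show ?thesis by (simp add: algebra_simps)
  qed
  ultimately show ?thesis unfolding int_slice_def by auto
qed

lemma card_int_slice: "finite (int_slice L y)" "card (int_slice L y) = L"
  by (simp_all add: int_slice_eq)

lemma abs_ceiling_le: "\<bar>real_of_int \<lceil>- y\<rceil>\<bar> \<le> \<bar>y\<bar> + 1"
  using ceiling_correct[of "- y"] by (simp add: abs_le_iff) linarith

text \<open>Two runs of \<open>L\<close> consecutive integers with offset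
  \<open>\<lceil>- y\<rceil>\<close>: each has at most as many elements outside the other as the
  modulus of the offset, also when they are disjoint.\<close>

lemma card_int_slice_diff:
  "real (card (int_slice L 0 - int_slice L y)) \<le> \<bar>y\<bar> + 1"
  "real (card (int_slice L y - int_slice L 0)) \<le> \<bar>y\<bar> + 1"
proof -
  define k where "k = \<lceil>- y\<rceil>"
  have k: "\<bar>real_of_int k\<bar> \<le> \<bar>y\<bar> + 1" unfolding k_def by (rule abs_ceiling_le)
  have "card (int_slice L 0 - int_slice L y) \<le> card ({0..<k} \<union> {k + int L..<int L})"
    by (rule card_mono) (auto simp: int_slice_eq k_def)
  also have "\<dots> \<le> card {0..<k} + card {k + int L..<int L}" by (rule card_Un_le)
  also have "real \<dots> = \<bar>real_of_int k\<bar>" by (cases "k \<ge> 0") auto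
  finally show "real (card (int_slice L 0 - int_slice L y)) \<le> \<bar>y\<bar> + 1" using k by simp
  have "card (int_slice L y - int_slice L 0) \<le> card ({k..<0} \<union> {int L..<k + int L})"
    by (rule card_mono) (auto simp: int_slice_eq k_def)
  also have "\<dots> \<le> card {k..<0} + card {int L..<k + int L}" by (rule card_Un_le)
  also have "real \<dots> = \<bar>real_of_int k\<bar>" by (cases "k \<ge> 0") auto
  finally show "real (card (int_slice L y - int_slice L 0)) \<le> \<bar>y\<bar> + 1" using k by simp
qed

lemma lattice_mem_cube: "lattice_point m + y \<in> cube (real L) \<longleftrightarrow> (\<forall>i. m $ i \<in> int_slice L (y $ i))"
  by (simp add: cube_def int_slice_def)

lemma card_box_slice:
  fixes i :: "'n::finite"
  assumes "finite X" "\<And>k. finite (Y k)" "\<And>k. card (Y k) = L"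
  shows "card {m :: int ^ 'n. \<forall>k. m $ k \<in> (if k = i then X else Y k)} = card X * L ^ (CARD('n) - 1)"
proof -
  have "card {m :: int ^ 'n. \<forall>k. m $ k \<in> (if k = i then X else Y k)} =
      (\<Prod>k\<in>UNIV. card (if k = i then X else Y k))"
    by (rule card_vec_box) (simp add: assms)
  also have "\<dots> = card X * (\<Prod>k\<in>UNIV - {i}. card (if k = i then X else Y k))"
    by (subst prod.remove[of _ i]) auto
  also have "(\<Prod>k\<in>UNIV - {i}. card (if k = i then X else Y k)) = (\<Prod>k\<in>UNIV - {i}. L)"
    by (rule prod.cong) (auto simp: assms(3))
  finally show ?thesis by (simp add: card_Diff_singleton)
qed

text \<open>If the shift by \<open>y\<close> moves a lattice point into or out of the cube, one
  coordinate lies in the difference of two slices and all others lie in slices of \<open>L\<close>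
  elements. This gives the order of the surface, \<open>L ^ (n - 1)\<close>; the factor 2 accounts
  for entering and leaving.\<close>

lemma card_cube_boundary:
  fixes y :: "real ^ 'n"
  assumes "finite I"
  shows "real (card {m \<in> I. (lattice_point m + y \<in> cube (real L)) \<noteq> (lattice_point m \<in> cube (real L))}) \<le>
    2 * CARD('n) * (1 + norm y) * real L ^ (CARD('n) - 1)"
proof -
  let ?S = "\<lambda>t. int_slice L t"
  let ?B = "\<lambda>i. {m :: int ^ 'n. \<forall>k. m $ k \<in> (if k = i then ?S 0 - ?S (y $ i) else ?S 0)}"
  let ?B' = "\<lambda>i. {m :: int ^ 'n. \<forall>k. m $ k \<in> (if k = i then ?S (y $ i) - ?S 0 else ?S (y $ k))}"
  let ?D = "{m \<in> I. (lattice_point m + y \<in> cube (real L)) \<noteq> (lattice_point m \<in> cube (real L))}"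
  have c: "card (?B i) = card (?S 0 - ?S (y $ i)) * L ^ (CARD('n) - 1)"
    "card (?B' i) = card (?S (y $ i) - ?S 0) * L ^ (CARD('n) - 1)" for i
    by (rule card_box_slice; simp add: card_int_slice)+
  have fin: "finite (?B i)" "finite (?B' i)" for i
    by (rule finite_vec_box; simp add: card_int_slice)+
  have 0: "lattice_point m \<in> cube (real L) \<longleftrightarrow> (\<forall>i. m $ i \<in> ?S 0)" for m :: "int ^ 'n"
    using lattice_mem_cube[of m 0 L] by simp
  have sub: "?D \<subseteq> (\<Union>i\<in>UNIV. ?B i \<union> ?B' i)"
  proof
    fix m assume m: "m \<in> ?D"
    show "m \<in> (\<Union>i\<in>UNIV. ?B i \<union> ?B' i)"
    proof (cases "\<forall>i. m $ i \<in> ?S 0")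
      case True
      then obtain i where "m $ i \<notin> ?S (y $ i)" using m unfolding mem_Collect_eq lattice_mem_cube 0 by blast
      then have "m \<in> ?B i" using True by simp
      then show ?thesis by blast
    next
      case False
      then have all: "\<forall>i. m $ i \<in> ?S (y $ i)" using m unfolding mem_Collect_eq lattice_mem_cube 0 by blast
      obtain i where "m $ i \<notin> ?S 0" using False by blast
      then have "m \<in> ?B' i" using all by simp
      then show ?thesis by blast
    qed
  qed
  have "card ?D \<le> card (\<Union>i\<in>UNIV. ?B i \<union> ?B' i)"
    by (rule card_mono[OF _ sub]) (intro finite_UN_I finite_UnI fin finite)
  also have "\<dots> \<le> (\<Sum>i\<in>UNIV. card (?B i \<union> ?B' i))" by (rule card_UN_le) simp
  also have "\<dots> \<le> (\<Sum>i\<in>UNIV. card (?B i) + card (?B' i))" by (intro sum_mono card_Un_le)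
  finally have "real (card ?D) \<le> real (\<Sum>i\<in>UNIV. card (?B i) + card (?B' i))" by (rule of_nat_mono)
  also have "\<dots> = (\<Sum>i\<in>UNIV. real (card (?B i)) + real (card (?B' i)))" by simp
  also have "\<dots> \<le> (\<Sum>i\<in>(UNIV :: 'n set). 2 * (1 + norm y) * real L ^ (CARD('n) - 1))"
  proof (rule sum_mono)
    fix i
    have n: "\<bar>y $ i\<bar> + 1 \<le> 1 + norm y" using component_le_norm_cart[of y i] by simp
    have "real (card (?B i)) \<le> (1 + norm y) * real L ^ (CARD('n) - 1)"
      unfolding c of_nat_mult of_nat_power
      by (intro mult_right_mono order_trans[OF card_int_slice_diff(1) n]) simp
    moreover have "real (card (?B' i)) \<le> (1 + norm y) * real L ^ (CARD('n) - 1)"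
      unfolding c of_nat_mult of_nat_power
      by (intro mult_right_mono order_trans[OF card_int_slice_diff(2) n]) simp
    ultimately show "real (card (?B i)) + real (card (?B' i)) \<le> 2 * (1 + norm y) * real L ^ (CARD('n) - 1)"
      by (simp add: distrib_right)
  qed
  finally show ?thesis by (simp add: mult_ac)
qed

text \<open>The coefficient at \<open>m\<close> is the integral of the indicator at
  \<open>y + m\<close> against \<open>cnj (\<phi> y)\<close>. Freezing the indicator at
  \<open>y = 0\<close> gives the main term; the error \<open>?X m\<close> comes only from those
  \<open>y\<close> that carry the lattice point across the boundary. Its sum over \<open>m\<close>
  is the boundary count integrated against \<open>norm (\<phi> y)\<close>, finite by the decay of
  \<open>\<phi>\<close>.\<close>

lemma sum_cube_coefficients_le:
  fixes \<phi> :: "real ^ 'n \<Rightarrow> complex"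
  assumes \<phi>: "\<phi> \<in> schwartz_space"
  shows "\<exists>C. \<forall>L\<ge>1. \<forall>I. finite I \<longrightarrow> (\<forall>\<theta>>0.
    (\<Sum>m\<in>I. (norm (L2_inner (\<lambda>x. indicator (cube (real L)) x) (\<lambda>x. \<phi> (x - lattice_point m))))\<^sup>2) \<le>
    (1 + \<theta>) * (norm (LINT x|lborel. \<phi> x))\<^sup>2 * real L ^ CARD('n) + (1 + 1 / \<theta>) * C * real L ^ (CARD('n) - 1))"
proof -
  let ?n = "CARD('n)"
  have m\<phi> [measurable]: "\<phi> \<in> borel_measurable borel"
    using smooth_borel_measurable[OF schwartz_smooth[OF \<phi>]] by simp
  note i\<phi> = schwartz_integrable[OF \<phi>]
  define c where "c = (LINT x|lborel. \<phi> x)"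
  define M where "M = (LINT x|lborel. norm (\<phi> x))"
  define W where "W = (LINT x|lborel. (1 + norm x) ^ 1 * norm (\<phi> x))"
  have iW: "integrable lborel (\<lambda>x. (1 + norm x) ^ 1 * norm (\<phi> x))"
  proof -
    obtain A where "sbound (1 + 2 * CARD('n)) \<phi> A" by (rule schwartz_sbound[OF \<phi>])
    then show ?thesis by (rule schwartz_integral_bound(1)[OF \<phi>])
  qed
  have M0: "M \<ge> 0" unfolding M_def by simp
  have "(\<Sum>m\<in>I. (norm (L2_inner (\<lambda>x. indicator (cube (real L)) x) (\<lambda>x. \<phi> (x - lattice_point m))))\<^sup>2) \<le>
    (1 + \<theta>) * (norm c)\<^sup>2 * real L ^ ?n + (1 + 1 / \<theta>) * (M * (2 * ?n * W)) * real L ^ (?n - 1)"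
    if I: "finite I" and \<theta>: "\<theta> > 0" for L I \<theta>
  proof -
    let ?F = "\<lambda>x :: real ^ 'n. indicator (cube (real L)) x :: complex"
    let ?a = "\<lambda>m. L2_inner ?F (\<lambda>x. \<phi> (x - lattice_point m))"
    let ?d = "\<lambda>m y. ?F (y + lattice_point m) - ?F (lattice_point m)"
    let ?X = "\<lambda>m. LINT y|lborel. norm (?d m y) * norm (\<phi> y)"
    have Fm [measurable]: "?F \<in> borel_measurable borel" by measurable
    have d1: "norm (?d m y) \<le> 1" for m y by (simp add: indicator_def)
    have iX: "integrable lborel (\<lambda>y. norm (?d m y) * norm (\<phi> y))" for m
    proof (rule Bochner_Integration.integrable_bound[OF i\<phi>])
      show "AE y in lborel. norm (norm (?d m y) * norm (\<phi> y)) \<le> norm (\<phi> y)"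
        using mult_right_mono[OF d1 norm_ge_zero] by (intro AE_I2) (simp add: abs_mult)
    qed measurable
    have XM: "?X m \<le> M" for m
      unfolding M_def
    proof (rule integral_mono[OF iX integrable_norm[OF i\<phi>]])
      show "norm (?d m y) * norm (\<phi> y) \<le> norm (\<phi> y)" for y
        using mult_right_mono[OF d1[of y m] norm_ge_zero[of "\<phi> y"]] by simp
    qed
    have X0: "?X m \<ge> 0" for m by (rule Bochner_Integration.integral_nonneg) simp
    have a: "norm (?a m) \<le> norm (?F (lattice_point m)) * norm c + ?X m" for m
    proof -
      have iF: "integrable lborel (\<lambda>y. ?F (y + lattice_point m) * cnj (\<phi> y))"
        by (rule Bochner_Integration.integrable_bound[OF i\<phi>])
          (measurable, intro AE_I2, simp add: norm_mult indicator_def)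
      have ic: "integrable lborel (\<lambda>y. ?F (lattice_point m) * cnj (\<phi> y))"
        by (intro integrable_mult_right integrable_cnj i\<phi>)
      have "?a m = (LINT y|lborel. ?F (y + lattice_point m) * cnj (\<phi> y))"
        unfolding L2_inner_def
        using integral_lborel_translate(2)[where f = "\<lambda>y. ?F y * cnj (\<phi> (y - lattice_point m))"
          and a = "lattice_point m"] by simp
      also have "\<dots> = (LINT y|lborel. ?F (lattice_point m) * cnj (\<phi> y)) + (LINT y|lborel. ?d m y * cnj (\<phi> y))"
        unfolding left_diff_distrib Bochner_Integration.integral_diff[OF iF ic] by simp
      also have "(LINT y|lborel. ?F (lattice_point m) * cnj (\<phi> y)) = ?F (lattice_point m) * cnj c"
        unfolding c_def by simp
      finally have "norm (?a m) \<le> norm (?F (lattice_point m) * cnj c) + norm (LINT y|lborel. ?d m y * cnj (\<phi> y))"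
        by (simp only: norm_triangle_ineq)
      also have "norm (LINT y|lborel. ?d m y * cnj (\<phi> y)) \<le> (LINT y|lborel. norm (?d m y * cnj (\<phi> y)))"
        by (rule integral_norm_bound)
      finally show ?thesis by (simp only: norm_mult complex_mod_cnj)
    qed
    have "(norm (?a m))\<^sup>2 \<le> (1 + \<theta>) * (norm c)\<^sup>2 * norm (?F (lattice_point m)) + (1 + 1 / \<theta>) * (M * ?X m)" for m
    proof -
      have "(norm (?a m))\<^sup>2 \<le> (norm (?F (lattice_point m)) * norm c + ?X m)\<^sup>2"
        by (intro power_mono a) simp
      also have "\<dots> \<le> (1 + \<theta>) * (norm (?F (lattice_point m)) * norm c)\<^sup>2 + (1 + 1 / \<theta>) * (?X m)\<^sup>2"
        by (rule weighted_square_sum[OF \<theta>])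
      also have "(norm (?F (lattice_point m)) * norm c)\<^sup>2 = (norm c)\<^sup>2 * norm (?F (lattice_point m))"
        by (simp add: indicator_def)
      \<comment> \<open>The uniform bound \<open>?X m \<le> M\<close> trades the square for a linear
        term, whose sum over \<open>m\<close> the boundary count controls.\<close>
      also have "(1 + 1 / \<theta>) * (?X m)\<^sup>2 \<le> (1 + 1 / \<theta>) * (M * ?X m)"
        unfolding power2_eq_square using \<theta> by (intro mult_left_mono mult_right_mono XM X0) simp_all
      finally show ?thesis by (simp add: mult.assoc)
    qed
    then have "(\<Sum>m\<in>I. (norm (?a m))\<^sup>2) \<le>
        (\<Sum>m\<in>I. (1 + \<theta>) * (norm c)\<^sup>2 * norm (?F (lattice_point m)) + (1 + 1 / \<theta>) * (M * ?X m))"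
      by (rule sum_mono)
    also have "\<dots> = (1 + \<theta>) * (norm c)\<^sup>2 * (\<Sum>m\<in>I. norm (?F (lattice_point m))) + (1 + 1 / \<theta>) * (M * (\<Sum>m\<in>I. ?X m))"
      by (simp only: sum.distrib sum_distrib_left)
    also have "\<dots> \<le> (1 + \<theta>) * (norm c)\<^sup>2 * real L ^ ?n + (1 + 1 / \<theta>) * (M * (2 * ?n * W * real L ^ (?n - 1)))"
    proof (intro add_mono mult_left_mono)
      have "(\<Sum>m\<in>I. norm (?F (lattice_point m))) = real (card {m \<in> I. lattice_point m \<in> cube (real L)})"
      proof -
        have "norm (?F (lattice_point m)) = (if lattice_point m \<in> cube (real L) then 1 else 0)" for m
          by (simp add: indicator_def)
        then show ?thesis using I by (simp add: sum.If_cases Int_def conj_commute)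
      qed
      also have "\<dots> \<le> real (card {m :: int ^ 'n. \<forall>i. m $ i \<in> int_slice L 0})"
        using lattice_mem_cube[of _ "0 :: real ^ 'n" L]
        by (intro of_nat_mono card_mono finite_vec_box card_int_slice) auto
      also have "\<dots> = real L ^ ?n" by (subst card_vec_box) (simp_all add: card_int_slice)
      finally show "(\<Sum>m\<in>I. norm (?F (lattice_point m))) \<le> real L ^ ?n" .
      have "(\<Sum>m\<in>I. ?X m) = (LINT y|lborel. (\<Sum>m\<in>I. norm (?d m y) * norm (\<phi> y)))"
        by (rule Bochner_Integration.integral_sum[symmetric]) (rule iX)
      also have "\<dots> \<le> (LINT y|lborel. (2 * ?n * real L ^ (?n - 1)) * ((1 + norm y) ^ 1 * norm (\<phi> y)))"
      proof (rule integral_mono)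
        show "integrable lborel (\<lambda>y. \<Sum>m\<in>I. norm (?d m y) * norm (\<phi> y))" by (intro Bochner_Integration.integrable_sum iX)
        show "integrable lborel (\<lambda>y. (2 * ?n * real L ^ (?n - 1)) * ((1 + norm y) ^ 1 * norm (\<phi> y)))"
          by (intro integrable_mult_right iW)
        fix y :: "real ^ 'n"
        have "(\<Sum>m\<in>I. norm (?d m y)) =
            real (card {m \<in> I. (lattice_point m + y \<in> cube (real L)) \<noteq> (lattice_point m \<in> cube (real L))})"
        proof -
          have "norm (?d m y) = (if (lattice_point m + y \<in> cube (real L)) \<noteq> (lattice_point m \<in> cube (real L)) then 1 else 0)" for m
            by (simp add: indicator_def add.commute)
          then show ?thesis using I by (simp add: sum.If_cases Int_def conj_commute)
        qed
        also have "\<dots> \<le> 2 * ?n * (1 + norm y) * real L ^ (?n - 1)" by (rule card_cube_boundary[OF I])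
        finally have "(\<Sum>m\<in>I. norm (?d m y)) * norm (\<phi> y) \<le> 2 * ?n * (1 + norm y) * real L ^ (?n - 1) * norm (\<phi> y)"
          by (rule mult_right_mono) simp
        then show "(\<Sum>m\<in>I. norm (?d m y) * norm (\<phi> y)) \<le> (2 * ?n * real L ^ (?n - 1)) * ((1 + norm y) ^ 1 * norm (\<phi> y))"
          unfolding sum_distrib_right[symmetric] power_one_right by (simp only: mult_ac)
      qed
      also have "\<dots> = 2 * ?n * W * real L ^ (?n - 1)"
        unfolding W_def by simp
      finally show "(\<Sum>m\<in>I. ?X m) \<le> 2 * ?n * W * real L ^ (?n - 1)" .
    qed (use \<theta> M0 in auto)
    finally show ?thesis by (simp only: mult.assoc)
  qed
  then show ?thesis unfolding c_def[symmetric] by blast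
qed

lemma norm_integral_scaling_function_ge_one:
  fixes \<phi> :: "real ^ 'n \<Rightarrow> complex"
  assumes V: "MRA V" "scaling_function V \<phi>" and \<phi>: "\<phi> \<in> schwartz_space"
  shows "1 \<le> (norm (LINT x|lborel. \<phi> x))\<^sup>2"
proof (rule ccontr)
  let ?n = "CARD('n)"
  define p where "p = (norm (LINT x|lborel. \<phi> x))\<^sup>2"
  assume "\<not> 1 \<le> (norm (LINT x|lborel. \<phi> x))\<^sup>2"
  then have p: "p < 1" by (simp add: p_def)
  \<comment> \<open>With this choice the main term has the factor \<open>(1 + \<theta>) * p = (1 +
    \<theta>) * (1 - \<theta>) = 1 - \<theta>\<^sup>2\<close>. Taking half of
    \<open>\<theta>\<^sup>2\<close> for \<open>\<delta>\<close> leaves a deficit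
    \<open>\<delta> * L ^ n\<close>, too large for the boundary term \<open>K * L ^ (n - 1)\<close>
    once \<open>L > K / \<delta>\<close>.\<close>
  define \<theta> where "\<theta> = 1 - p"
  have \<theta>: "\<theta> > 0" using p by (simp add: \<theta>_def)
  define \<delta> where "\<delta> = \<theta>\<^sup>2 / 2"
  have \<delta>: "\<delta> > 0" using \<theta> by (simp add: \<delta>_def)
  have "(1 + \<theta>) * p = 1 - \<theta>\<^sup>2" by (simp add: \<theta>_def power2_eq_square algebra_simps)
  then have p_eq: "(1 + \<theta>) * p = 1 - 2 * \<delta>" by (simp add: \<delta>_def)
  obtain C where C: "\<And>L I \<theta>. L \<ge> 1 \<Longrightarrow> finite I \<Longrightarrow> \<theta> > 0 \<Longrightarrow>
    (\<Sum>m\<in>I. (norm (L2_inner (\<lambda>x. indicator (cube (real L)) x) (\<lambda>x. \<phi> (x - lattice_point m))))\<^sup>2) \<le>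
    (1 + \<theta>) * p * real L ^ ?n + (1 + 1 / \<theta>) * C * real L ^ (?n - 1)"
    using sum_cube_coefficients_le[OF \<phi>, folded p_def] by (elim exE) metis
  define K where "K = (1 + 1 / \<theta>) * C"
  obtain J0 :: nat where J0: "K / \<delta> < 2 ^ J0" using real_arch_pow[of 2 "K / \<delta>"] by auto
  obtain J I where J: "J \<ge> J0" "finite I" "(1 - \<delta>) * (2 ^ J) ^ ?n \<le>
    (\<Sum>m\<in>I. (norm (L2_inner (\<lambda>x. indicator (cube (2 ^ J)) x) (\<lambda>x. \<phi> (x - lattice_point m))))\<^sup>2)"
    using MRA_cube_approximation[OF V \<delta>, of J0] by (elim exE conjE)
  define L :: real where "L = 2 ^ J"
  have L: "L \<ge> 1" "K / \<delta> < L"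
  proof -
    have "(2 :: real) ^ J0 \<le> 2 ^ J" by (rule power_increasing[OF J(1)]) simp
    with J0 show "K / \<delta> < L" unfolding L_def by (rule less_le_trans)
  qed (simp add: L_def)
  have "(1 - \<delta>) * L ^ ?n \<le> (1 + \<theta>) * p * L ^ ?n + K * L ^ (?n - 1)"
    using order_trans[OF J(3)] C[of "2 ^ J" I \<theta>] J(2) \<theta> unfolding K_def L_def by simp
  then have "\<delta> * L ^ ?n \<le> K * L ^ (?n - 1)" unfolding p_eq by (simp add: algebra_simps)
  moreover have "L ^ ?n = L * L ^ (?n - 1)" by (simp add: power_eq_if)
  ultimately have "(\<delta> * L) * L ^ (?n - 1) \<le> K * L ^ (?n - 1)" by simp
  then have "\<delta> * L \<le> K" using L by (simp add: mult_le_cancel_right)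
  then show False using L(2) \<delta> by (simp add: field_simps)
qed

section \<open>Periodization and the projections\<close>

definition periodization :: "(real ^ 'n \<Rightarrow> complex) \<Rightarrow> real ^ 'n \<Rightarrow> complex" where
  "periodization f x = infsum (\<lambda>m. f (x + lattice_point m)) UNIV"

lemma bij_lattice_translate: "bij (\<lambda>m :: int ^ 'n. m + k)"
  by (rule bij_betwI[where g = "\<lambda>m. m - k"]) auto

text \<open>Invariance under lattice shifts is a reindexing of the unordered sum; the enumeration
  \<open>lattice_enum\<close> is not adapted to shifts.\<close>

lemma infsum_lattice_shift:
  "infsum (\<lambda>m. f (x + lattice_point k + lattice_point m)) UNIV = infsum (\<lambda>m. f (x + lattice_point m)) UNIV"
  using infsum_reindex_bij_betw[OF bij_lattice_translate[of k], of "\<lambda>m. f (x + lattice_point m)"]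
  by (simp add: lattice_point_add add_ac)

lemma periodization_shift: "periodization f (x + lattice_point k) = periodization f x"
  unfolding periodization_def by (rule infsum_lattice_shift)

lemma schwartz_lattice_summable:
  fixes \<phi> :: "real ^ 'n \<Rightarrow> complex"
  assumes "\<phi> \<in> schwartz_space"
  shows "\<exists>K. \<forall>m. norm (\<phi> (x + lattice_point m)) \<le> K * lattice_weight m"
proof -
  obtain A where A: "sbound (0 + 2 * CARD('n)) \<phi> A" by (rule schwartz_sbound[OF assms])
  show ?thesis
    using schwartz_lattice_decay'[OF A component_le_norm_cart, of x] by simp blast
qed

lemma periodization_suminf:
  fixes \<phi> :: "real ^ 'n \<Rightarrow> complex"
  assumes "\<phi> \<in> schwartz_space"
  shows "periodization \<phi> x = (\<Sum>k. \<phi> (x + lattice_point (lattice_enum k)))"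
    and "summable (\<lambda>k. norm (\<phi> (x + lattice_point (lattice_enum k))))"
proof -
  obtain K where K: "\<And>m. norm (\<phi> (x + lattice_point m)) \<le> K * lattice_weight m"
    using schwartz_lattice_summable[OF assms, of x] by (elim exE) (rule that, erule spec)
  show "periodization \<phi> x = (\<Sum>k. \<phi> (x + lattice_point (lattice_enum k)))"
    unfolding periodization_def by (rule infsum_lattice_enum[OF K])
  show "summable (\<lambda>k. norm (\<phi> (x + lattice_point (lattice_enum k))))"
    by (rule lattice_dominated_summable(1)[OF K])
qed

lemma floor_vec_unit_cube: "x - lattice_point (floor_vec x) \<in> unit_cube"
  by (simp add: floor_vec_iff)

text \<open>By periodicity \<open>x\<close> may be moved into the unit cube, where the decay
  estimate is uniform.\<close>

lemma sum_norm_lattice_bounded: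
  fixes \<phi> :: "real ^ 'n \<Rightarrow> complex"
  assumes \<phi>: "\<phi> \<in> schwartz_space"
  shows "\<exists>S. \<forall>x. (\<Sum>k. norm (\<phi> (x + lattice_point (lattice_enum k)))) \<le> S"
proof -
  obtain A where A: "sbound (0 + 2 * CARD('n)) \<phi> A" by (rule schwartz_sbound[OF \<phi>])
  let ?K = "9 ^ CARD('n) * A"
  have "(\<Sum>k. norm (\<phi> (x + lattice_point (lattice_enum k)))) \<le> (\<Sum>k. ?K * lattice_weight (lattice_enum k :: int ^ 'n))" for x
  proof -
    define p where "p = floor_vec x"
    define t where "t = x - lattice_point p"
    have t: "t \<in> unit_cube" unfolding t_def p_def by (rule floor_vec_unit_cube)
    obtain K where K: "\<And>m. norm (\<phi> (x + lattice_point m)) \<le> K * lattice_weight m"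
      using schwartz_lattice_summable[OF \<phi>, of x] by (elim exE) (rule that, erule spec)
    have dom: "norm (\<phi> (t + lattice_point m)) \<le> ?K * lattice_weight m" for m
      using schwartz_lattice_decay[OF A unit_cube_bounded[OF t], of m] by simp
    have "(\<Sum>k. norm (\<phi> (x + lattice_point (lattice_enum k)))) = infsum (\<lambda>m. norm (\<phi> (x + lattice_point m))) UNIV"
      by (rule infsum_lattice_enum[symmetric, where K = K]) (simp add: K)
    also have "\<dots> = infsum (\<lambda>m. norm (\<phi> (t + lattice_point p + lattice_point m))) UNIV"
      by (simp add: t_def)
    also have "\<dots> = infsum (\<lambda>m. norm (\<phi> (t + lattice_point m))) UNIV"
      by (rule infsum_lattice_shift[where f = "\<lambda>x. norm (\<phi> x)"])
    also have "\<dots> = (\<Sum>k. norm (\<phi> (t + lattice_point (lattice_enum k))))"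
      by (rule infsum_lattice_enum[where K = ?K]) (use dom in simp)
    also have "\<dots> \<le> (\<Sum>k. ?K * lattice_weight (lattice_enum k :: int ^ 'n))"
      by (intro suminf_le dom lattice_dominated_summable(1)[OF dom] summable_mult lattice_weight_enum_summable)
    finally show ?thesis .
  qed
  then show ?thesis by blast
qed

text \<open>The points of \<open>S\<close> where \<open>f\<close> differs from \<open>c\<close> form
  an open null set, and a nonempty open set is not negligible.\<close>

lemma AE_eq_on_open_imp_eq:
  fixes f :: "'a::euclidean_space \<Rightarrow> 'b::t1_space"
  assumes "open S" "continuous_on S f" "AE x in lborel. x \<in> S \<longrightarrow> f x = c" "x \<in> S"
  shows "f x = c"
proof (rule ccontr)
  assume "f x \<noteq> c"
  let ?N = "S \<inter> f -` (- {c})"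
  have o: "open ?N" by (rule continuous_open_preimage[OF assms(2,1)]) (simp add: open_Compl)
  have "AE x in lborel. x \<notin> ?N" using assms(3) by eventually_elim auto
  then have "?N \<in> null_sets lborel"
    using o by (subst AE_iff_null_sets) (simp_all add: borel_open)
  then have "negligible ?N" unfolding negligible_iff_null_sets by (rule null_sets_completionI)
  moreover have "?N \<noteq> {}" using assms(4) \<open>f x \<noteq> c\<close> by blast
  ultimately show False using open_not_negligible[OF o] by blast
qed

text \<open>
  Unfolding gives that \<open>P = periodization \<phi>\<close> has mean \<open>c = \<integral>\<phi>\<close> and, by orthonormality, mean square
  \<open>1\<close> over the unit cube. Hence the variance of \<open>P\<close> is \<open>1 - \<bar>c\<bar>\<^sup>2 \<le> 0\<close>.
\<close>

lemma
  fixes \<phi> :: "real ^ 'n \<Rightarrow> complex"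
  assumes \<phi>: "\<phi> \<in> schwartz_space"
    and orth: "\<And>m k. L2_inner (\<lambda>x. \<phi> (x - lattice_point m)) (\<lambda>x. \<phi> (x - lattice_point k)) = (if m = k then 1 else 0)"
    and ge_one: "1 \<le> (norm (LINT x|lborel. \<phi> x))\<^sup>2"
  shows periodization_eq_integral: "periodization \<phi> x = (LINT x|lborel. \<phi> x)"
    and norm_integral_eq_one: "(LINT x|lborel. \<phi> x) * cnj (LINT x|lborel. \<phi> x) = 1"
proof -
  define c where "c = (LINT x|lborel. \<phi> x)"
  let ?l = "\<lambda>k. lattice_point (lattice_enum k :: int ^ 'n)"
  let ?P = "periodization \<phi>"
  let ?Q = "indicator (unit_cube :: (real ^ 'n) set) :: real ^ 'n \<Rightarrow> real"
  have m\<phi> [measurable]: "\<phi> \<in> borel_measurable borel"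
    using smooth_borel_measurable[OF schwartz_smooth[OF \<phi>]] by simp
  obtain A where A: "sbound (0 + 2 * CARD('n)) \<phi> A" by (rule schwartz_sbound[OF \<phi>])
  let ?K = "9 ^ CARD('n) * A"
  have dom2: "norm (\<phi> (x + lattice_point m)) \<le> ?K * lattice_weight m" if "\<And>i. \<bar>x $ i\<bar> \<le> 2" for x m
    using schwartz_lattice_decay[OF A that, of m] by simp
  have dom: "norm (\<phi> (x + lattice_point m)) \<le> ?K * lattice_weight m" if "x \<in> unit_cube" for x m
    by (rule dom2[OF unit_cube_bounded[OF that]])
  obtain S where S: "\<And>x. (\<Sum>k. norm (\<phi> (x + ?l k))) \<le> S"
    using sum_norm_lattice_bounded[OF \<phi>] by (elim exE) (rule that, erule spec)
  note P = periodization_suminf(1)[OF \<phi>] and sm = periodization_suminf(2)[OF \<phi>]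
  have Pb: "norm (?P x) \<le> S" for x
    unfolding P by (rule order_trans[OF summable_norm[OF sm] S])
  have Pm [measurable]: "?P \<in> borel_measurable borel"
    unfolding P[abs_def] by measurable
  have I1: "c = (LINT x|lborel. ?Q x *\<^sub>R ?P x)"
    unfolding P c_def by (rule integral_unfold_lattice(2)[where f = \<phi> and K = ?K]) (auto intro: dom)
  have I2: "(LINT x|lborel. \<phi> x * cnj (?P x)) = (LINT x|lborel. ?Q x *\<^sub>R (?P x * cnj (?P x)))"
  proof -
    have "norm (\<phi> (x + lattice_point m) * cnj (?P (x + lattice_point m))) \<le> (?K * S) * lattice_weight m"
      if "x \<in> unit_cube" for x m
    proof -
      have "norm (\<phi> (x + lattice_point m)) * norm (?P (x + lattice_point m)) \<le> (?K * lattice_weight m) * S"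
        by (rule mult_mono[OF dom[OF that] Pb]) (rule order_trans[OF norm_ge_zero dom[OF that]], simp)
      then show ?thesis by (simp add: norm_mult mult_ac)
    qed
    then have "(LINT x|lborel. \<phi> x * cnj (?P x)) =
        (LINT x|lborel. ?Q x *\<^sub>R (\<Sum>k. \<phi> (x + ?l k) * cnj (?P (x + ?l k))))"
      by (intro integral_unfold_lattice(2)[where K = "?K * S"]) auto
    also have "(\<lambda>x. \<Sum>k. \<phi> (x + ?l k) * cnj (?P (x + ?l k))) = (\<lambda>x. ?P x * cnj (?P x))"
    proof
      fix x
      have "(\<Sum>k. \<phi> (x + ?l k) * cnj (?P (x + ?l k))) = (\<Sum>k. \<phi> (x + ?l k)) * cnj (?P x)"
        unfolding periodization_shift by (rule suminf_mult2[symmetric, OF summable_norm_cancel[OF sm]])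
      then show "(\<Sum>k. \<phi> (x + ?l k) * cnj (?P (x + ?l k))) = ?P x * cnj (?P x)" by (simp only: P)
    qed
    finally show ?thesis .
  qed
  \<comment> \<open>Integrated term by term, the term of index \<open>m\<close> is the inner product
    of \<open>\<phi>\<close> with its translate by \<open>- m\<close>; orthonormality leaves only
    \<open>m = 0\<close>.\<close>
  have I3: "(LINT x|lborel. \<phi> x * cnj (?P x)) = 1"
  proof -
    let ?f = "\<lambda>k x. \<phi> x * cnj (\<phi> (x + ?l k))"
    have f_le: "norm (?f k x) \<le> norm (\<phi> x) * A" for k x
      using sbound_norm_le'[OF A, of "[]"] by (auto simp: norm_mult intro!: mult_left_mono)
    have fi: "integrable lborel (?f k)" for k
    proof (rule Bochner_Integration.integrable_bound)
      show "integrable lborel (\<lambda>x. norm (\<phi> x) * A)" using schwartz_integrable[OF \<phi>] by simp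
      show "AE x in lborel. norm (?f k x) \<le> norm (norm (\<phi> x) * A)"
        by (intro AE_I2 order_trans[OF f_le]) simp
    qed measurable
    have fs: "summable (\<lambda>k. norm (?f k x))" for x
      unfolding norm_mult complex_mod_cnj by (rule summable_mult[OF sm])
    have fn: "summable (\<lambda>k. LINT x|lborel. norm (?f k x))"
    proof (rule summableI_nonneg_bounded)
      fix n
      have "(\<Sum>k<n. LINT x|lborel. norm (?f k x)) = (LINT x|lborel. (\<Sum>k<n. norm (?f k x)))"
        by (rule Bochner_Integration.integral_sum[symmetric]) (rule integrable_norm[OF fi])
      also have "\<dots> \<le> (LINT x|lborel. norm (\<phi> x) * S)"
      proof (rule integral_mono)
        show "integrable lborel (\<lambda>x. \<Sum>k<n. norm (?f k x))"
          by (intro Bochner_Integration.integrable_sum integrable_norm fi)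
        show "integrable lborel (\<lambda>x. norm (\<phi> x) * S)" using schwartz_integrable[OF \<phi>] by simp
        fix x
        have "(\<Sum>k<n. norm (\<phi> (x + ?l k))) \<le> S"
          by (rule order_trans[OF sum_le_suminf[OF sm] S]) auto
        then have "norm (\<phi> x) * (\<Sum>k<n. norm (\<phi> (x + ?l k))) \<le> norm (\<phi> x) * S"
          by (rule mult_left_mono) simp
        then show "(\<Sum>k<n. norm (?f k x)) \<le> norm (\<phi> x) * S"
          by (simp only: norm_mult complex_mod_cnj sum_distrib_left)
      qed
      finally show "(\<Sum>k<n. LINT x|lborel. norm (?f k x)) \<le> (LINT x|lborel. norm (\<phi> x) * S)" .
    qed simp
    have fint: "(LINT x|lborel. ?f k x) = (if lattice_enum k = (0 :: int ^ 'n) then 1 else 0)" for k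
      using orth[of 0 "- lattice_enum k"] unfolding L2_inner_def
      by (simp add: lattice_point_minus eq_commute[of 0])
    obtain k0 where k0: "(0 :: int ^ 'n) = lattice_enum k0" by (rule lattice_enum_cases)
    have "\<phi> x * cnj (?P x) = (\<Sum>k. ?f k x)" for x
    proof -
      have "cnj (?P x) = (\<Sum>k. cnj (\<phi> (x + ?l k)))"
        unfolding P by (rule bounded_linear.suminf[OF bounded_linear_cnj summable_norm_cancel[OF sm]])
      then show ?thesis
        using suminf_mult[OF bounded_linear.summable[OF bounded_linear_cnj summable_norm_cancel[OF sm]], of "\<phi> x" x] by simp
    qed
    then have "(LINT x|lborel. \<phi> x * cnj (?P x)) = (LINT x|lborel. (\<Sum>k. ?f k x))" by (simp only:)
    also have "\<dots> = (\<Sum>k. LINT x|lborel. ?f k x)"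
      by (rule integral_suminf[OF fi AE_I2[OF fs] fn])
    also have "\<dots> = (\<Sum>k. if k = k0 then 1 else 0)"
      unfolding fint unfolding k0 lattice_enum_inj ..
    also have "\<dots> = 1" using sums_single[of k0 "\<lambda>_. 1 :: complex"] by (simp add: sums_iff)
    finally show ?thesis .
  qed
  let ?R = "\<lambda>x. ?Q x *\<^sub>R ?P x" and ?R2 = "\<lambda>x. ?Q x *\<^sub>R (?P x * cnj (?P x))"
  have iR: "integrable lborel ?R"
    by (rule integrable_unit_cube_bounded(1)[where B = S]) (simp_all add: Pb)
  have iR2: "integrable lborel ?R2"
  proof (rule integrable_unit_cube_bounded(1)[where B = "S * S"])
    show "norm (?P x * cnj (?P x)) \<le> S * S" for x
      unfolding norm_mult complex_mod_cnj
      by (intro mult_mono Pb norm_ge_zero order_trans[OF norm_ge_zero Pb])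
  qed measurable
  have iQ: "integrable lborel (\<lambda>x. of_real (?Q x) :: complex)" by (intro integrable_of_real) simp
  have var: "of_real (LINT x|lborel. ?Q x * (norm (?P x - c))\<^sup>2) = 1 - c * cnj c"
  proof -
    have "of_real (LINT x|lborel. ?Q x * (norm (?P x - c))\<^sup>2) =
        (LINT x|lborel. complex_of_real (?Q x * (norm (?P x - c))\<^sup>2))"
      by (rule integral_complex_of_real[symmetric])
    also have "\<dots> = (LINT x|lborel. ?R2 x - cnj c * ?R x - c * cnj (?R x) + (c * cnj c) * of_real (?Q x))"
    proof (rule Bochner_Integration.integral_cong[OF refl])
      fix x
      have "of_real ((norm (?P x - c))\<^sup>2) = ?P x * cnj (?P x) - cnj c * ?P x - c * cnj (?P x) + c * cnj c"
        unfolding complex_norm_square by (simp add: algebra_simps)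
      then show "complex_of_real (?Q x * (norm (?P x - c))\<^sup>2) =
          ?R2 x - cnj c * ?R x - c * cnj (?R x) + (c * cnj c) * of_real (?Q x)"
        by (simp add: indicator_def)
    qed
    also have "\<dots> = (LINT x|lborel. ?R2 x) - cnj c * (LINT x|lborel. ?R x) - c * cnj (LINT x|lborel. ?R x) +
        (c * cnj c) * of_real (LINT x|lborel. ?Q x)"
    proof -
      have "integrable lborel (\<lambda>x. cnj c * ?R x)" "integrable lborel (\<lambda>x. c * cnj (?R x))"
        "integrable lborel (\<lambda>x. (c * cnj c) * complex_of_real (?Q x))"
        by (intro integrable_mult_right integrable_cnj iR iQ)+
      then show ?thesis
        using iR2 by (simp only: Bochner_Integration.integral_add Bochner_Integration.integral_diff
            Bochner_Integration.integrable_add Bochner_Integration.integrable_diff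
            integral_mult_right_zero Bochner_Integration.integral_cnj integral_complex_of_real)
    qed
    also have "\<dots> = 1 - cnj c * c - c * cnj c + c * cnj c"
      unfolding I1[symmetric] I2[symmetric] I3 by simp
    finally show ?thesis by simp
  qed
  have sq: "c * cnj c = of_real ((norm c)\<^sup>2)" by (rule complex_norm_square[symmetric])
  have var': "(LINT x|lborel. ?Q x * (norm (?P x - c))\<^sup>2) = 1 - (norm c)\<^sup>2"
  proof -
    have "complex_of_real (LINT x|lborel. ?Q x * (norm (?P x - c))\<^sup>2) = of_real (1 - (norm c)\<^sup>2)"
      using var unfolding sq by (simp only: of_real_diff of_real_1)
    then show ?thesis by (simp only: of_real_eq_iff)
  qed
  have nonneg: "0 \<le> (LINT x|lborel. ?Q x * (norm (?P x - c))\<^sup>2)"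
    by (rule Bochner_Integration.integral_nonneg) simp
  have c1: "(norm c)\<^sup>2 = 1" using ge_one[folded c_def] nonneg[unfolded var'] by simp
  then show "(LINT x|lborel. \<phi> x) * cnj (LINT x|lborel. \<phi> x) = 1"
    unfolding c_def[symmetric] sq by simp
  have iV: "integrable lborel (\<lambda>x. ?Q x *\<^sub>R (norm (?P x - c))\<^sup>2)"
  proof (rule integrable_unit_cube_bounded(1)[where B = "(S + norm c)\<^sup>2"])
    show "norm ((norm (?P x - c))\<^sup>2) \<le> (S + norm c)\<^sup>2" for x
      using Pb[of x] norm_triangle_ineq4[of "?P x" c] by (simp add: power_mono)
  qed measurable
  have "AE x in lborel. ?Q x *\<^sub>R (norm (?P x - c))\<^sup>2 = 0"
    using integral_nonneg_eq_0_iff_AE[OF iV] var' c1 by simp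
  then have ae: "AE x in lborel. x \<in> box 0 1 \<longrightarrow> ?P x = c"
  proof eventually_elim
    case (elim x)
    show ?case
    proof
      assume "x \<in> box 0 1"
      then have "x \<in> unit_cube" by (auto simp: unit_cube_def mem_box_cart less_imp_le)
      then show "?P x = c" using elim by simp
    qed
  qed
  \<comment> \<open>Vanishing variance gives equality only almost everywhere. Continuity on a set
    around the closed cube upgrades it to the open box and then to the faces; periodicity does the
    rest.\<close>
  let ?U = "{x :: real ^ 'n. \<forall>i. \<bar>x $ i\<bar> \<le> 2}"
  have "uniform_limit ?U (\<lambda>n x. \<Sum>k<n. \<phi> (x + ?l k)) (\<lambda>x. \<Sum>k. \<phi> (x + ?l k)) sequentially"
    by (rule Weierstrass_m_test[OF _ summable_mult[OF lattice_weight_enum_summable]]) (use dom2 in auto)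
  then have cont: "continuous_on ?U ?P"
    unfolding P[abs_def]
    by (rule uniform_limit_theorem[rotated])
      (auto intro!: always_eventually continuous_on_sum continuous_on_compose2[OF smooth_continuous[OF schwartz_smooth[OF \<phi>], of UNIV]]
        continuous_intros)
  have cb: "cbox 0 1 \<subseteq> ?U"
  proof
    fix x :: "real ^ 'n" assume "x \<in> cbox 0 1"
    then have "\<bar>x $ i\<bar> \<le> 1" for i by (simp add: mem_box_cart)
    then have "\<bar>x $ i\<bar> \<le> 2" for i by (rule order_trans) simp
    then show "x \<in> ?U" by simp
  qed
  have Pbox: "?P x = c" if "x \<in> box 0 1" for x
    by (rule AE_eq_on_open_imp_eq[OF open_box continuous_on_subset[OF cont] ae that])
      (rule order_trans[OF box_subset_cbox cb])
  have cl: "closure (box 0 1) = (cbox 0 1 :: (real ^ 'n) set)"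
  proof (rule closure_box)
    have "(1 / 2) *\<^sub>R (1 :: real ^ 'n) \<in> box 0 1" by (simp add: mem_box_cart)
    then show "box 0 1 \<noteq> ({} :: (real ^ 'n) set)" by blast
  qed
  have Pc: "?P x = c" if "x \<in> cbox 0 1" for x
  proof (rule continuous_constant_on_closure[where S = "box 0 1" and f = ?P])
    show "continuous_on (closure (box 0 1)) ?P" unfolding cl by (rule continuous_on_subset[OF cont cb])
    show "x \<in> closure (box 0 1)" unfolding cl by (rule that)
  qed (rule Pbox)
  define t where "t = x - lattice_point (floor_vec x)"
  have "t \<in> cbox 0 1"
    using floor_vec_unit_cube[of x] unfolding t_def[symmetric] by (auto simp: unit_cube_def mem_box_cart less_imp_le)
  then have "?P t = c" by (rule Pc)
  then show "?P x = (LINT x|lborel. \<phi> x)"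
    using periodization_shift[of \<phi> t "floor_vec x"] unfolding c_def[symmetric] by (simp add: t_def)
qed

text \<open>Mean value estimate on \<open>cball z R\<close>, which contains the translates of
  \<open>z\<close> by \<open>a\<close> and \<open>b\<close>. It consumes one more derivative, hence
  \<open>Suc N\<close>. Moving the weight from a point of the ball to \<open>z\<close> costs
  \<open>(1 + R) ^ N\<close>, and summing over the partial derivatives costs
  \<open>CARD('n)\<close>.\<close>

lemma sbound_translate_diff:
  fixes h :: "real ^ 'n \<Rightarrow> complex" and A R :: real
  assumes h: "smooth h" "sbound (Suc N) h A" and ab: "norm a \<le> R" "norm b \<le> R"
  shows "sbound N (\<lambda>z. h (a + 1 *\<^sub>R z) - h (b + 1 *\<^sub>R z)) (CARD('n) * A * (1 + R) ^ N * norm (a - b))"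
proof (rule sboundI)
  fix "is" :: "'n list" and z :: "real ^ 'n"
  assume l: "length is \<le> N"
  let ?f = "partial_derivs is h"
  let ?D = "\<lambda>w v. \<Sum>i\<in>UNIV. of_real (v $ i) * partial_deriv i ?f w"
  let ?B = "CARD('n) * (A * (1 + R) ^ N / (1 + norm z) ^ N)"
  have A: "0 \<le> A" by (rule sbound_nonneg[OF h(2)])
  have R: "0 \<le> R" using ab(1) norm_ge_zero order_trans by blast
  have bd: "norm (partial_deriv i ?f w) \<le> A * (1 + R) ^ N / (1 + norm z) ^ N" if w: "w \<in> cball z R" for i w
  proof -
    have pos: "0 < 1 + norm w" "0 < 1 + norm z" by (simp_all add: add_pos_nonneg)
    have "norm z \<le> norm w + R" using w norm_triangle_sub[of z w] by (simp add: dist_norm)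
    also have "\<dots> \<le> norm w + R + R * norm w" using R by simp
    finally have "1 + norm z \<le> (1 + R) * (1 + norm w)" by (simp add: algebra_simps)
    then have "(1 + norm z) ^ N \<le> ((1 + R) * (1 + norm w)) ^ N" using pos by (intro power_mono) auto
    also have "\<dots> = (1 + R) ^ N * (1 + norm w) ^ N" by (rule power_mult_distrib)
    also have "\<dots> \<le> (1 + R) ^ N * (1 + norm w) ^ Suc N"
      using R by (intro mult_left_mono power_increasing) auto
    finally have 1: "(1 + norm z) ^ N \<le> (1 + R) ^ N * (1 + norm w) ^ Suc N" .
    have "norm (partial_derivs (i # is) h w) \<le> A / (1 + norm w) ^ Suc N"
      by (rule sbound_norm_le[OF h(2)]) (use l in simp)
    also have "\<dots> \<le> A * (1 + R) ^ N / (1 + norm z) ^ N"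
      using mult_left_mono[OF 1 A] pos by (simp add: divide_simps mult_ac del: power_Suc)
    finally show ?thesis by simp
  qed
  have "norm (?f (a + z) - ?f (b + z)) \<le> ?B * norm ((a + z) - (b + z))"
  proof (rule differentiable_bound[of "cball z R" ?f ?D])
    fix w assume w: "w \<in> cball z R"
    show "(?f has_derivative ?D w) (at w within cball z R)"
      by (rule has_derivative_at_withinI[OF has_derivative_partial_deriv[OF smoothD[OF h(1)]]])
    show "onorm (?D w) \<le> ?B"
    proof (rule onorm_le)
      fix v :: "real ^ 'n"
      have "norm (?D w v) \<le> (\<Sum>i\<in>(UNIV::'n set). norm v * (A * (1 + R) ^ N / (1 + norm z) ^ N))"
      proof (rule sum_norm_le)
        fix i :: 'n
        show "norm (of_real (v $ i) * partial_deriv i ?f w) \<le> norm v * (A * (1 + R) ^ N / (1 + norm z) ^ N)"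
          unfolding norm_mult norm_of_real
          by (rule mult_mono[OF component_le_norm_cart bd[OF w]]) auto
      qed
      then show "norm (?D w v) \<le> ?B * norm v" by (simp add: mult_ac)
    qed
  qed (use ab in \<open>auto simp: dist_norm\<close>)
  then have "norm (?f (a + z) - ?f (b + z)) \<le> ?B * norm (a - b)" by simp
  then have "(1 + norm z) ^ N * norm (?f (a + z) - ?f (b + z)) \<le> (1 + norm z) ^ N * (?B * norm (a - b))"
    by (rule mult_left_mono) simp
  also have "\<dots> = CARD('n) * A * (1 + R) ^ N * norm (a - b)"
    by (simp add: add_nonneg_eq_0_iff)
  finally have "(1 + norm z) ^ N * norm (?f (a + z) - ?f (b + z)) \<le> CARD('n) * A * (1 + R) ^ N * norm (a - b)" .
  moreover have "partial_derivs is (\<lambda>z. h (a + 1 *\<^sub>R z) - h (b + 1 *\<^sub>R z)) z = ?f (a + z) - ?f (b + z)"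
    unfolding partial_derivs_diff[OF smooth_affine[OF h(1)] smooth_affine[OF h(1)]] partial_derivs_affine[OF h(1)]
    by simp
  ultimately show "(1 + norm z) ^ N * norm (partial_derivs is (\<lambda>z. h (a + 1 *\<^sub>R z) - h (b + 1 *\<^sub>R z)) z) \<le>
      CARD('n) * A * (1 + R) ^ N * norm (a - b)" by (simp only:)
qed

text \<open>Equicontinuity upgrades pointwise convergence to convergence that is uniform on the compact
  set of translates by vectors of norm at most \<open>R\<close>.\<close>

lemma equicontinuous_translates_tendsto_zero:
  fixes U :: "nat \<Rightarrow> (real ^ 'n \<Rightarrow> complex) \<Rightarrow> complex"
  assumes U: "\<And>j. schwartz_functional (U j)"
    and equicont: "\<And>j \<psi> A. \<psi> \<in> schwartz_space \<Longrightarrow> sbound N \<psi> A \<Longrightarrow> norm (U j \<psi>) \<le> C * A" and "C > 0"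
    and lim: "\<And>\<psi>. \<psi> \<in> schwartz_space \<Longrightarrow> (\<lambda>j. U j \<psi>) \<longlonglongrightarrow> 0"
    and h: "h \<in> schwartz_space" and s: "\<And>j. norm (s j) \<le> R"
  shows "(\<lambda>j. U j (\<lambda>z. h (s j + 1 *\<^sub>R z))) \<longlonglongrightarrow> 0"
proof (rule tendstoI)
  fix e :: real assume e: "e > 0"
  obtain A where A: "sbound (Suc N) h A" "A > 0" by (rule schwartz_sbound[OF h])
  let ?g = "\<lambda>a z. h (a + 1 *\<^sub>R z)"
  have g: "?g a \<in> schwartz_space" for a by (rule schwartz_affine[OF h]) simp
  have R: "R \<ge> 0" by (rule order_trans[OF norm_ge_zero s])
  \<comment> \<open>A Lipschitz constant, uniform in \<open>j\<close>, for the value of the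
    functional as a function of the translation vector; balls of radius \<open>e / (2 * D)\<close>
    therefore leave an error below \<open>e / 2\<close>.\<close>
  define D where "D = C * (CARD('n) * A * (1 + R) ^ N)"
  have D: "D > 0" using A(2) \<open>C > 0\<close> R by (simp add: D_def)
  have cover: "cball 0 R \<subseteq> (\<Union>b\<in>cball (0 :: real ^ 'n) R. ball b (e / (2 * D)))"
  proof
    fix b :: "real ^ 'n" assume "b \<in> cball 0 R"
    moreover have "b \<in> ball b (e / (2 * D))" using e D by simp
    ultimately show "b \<in> (\<Union>b\<in>cball 0 R. ball b (e / (2 * D)))" by (rule UN_I)
  qed
  obtain F where F: "F \<subseteq> cball (0 :: real ^ 'n) R" "finite F"
      "cball 0 R \<subseteq> (\<Union>b\<in>F. ball b (e / (2 * D)))"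
    by (rule compactE_image[where S = "cball 0 R" and f = "\<lambda>b. ball b (e / (2 * D))", OF compact_cball _ cover]) auto
  have "eventually (\<lambda>j. \<forall>b\<in>F. norm (U j (?g b)) < e / 2) sequentially"
    using tendstoD[OF lim[OF g] half_gt_zero[OF e]] unfolding dist_norm diff_zero
    by (intro eventually_ball_finite F(2) ballI)
  then show "eventually (\<lambda>j. dist (U j (?g (s j))) 0 < e) sequentially"
  proof eventually_elim
    case (elim j)
    interpret schwartz_functional "U j" by (rule U)
    have "s j \<in> cball 0 R" using s by simp
    then obtain b where b: "b \<in> F" "s j \<in> ball b (e / (2 * D))" using F(3) by blast
    then have bR: "norm b \<le> R" using F(1) by auto
    have "norm (U j (\<lambda>z. ?g (s j) z - ?g b z)) \<le> C * (CARD('n) * A * (1 + R) ^ N * norm (s j - b))"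
      by (rule equicont[OF schwartz_diff[OF g g] sbound_translate_diff[OF schwartz_smooth[OF h] A(1) s bR]])
    also have "\<dots> = D * norm (s j - b)" by (simp add: D_def)
    also have "\<dots> < D * (e / (2 * D))"
      using b(2) D by (intro mult_strict_left_mono) (simp_all add: dist_norm norm_minus_commute)
    also have "\<dots> = e / 2" using D by simp
    finally have 1: "norm (U j (?g (s j)) - U j (?g b)) < e / 2" by (simp only: diff[OF g g])
    have 2: "norm (U j (?g b)) < e / 2" using elim b(1) by blast
    have "norm (U j (?g (s j))) \<le> norm (U j (?g (s j)) - U j (?g b)) + norm (U j (?g b))"
      using norm_triangle_ineq[of "U j (?g (s j)) - U j (?g b)" "U j (?g b)"] by simp
    then show ?case using 1 2 by simp
  qed
qed

section \<open>The point value along dyadic scales, and the kernel expansion\<close>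

lemma dilated_integral:
  fixes \<psi> :: "real ^ 'n \<Rightarrow> complex"
  assumes "\<psi> \<in> schwartz_space"
  shows "dilated (\<lambda>\<psi>. LINT x|lborel. \<psi> x) x0 j \<psi> = (LINT x|lborel. \<psi> x)"
proof -
  have m: "\<psi> \<in> borel_measurable lborel" by (rule smooth_borel_measurable[OF schwartz_smooth[OF assms]])
  then have [measurable]: "\<psi> \<in> borel_measurable borel" by simp
  have "(\<lambda>y. \<psi> (2 ^ j *\<^sub>R (y - x0))) \<in> borel_measurable lborel" by measurable
  from integral_lborel_translate(2)[OF this, of x0]
  have "(LINT y|lborel. \<psi> (2 ^ j *\<^sub>R (y - x0))) = (LINT y|lborel. \<psi> (2 ^ j *\<^sub>R y))" by simp
  moreover have "(LINT x|lborel. \<psi> x) = (2 ^ j) ^ CARD('n) *\<^sub>R (LINT x|lborel. \<psi> (2 ^ j *\<^sub>R x))"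
    by (rule integral_lborel_scale(2)[OF m]) simp
  ultimately show ?thesis
    by (simp add: dilated_def scaleR_conv_of_real power_mult[symmetric] mult.commute)
qed

lemma schwartz_functional_diff_cmult:
  assumes "schwartz_functional T" "schwartz_functional I"
  shows "schwartz_functional (\<lambda>\<psi>. T \<psi> - \<gamma> * I \<psi>)"
proof
  interpret T: schwartz_functional T by fact
  interpret I: schwartz_functional I by fact
  show "T (\<lambda>x. f x + g x) - \<gamma> * I (\<lambda>x. f x + g x) = (T f - \<gamma> * I f) + (T g - \<gamma> * I g)"
    if "f \<in> schwartz_space" "g \<in> schwartz_space" for f g
    unfolding T.add[OF that] I.add[OF that] by (simp add: algebra_simps)
  show "T (\<lambda>x. c * f x) - \<gamma> * I (\<lambda>x. c * f x) = c * (T f - \<gamma> * I f)" if "f \<in> schwartz_space" for f c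
    unfolding T.cmult[OF that] I.cmult[OF that] by (simp add: algebra_simps)
  obtain N C where T: "C > 0" "\<And>f A. f \<in> schwartz_space \<Longrightarrow> sbound N f A \<Longrightarrow> norm (T f) \<le> C * A"
    by (rule T.bound) blast
  obtain M D where I: "D > 0" "\<And>f A. f \<in> schwartz_space \<Longrightarrow> sbound M f A \<Longrightarrow> norm (I f) \<le> D * A"
    by (rule I.bound) blast
  have "norm (T f - \<gamma> * I f) \<le> (C + norm \<gamma> * D) * A"
    if f: "f \<in> schwartz_space" and A: "sbound (max N M) f A" for f A
  proof -
    have "norm (T f - \<gamma> * I f) \<le> norm (T f) + norm \<gamma> * norm (I f)"
      using norm_triangle_ineq4[of "T f" "\<gamma> * I f"] by (simp add: norm_mult)
    also have "\<dots> \<le> C * A + norm \<gamma> * (D * A)"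
      by (intro add_mono mult_left_mono T(2) I(2) f sbound_order_mono[OF A]) auto
    finally show ?thesis by (simp add: algebra_simps)
  qed
  then show "\<exists>N C. \<forall>f\<in>schwartz_space. \<forall>A. sbound N f A \<longrightarrow> norm (T f - \<gamma> * I f) \<le> C * A" by blast
qed

lemma test_functions_in_ball_compact:
  assumes "\<psi> \<in> test_functions_in_ball R"
  shows "\<psi> \<in> compact_test_functions"
proof -
  have "{x. \<psi> x \<noteq> 0} \<subseteq> cball 0 R"
    using assms by (force simp: test_functions_in_ball_def not_less[symmetric])
  then have "bounded {x. \<psi> x \<noteq> 0}" by (rule bounded_subset[OF bounded_cball])
  then show ?thesis
    using assms by (simp add: compact_test_functions_def test_functions_in_ball_def)
qed

lemma point_value_dilated:
  fixes T :: "(real ^ 'n \<Rightarrow> complex) \<Rightarrow> complex"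
  assumes "has_point_value T x0 \<gamma>" "\<psi> \<in> test_functions_in_ball R"
  shows "(\<lambda>j. dilated T x0 j \<psi>) \<longlonglongrightarrow> \<gamma> * (LINT x|lborel. \<psi> x)"
proof -
  have lim: "((\<lambda>\<epsilon>::real. of_real (1 / \<bar>\<epsilon>\<bar> ^ CARD('n)) * T (\<lambda>y. \<psi> ((1 / \<epsilon>) *\<^sub>R (y - x0))))
      \<longlongrightarrow> \<gamma> * (LINT x|lborel. \<psi> x)) (at 0)"
    using assms(1) test_functions_in_ball_compact[OF assms(2)] unfolding has_point_value_def by (rule bspec)
  have "filterlim (\<lambda>j. (1 / 2) ^ j :: real) (at 0) sequentially"
    unfolding filterlim_at by (auto intro!: LIMSEQ_realpow_zero)
  from filterlim_compose[OF lim this]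
  show ?thesis
    by (simp add: dilated_def power_one_over power_mult[symmetric] mult.commute)
qed

text \<open>The index \<open>m\<close> becomes \<open>floor_vec X - m\<close>. The base point then
  lies in the unit cube, where the lattice estimates are uniform; the translates appear with a plus
  sign as in \<open>periodization\<close>; and \<open>Y\<close> enters only through
  \<open>Y - X\<close>, the form that \<open>dilated\<close> expects.\<close>

lemma MRA_kernel0_expansion:
  fixes \<phi> :: "real ^ 'n \<Rightarrow> complex" and X Y :: "real ^ 'n"
  assumes \<phi>: "\<phi> \<in> schwartz_space"
  defines "t \<equiv> X - lattice_point (floor_vec X)"
  shows "MRA_kernel0 \<phi> X Y = (\<Sum>k. \<phi> (t + lattice_point (lattice_enum k)) *
    cnj (\<phi> (t + lattice_point (lattice_enum k) + (Y - X))))"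
proof -
  let ?p = "floor_vec X"
  obtain A where A: "sbound (0 + 2 * CARD('n)) \<phi> A" "A > 0" by (rule schwartz_sbound[OF \<phi>])
  have lat: "X - lattice_point (?p - m) = t + lattice_point m" for m by (simp add: t_def vec_eq_iff)
  have lat': "Y - lattice_point (?p - m) = t + lattice_point m + (Y - X)" for m by (simp add: t_def vec_eq_iff)
  have "bij (\<lambda>m :: int ^ 'n. ?p - m)" by (rule bij_betwI[where g = "\<lambda>m. ?p - m"]) auto
  from infsum_reindex_bij_betw[OF this, of "\<lambda>m. \<phi> (X - lattice_point m) * cnj (\<phi> (Y - lattice_point m))"]
  have "MRA_kernel0 \<phi> X Y = infsum (\<lambda>m. \<phi> (t + lattice_point m) * cnj (\<phi> (t + lattice_point m + (Y - X)))) UNIV"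
    unfolding MRA_kernel0_def lat lat' ..
  also have "\<dots> = (\<Sum>k. \<phi> (t + lattice_point (lattice_enum k)) * cnj (\<phi> (t + lattice_point (lattice_enum k) + (Y - X))))"
  proof (rule infsum_lattice_enum[where K = "9 ^ CARD('n) * A * A"])
    fix m
    have "norm (\<phi> (t + lattice_point m)) \<le> 9 ^ CARD('n) * A * lattice_weight m"
      using schwartz_lattice_decay[OF A(1) unit_cube_bounded[OF floor_vec_unit_cube], of X m] by (simp add: t_def)
    moreover have "norm (\<phi> (t + lattice_point m + (Y - X))) \<le> A"
      using sbound_norm_le'[OF A(1), of "[]"] by simp
    ultimately have "norm (\<phi> (t + lattice_point m)) * norm (\<phi> (t + lattice_point m + (Y - X))) \<le>
        (9 ^ CARD('n) * A * lattice_weight m) * A"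
      using A(2) by (intro mult_mono) (auto intro!: mult_nonneg_nonneg lattice_weight_nonneg)
    then show "norm (\<phi> (t + lattice_point m) * cnj (\<phi> (t + lattice_point m + (Y - X)))) \<le>
        9 ^ CARD('n) * A * A * lattice_weight m"
      by (simp add: norm_mult mult_ac)
  qed
  finally show ?thesis .
qed

lemma sbound_translate:
  assumes "smooth f" "sbound N f A"
  shows "sbound N (\<lambda>z. f (a + 1 *\<^sub>R z)) ((1 + norm a) ^ N * A)"
  using sbound_affine[OF assms, of 1 a] by simp

text \<open>The kernel series converges in the Schwartz space, not only pointwise, and so passes
  through the functional. Translation by \<open>?\<tau> k\<close> costs a factor
  \<open>(1 + norm (?\<tau> k)) ^ N\<close> in the norm of order \<open>N\<close>, which the rapidly
  decreasing coefficient \<open>\<phi> (?\<tau> k)\<close> absorbs.\<close>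

lemma MRA_projection_expansion:
  fixes \<phi> :: "real ^ 'n \<Rightarrow> complex" and T :: "(real ^ 'n \<Rightarrow> complex) \<Rightarrow> complex"
    and x0 :: "real ^ 'n" and j :: nat
  assumes \<phi>: "\<phi> \<in> schwartz_space" and T: "schwartz_functional T"
  defines "t \<equiv> 2 ^ j *\<^sub>R x0 - lattice_point (floor_vec (2 ^ j *\<^sub>R x0))"
  shows "(\<lambda>k. \<phi> (t + lattice_point (lattice_enum k)) *
      dilated T x0 j (\<lambda>z. cnj (\<phi> (t + lattice_point (lattice_enum k) + 1 *\<^sub>R z)))) sums MRA_projection \<phi> (int j) T x0"
proof -
  interpret T: schwartz_functional T by fact
  interpret Tj: schwartz_functional "dilated T x0 j" by (rule schwartz_functional_dilated[OF T])
  let ?h = "\<lambda>x. cnj (\<phi> x)"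
  have h: "?h \<in> schwartz_space" by (rule schwartz_cnj[OF \<phi>])
  let ?\<tau> = "\<lambda>k. t + lattice_point (lattice_enum k :: int ^ 'n)"
  let ?g = "\<lambda>a z. ?h (a + 1 *\<^sub>R z)"
  let ?f = "\<lambda>k z. \<phi> (?\<tau> k) * ?g (?\<tau> k) z"
  have t: "t \<in> unit_cube" unfolding t_def by (rule floor_vec_unit_cube)
  have g: "?g a \<in> schwartz_space" for a by (rule schwartz_affine[OF h]) simp
  have "\<forall>N. \<exists>A. sbound N \<phi> A" using \<phi> schwartz_iff by blast
  then obtain A where A: "\<And>N. sbound N \<phi> (A N)" by metis
  define a where "a N k = 9 ^ CARD('n) * A (N + 2 * CARD('n)) * lattice_weight (lattice_enum k :: int ^ 'n) * A N" for N k
  have f: "?f k \<in> schwartz_space" for k by (rule schwartz_cmult[OF g])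
  have fa: "sbound N (?f k) (a N k)" for N k
  proof (rule sbound_le[OF sbound_cmult[OF schwartz_smooth[OF g] sbound_translate[OF schwartz_smooth[OF h]
        sbound_cnj[OF schwartz_smooth[OF \<phi>] A]]]])
    have "(1 + norm (?\<tau> k)) ^ N * norm (\<phi> (?\<tau> k)) * A N \<le>
        9 ^ CARD('n) * A (N + 2 * CARD('n)) * lattice_weight (lattice_enum k :: int ^ 'n) * A N"
      by (rule mult_right_mono[OF schwartz_lattice_decay[OF A unit_cube_bounded[OF t]] sbound_nonneg[OF A]])
    then show "norm (\<phi> (?\<tau> k)) * ((1 + norm (?\<tau> k)) ^ N * A N) \<le> a N k"
      unfolding a_def by (simp only: mult_ac)
  qed
  have as: "summable (a N)" for N
    unfolding a_def by (intro summable_mult2 summable_mult lattice_weight_enum_summable)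
  define \<psi> where "\<psi> z = (\<Sum>k. ?f k z)" for z
  have \<psi>: "\<psi> \<in> schwartz_space" unfolding \<psi>_def[abs_def] by (rule schwartz_suminf[OF f fa as])
  have "MRA_kernel \<phi> (int j) x0 y = 2 ^ (CARD('n) * j) * \<psi> (2 ^ j *\<^sub>R (y - x0))" for y
    unfolding MRA_kernel_def power_int_of_nat of_nat_mult[symmetric] MRA_kernel0_expansion[OF \<phi>] \<psi>_def t_def
    by (simp add: scaleR_diff_right)
  then have "MRA_projection \<phi> (int j) T x0 = T (\<lambda>y. 2 ^ (CARD('n) * j) * \<psi> (2 ^ j *\<^sub>R (y - x0)))"
    unfolding MRA_projection_def by (intro arg_cong[where f = T] ext)
  also have "\<dots> = dilated T x0 j \<psi>"
  proof -
    have "(\<lambda>y. \<psi> (- (2 ^ j *\<^sub>R x0) + 2 ^ j *\<^sub>R y)) \<in> schwartz_space" by (rule schwartz_affine[OF \<psi>]) simp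
    then have "(\<lambda>y. \<psi> (2 ^ j *\<^sub>R (y - x0))) \<in> schwartz_space" by (simp add: scaleR_diff_right)
    from T.cmult[OF this] show ?thesis by (simp add: dilated_def)
  qed
  finally have "MRA_projection \<phi> (int j) T x0 = dilated T x0 j (\<lambda>z. \<Sum>k. ?f k z)"
    unfolding \<psi>_def[abs_def] .
  moreover have "(\<lambda>k. dilated T x0 j (?f k)) sums dilated T x0 j (\<lambda>z. \<Sum>k. ?f k z)"
    by (rule Tj.suminf[OF f fa as])
  moreover have "dilated T x0 j (?f k) = \<phi> (?\<tau> k) * dilated T x0 j (?g (?\<tau> k))" for k
    by (rule Tj.cmult[OF g])
  ultimately show ?thesis by simp
qed

theorem theorem1p1:
  fixes V :: "int \<Rightarrow> (real ^ 'n \<Rightarrow> complex) set"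
    and \<phi> :: "real ^ 'n \<Rightarrow> complex"
    and f :: "(real ^ 'n \<Rightarrow> complex) \<Rightarrow> complex"
    and x0 :: "real ^ 'n"
    and \<gamma> :: complex
  assumes "MRA V"
    and "scaling_function V \<phi>"
    and "\<phi> \<in> schwartz_space"
    and "tempered_distribution f"
    and "has_point_value f x0 \<gamma>"
  shows "((\<lambda>j::int. MRA_projection \<phi> j f x0) \<longlongrightarrow> \<gamma>) at_top"
proof -
  note \<phi> = assms(3)
  have fF: "schwartz_functional f" by (rule tempered_distribution_schwartz_functional[OF assms(4)])
  \<comment> \<open>Subtracting \<open>\<gamma>\<close> times the integral makes all limits 0. The
    integral is invariant under the dilations, so the same amount is subtracted at every
    scale.\<close>
  define U where "U \<psi> = f \<psi> - \<gamma> * (LINT x|lborel. \<psi> x)" for \<psi>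
  have UF: "schwartz_functional U"
    unfolding U_def[abs_def] by (rule schwartz_functional_diff_cmult[OF fF schwartz_functional_integral])
  have dil: "dilated U x0 j \<psi> = dilated f x0 j \<psi> - \<gamma> * (LINT x|lborel. \<psi> x)" if "\<psi> \<in> schwartz_space" for j \<psi>
    unfolding dilated_integral[OF that, of x0 j, symmetric] by (simp add: dilated_def U_def algebra_simps)
  have lim_test: "(\<lambda>j. dilated U x0 j \<psi>) \<longlonglongrightarrow> 0" if "\<psi> \<in> test_functions_in_ball R" for \<psi> R
  proof -
    have "(\<lambda>j. dilated f x0 j \<psi> - \<gamma> * (LINT x|lborel. \<psi> x)) \<longlonglongrightarrow>
        \<gamma> * (LINT x|lborel. \<psi> x) - \<gamma> * (LINT x|lborel. \<psi> x)"
      by (intro tendsto_diff point_value_dilated[OF assms(5) that] tendsto_const)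
    then show ?thesis by (simp add: dil[OF test_functions_in_ball_schwartz[OF that]])
  qed
  have bounded: "\<exists>B. \<forall>j. norm (dilated U x0 j \<psi>) \<le> B" if "\<psi> \<in> test_functions_in_ball R" for \<psi> R
    using convergent_imp_Bseq[OF convergentI[OF lim_test[OF that]]] unfolding Bseq_def by (elim exE conjE) (rule exI)
  have "\<exists>N C. \<forall>j. \<forall>\<psi>\<in>schwartz_space. \<forall>A. sbound N \<psi> A \<longrightarrow> norm (dilated U x0 j \<psi>) \<le> C * A"
    by (rule dilated_equicontinuous[OF UF]) (erule bounded)
  then obtain N C0 where C0: "\<forall>j. \<forall>\<psi>\<in>schwartz_space. \<forall>A. sbound N \<psi> A \<longrightarrow> norm (dilated U x0 j \<psi>) \<le> C0 * A"
    by (elim exE)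
  define C where "C = \<bar>C0\<bar> + 1"
  have C: "C > 0" by (simp add: C_def)
  have equicont: "norm (dilated U x0 j \<psi>) \<le> C * A" if "\<psi> \<in> schwartz_space" "sbound N \<psi> A" for j \<psi> A
  proof -
    have "norm (dilated U x0 j \<psi>) \<le> C0 * A" using C0 that by simp
    also have "\<dots> \<le> C * A" by (intro mult_right_mono sbound_nonneg[OF that(2)]) (simp add: C_def)
    finally show ?thesis .
  qed
  have lim: "(\<lambda>j. dilated U x0 j \<psi>) \<longlonglongrightarrow> 0" if "\<psi> \<in> schwartz_space" for \<psi>
    by (rule dilated_tendsto_zero[OF UF _ _ that]) (erule lim_test, erule equicont, assumption)
  let ?h = "\<lambda>x. cnj (\<phi> x)"
  have h: "?h \<in> schwartz_space" by (rule schwartz_cnj[OF \<phi>])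
  let ?g = "\<lambda>a z. ?h (a + 1 *\<^sub>R z)"
  have g: "?g a \<in> schwartz_space" for a by (rule schwartz_affine[OF h]) simp
  define c where "c = (LINT x|lborel. \<phi> x)"
  have orth: "L2_inner (\<lambda>x. \<phi> (x - lattice_point m)) (\<lambda>x. \<phi> (x - lattice_point k)) = (if m = k then 1 else 0)" for m k
    using assms(2) by (simp add: scaling_function_def orthonormal_basis_def)
  note ge_one = norm_integral_scaling_function_ge_one[OF assms(1,2) \<phi>]
  have per: "periodization \<phi> x = c" for x
    unfolding c_def by (rule periodization_eq_integral[OF \<phi> orth ge_one])
  have cc: "c * cnj c = 1" unfolding c_def by (rule norm_integral_eq_one[OF \<phi> orth ge_one])
  have int_g: "(LINT z|lborel. ?g a z) = cnj c" for a
    using integral_lborel_translate(2)[OF smooth_borel_measurable[OF schwartz_smooth[OF h]], of a]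
    by (simp add: c_def add.commute)
  define t where "t j = 2 ^ j *\<^sub>R x0 - lattice_point (floor_vec (2 ^ j *\<^sub>R x0))" for j
  let ?\<tau> = "\<lambda>j k. t j + lattice_point (lattice_enum k :: int ^ 'n)"
  have t: "t j \<in> unit_cube" for j unfolding t_def by (rule floor_vec_unit_cube)
  obtain A where A: "sbound (N + 2 * CARD('n)) \<phi> A" "A > 0" by (rule schwartz_sbound[OF \<phi>])
  obtain B where B: "sbound N ?h B" "B > 0" by (rule schwartz_sbound[OF h])
  let ?a = "\<lambda>k j. \<phi> (?\<tau> j k) * dilated U x0 j (?g (?\<tau> j k))"
  let ?M = "\<lambda>k. C * B * (9 ^ CARD('n) * A * lattice_weight (lattice_enum k :: int ^ 'n))"
  \<comment> \<open>Equicontinuity loses a power of \<open>1 + norm (?\<tau> j k)\<close>, regained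
    from the decay of \<open>\<phi>\<close>. As \<open>t j\<close> stays in the unit cube, the
    majorant does not depend on \<open>j\<close>.\<close>
  have a_le: "norm (?a k j) \<le> ?M k" for k j
  proof -
    have "norm (dilated U x0 j (?g (?\<tau> j k))) \<le> C * ((1 + norm (?\<tau> j k)) ^ N * B)"
      by (rule equicont[OF g sbound_translate[OF schwartz_smooth[OF h] B(1)]])
    then have "norm (?a k j) \<le> norm (\<phi> (?\<tau> j k)) * (C * ((1 + norm (?\<tau> j k)) ^ N * B))"
      unfolding norm_mult by (rule mult_left_mono) simp
    also have "\<dots> = C * B * ((1 + norm (?\<tau> j k)) ^ N * norm (\<phi> (?\<tau> j k)))" by (simp only: mult_ac)
    also have "\<dots> \<le> ?M k"
      using C B(2) by (intro mult_left_mono schwartz_lattice_decay[OF A(1) unit_cube_bounded[OF t]]) simp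
    finally show ?thesis .
  qed
  have Ms: "summable ?M" by (intro summable_mult lattice_weight_enum_summable)
  have a_lim: "(\<lambda>j. ?a k j) \<longlonglongrightarrow> 0" for k
  proof -
    \<comment> \<open>For fixed \<open>k\<close> the translation vectors stay in a bounded set as
      \<open>j\<close> varies.\<close>
    have "norm (?\<tau> j k) \<le> 2 * CARD('n) + norm (lattice_point (lattice_enum k :: int ^ 'n))" for j
    proof -
      have "norm (t j) \<le> (\<Sum>i\<in>UNIV. \<bar>t j $ i\<bar>)" by (rule norm_le_l1_cart)
      also have "\<dots> \<le> (\<Sum>i\<in>(UNIV :: 'n set). 2)" by (rule sum_mono) (rule unit_cube_bounded[OF t])
      finally have "norm (t j) \<le> 2 * CARD('n)" by simp
      then show ?thesis by (rule norm_triangle_mono) simp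
    qed
    from equicontinuous_translates_tendsto_zero[OF schwartz_functional_dilated[OF UF] equicont C lim h this]
    have "(\<lambda>j. A * norm (dilated U x0 j (?g (?\<tau> j k)))) \<longlonglongrightarrow> A * 0"
      by (intro tendsto_mult_left tendsto_norm_zero)
    then have lim0: "(\<lambda>j. A * norm (dilated U x0 j (?g (?\<tau> j k)))) \<longlonglongrightarrow> 0" by simp
    have "norm (?a k j) \<le> A * norm (dilated U x0 j (?g (?\<tau> j k)))" for j
      unfolding norm_mult using sbound_norm_le'[OF A(1), of "[]"] by (intro mult_right_mono) simp_all
    then show ?thesis by (intro Lim_null_comparison[OF _ lim0] always_eventually allI)
  qed
  have "(\<lambda>j. \<Sum>k. ?a k j) \<longlonglongrightarrow> (\<Sum>k. 0)"
    using tannerys_theorem[where a = ?a and b = "\<lambda>_. 0" and M = ?M and F = sequentially, OF a_lim _ Ms]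
      a_le by (simp add: always_eventually)
  then have "(\<lambda>j. (\<Sum>k. ?a k j) + \<gamma>) \<longlonglongrightarrow> 0 + \<gamma>"
    by (intro tendsto_add tendsto_const) simp
  moreover have "MRA_projection \<phi> (int j) f x0 = (\<Sum>k. ?a k j) + \<gamma>" for j
  proof -
    note E = MRA_projection_expansion[OF \<phi> fF, of j x0, folded t_def]
    have "dilated f x0 j (?g a) = dilated U x0 j (?g a) + \<gamma> * cnj c" for a
      using dil[OF g, of j a] by (simp add: int_g[simplified])
    then have 1: "(\<lambda>k. ?a k j + \<phi> (?\<tau> j k) * (\<gamma> * cnj c)) sums MRA_projection \<phi> (int j) f x0"
      using E by (simp only: distrib_left)
    have 2: "(\<lambda>k. ?a k j) sums (\<Sum>k. ?a k j)"
      by (intro summable_sums summable_comparison_test'[OF Ms a_le])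
    \<comment> \<open>What was subtracted in \<open>U\<close> adds up to
      \<open>\<gamma> * cnj c\<close> times the periodization at \<open>t j\<close>. The
      periodization equals \<open>c\<close> wherever \<open>t j\<close> lies, and
      \<open>c * cnj c = 1\<close> leaves \<open>\<gamma>\<close> at every scale.\<close>
    have 3: "(\<lambda>k. \<phi> (?\<tau> j k) * (\<gamma> * cnj c)) sums \<gamma>"
    proof -
      have "(\<lambda>k. \<phi> (?\<tau> j k)) sums c"
        using summable_sums[OF summable_norm_cancel[OF periodization_suminf(2)[OF \<phi>]], of "t j"]
        unfolding periodization_suminf(1)[OF \<phi>, symmetric] per .
      then have "(\<lambda>k. \<phi> (?\<tau> j k) * (\<gamma> * cnj c)) sums (c * (\<gamma> * cnj c))" by (rule sums_mult2)
      then show ?thesis using cc by (simp add: mult.left_commute)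
    qed
    show ?thesis by (rule sums_unique2[OF 1 sums_add[OF 2 3]])
  qed
  ultimately have "(\<lambda>j. MRA_projection \<phi> (int j) f x0) \<longlonglongrightarrow> \<gamma>" by simp
  moreover have "filterlim nat sequentially at_top"
    unfolding filterlim_at_top
  proof
    fix Z :: nat
    show "eventually (\<lambda>j. Z \<le> nat j) at_top"
      by (rule eventually_mono[OF eventually_ge_at_top[of "int Z"]]) linarith
  qed
  ultimately have "((\<lambda>j. MRA_projection \<phi> (int (nat j)) f x0) \<longlongrightarrow> \<gamma>) at_top"
    by (rule filterlim_compose)
  then show ?thesis
    by (rule Lim_transform_eventually) (auto intro: eventually_mono[OF eventually_ge_at_top[of 0]])
qed

end
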